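(* Let $\mathcal{E}=\{W\subseteq\mathbb{P} : \mathbb{Z}\text{ is existentially definable in }R_W\}$. The following are equivalent. (1) The class $\mathcal{E}$ is not meager in $2^{\mathbb{P}}$. (2) There is a $\sigma\in 2^{<\mathbb{P}}$ and a single polynomial $g$ which existentially defines $\mathbb{Z}$ in all HTP-generic subrings $R_V$ with $V\in\mathcal{U}_\sigma$. (3) $\mathbb{P}\in\mathcal{E}$; that is, $\mathbb{Z}$ is existentially definable in $\mathbb{Q}$. (4) There is a single existential formula which defines $\mathbb{Z}$ in every subring of $\mathbb{Q}$.
   Context: $\mathbb{P}$ is the set of all prime numbers. For $W\subseteq\mathbb{P}$, $R_W=\mathbb{Z}[\frac1p : p\in W]$ is the corresponding subring of $\mathbb{Q}$ (every subring of $\mathbb{Q}$ has this form; $R_{\mathbb{P}}=\mathbb{Q}$). For a subring $R\subseteq\mathbb{Q}$, $\mathrm{HTP}(R)$ denotes the set of polynomials (each in finitely many variables, with coefficients in $\mathbb{Z}$ or, equivalently after clearing denominators, in $R$) that have a zero with all coordinates in $R$. Existential definability: in a ring $R\subseteq\mathbb{Q}$, a polynomial $g\in\mathbb{Z}[X,\vec{Y}]$ existentially defines $\mathbb{Z}$ if for every $q\in R$, $q\in\mathbb{Z}\iff g(q,\vec{Y})\in\mathrm{HTP}(R)$ (i.e. iff $g(q,\vec y)=0$ for some tuple $\vec y$ from $R$). $\mathbb{Z}$ is existentially definable in $R$ if such a polynomial $g$ exists. An existential formula in (4) means a parameter-free existential first-order formula, with one free variable, in the language of rings. Topology: the power set $2^{\mathbb{P}}$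 of $\mathbb{P}$ carries the Cantor-space (product) topology, identifying $W\subseteq\mathbb{P}$ with its characteristic function $\mathbb{P}\to\{0,1\}$. $2^{<\mathbb{P}}$ is the set of functions $\sigma$ from finite initial segments of $\mathbb{P}$ (in increasing order) to $\{0,1\}$, and $\mathcal{U}_\sigma=\{W\subseteq\mathbb{P} : \sigma\subset W\}$ is the basic open set of those $W$ whose characteristic function extends $\sigma$. A set is nowhere dense if its closure contains no nonempty open set, and meager if it is a countable union of nowhere dense sets. HTP-generic: for $f\in\mathbb{Z}[X_0,X_1,\ldots]$ let $\mathcal{A}(f)=\{W\subseteq\mathbb{P} : f\in\mathrm{HTP}(R_W)\}$ (an open set), and let $\mathcal{B}(f)=2^{\mathbb{P}}-\mathcal{A}(f)-\mathrm{Int}(2^{\mathbb{P}}-\mathcal{A}(f))$ be its topological boundary. A set $W\subseteq\mathbb{P}$, and the corresponding subring $R_W$, is HTP-generic if $W\notin\mathcal{B}(f)$ for every $f\in\mathbb{Z}[X_0,X_1,\ldots]$. *)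

theory Defs
  imports
    "HOL-Analysis.Analysis"
    "HOL-Library.Poly_Mapping"
    "HOL-Computational_Algebra.Primes"
begin

subsection \<open>Subrings of the rationals\<close>

definition is_subring :: "rat set \<Rightarrow> bool" where
  "is_subring R \<longleftrightarrow>
     1 \<in> R \<and> (\<forall>x\<in>R. \<forall>y\<in>R. x - y \<in> R) \<and> (\<forall>x\<in>R. \<forall>y\<in>R. x * y \<in> R)"

abbreviation Primes :: "nat set" ("\<P>") where
  "\<P> \<equiv> {p. prime p}"

definition R_of :: "nat set \<Rightarrow> rat set" where
  "R_of W = is_subring hull ((\<lambda>p. 1 / of_nat p) ` W)"

lemma is_subring_R_of: "is_subring (R_of W)"
  unfolding R_of_def by (rule hull_in) (auto simp: is_subring_def)

lemma R_of_Primes: "R_of \<P> = UNIV"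
proof -
  let ?R = "R_of \<P>"
  have one: "1 \<in> ?R"
    using is_subring_R_of[of \<P>] by (simp add: is_subring_def)
  have diff: "x - y \<in> ?R" and mult: "x * y \<in> ?R" if "x \<in> ?R" "y \<in> ?R" for x y
    using is_subring_R_of[of \<P>] that by (auto simp: is_subring_def)
  have zero: "0 \<in> ?R" using diff[OF one one] by simp
  have neg: "- x \<in> ?R" if "x \<in> ?R" for x using diff[OF zero that] by simp
  have add: "x + y \<in> ?R" if "x \<in> ?R" "y \<in> ?R" for x y
    using diff[OF that(1) neg[OF that(2)]] by simp
  have nat: "of_nat n \<in> ?R" for n
    by (induction n) (auto intro: zero one add)
  have int: "of_int k \<in> ?R" for k
    by (cases k) (use nat neg[OF nat] in \<open>auto simp del: of_nat_Suc\<close>)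
  have inv: "1 / of_nat n \<in> ?R" if "n > 0" for n
    using that
  proof (induction n rule: prime_divisors_induct)
    case (factor p n)
    have "1 / of_nat p \<in> (\<lambda>p. 1 / of_nat p :: rat) ` \<P>"
      using factor.hyps by blast
    then have "1 / of_nat p \<in> ?R"
      unfolding R_of_def by (rule hull_inc)
    with factor have "(1 / of_nat p) * (1 / of_nat n) \<in> ?R"
      by (intro mult) auto
    then show ?case by simp
  qed (use one in auto)
  have "q \<in> ?R" for q
  proof (cases q)
    case (Fract a b)
    have "q = of_int a * (1 / of_nat (nat b))"
      using Fract by (simp add: Fract_of_int_quotient)
    moreover have "\<dots> \<in> ?R"
      by (intro mult int inv) (use Fract in simp)
    ultimately show ?thesis by simp
  qed
  then show ?thesis by blast
qed


subsection \<open>Polynomials over the integers and \<open>HTP\<close>\<close>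

text \<open>
  \<open>\<int>[X\<^sub>0, X\<^sub>1, \<dots>]\<close>, as finitely supported maps from monomials (finitely supported
  exponent functions) to coefficients.
\<close>
type_synonym zpoly = "(nat \<Rightarrow>\<^sub>0 nat) \<Rightarrow>\<^sub>0 int"

definition eval_poly :: "zpoly \<Rightarrow> (nat \<Rightarrow> rat) \<Rightarrow> rat" where
  "eval_poly f x =
     (\<Sum>m\<in>Poly_Mapping.keys f. of_int (Poly_Mapping.lookup f m) *
        (\<Prod>i\<in>Poly_Mapping.keys m. x i ^ Poly_Mapping.lookup m i))"

text \<open>
  A zero assigns a value to every variable; those not occurring in \<open>f\<close> are irrelevant.
\<close>
definition HTP :: "rat set \<Rightarrow> zpoly set" where
  "HTP R = {f. \<exists>x. (\<forall>i. x i \<in> R) \<and> eval_poly f x = 0}"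

text \<open>
  In \<open>g(X, Y)\<close>, \<open>X\<close> is the variable with index 0 and \<open>Y\<close> consists of all the others.
\<close>
definition ex_defines_Z :: "zpoly \<Rightarrow> rat set \<Rightarrow> bool" where
  "ex_defines_Z g R \<longleftrightarrow>
     (\<forall>q\<in>R. q \<in> \<int> \<longleftrightarrow> (\<exists>y. (\<forall>i. y i \<in> R) \<and> eval_poly g (case_nat q y) = 0))"

definition Z_ex_definable :: "rat set \<Rightarrow> bool" where
  "Z_ex_definable R \<longleftrightarrow> (\<exists>g. ex_defines_Z g R)"


subsection \<open>First-order formulas in the language of rings\<close>

datatype rterm =
    Var nat | Zero | One | Minus rterm | Add rterm rterm | Mult rterm rterm

datatype fm =
    Eq rterm rterm | Neg fm | Conj fm fm | Disj fm fm | Exists nat fm | Forall nat fm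

primrec tval :: "(nat \<Rightarrow> rat) \<Rightarrow> rterm \<Rightarrow> rat" where
  "tval e (Var i) = e i"
| "tval e Zero = 0"
| "tval e One = 1"
| "tval e (Minus s) = - tval e s"
| "tval e (Add s t) = tval e s + tval e t"
| "tval e (Mult s t) = tval e s * tval e t"

primrec sat :: "rat set \<Rightarrow> (nat \<Rightarrow> rat) \<Rightarrow> fm \<Rightarrow> bool" where
  "sat R e (Eq s t) \<longleftrightarrow> tval e s = tval e t"
| "sat R e (Neg \<phi>) \<longleftrightarrow> \<not> sat R e \<phi>"
| "sat R e (Conj \<phi> \<psi>) \<longleftrightarrow> sat R e \<phi> \<and> sat R e \<psi>"
| "sat R e (Disj \<phi> \<psi>) \<longleftrightarrow> sat R e \<phi> \<or> sat R e \<psi>"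
| "sat R e (Exists i \<phi>) \<longleftrightarrow> (\<exists>a\<in>R. sat R (e(i := a)) \<phi>)"
| "sat R e (Forall i \<phi>) \<longleftrightarrow> (\<forall>a\<in>R. sat R (e(i := a)) \<phi>)"

primrec tvars :: "rterm \<Rightarrow> nat set" where
  "tvars (Var i) = {i}"
| "tvars Zero = {}"
| "tvars One = {}"
| "tvars (Minus s) = tvars s"
| "tvars (Add s t) = tvars s \<union> tvars t"
| "tvars (Mult s t) = tvars s \<union> tvars t"

primrec fvars :: "fm \<Rightarrow> nat set" where
  "fvars (Eq s t) = tvars s \<union> tvars t"
| "fvars (Neg \<phi>) = fvars \<phi>"
| "fvars (Conj \<phi> \<psi>) = fvars \<phi> \<union> fvars \<psi>"
| "fvars (Disj \<phi> \<psi>) = fvars \<phi> \<union> fvars \<psi>"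
| "fvars (Exists i \<phi>) = fvars \<phi> - {i}"
| "fvars (Forall i \<phi>) = fvars \<phi> - {i}"

primrec qfree :: "fm \<Rightarrow> bool" where
  "qfree (Eq s t) \<longleftrightarrow> True"
| "qfree (Neg \<phi>) \<longleftrightarrow> qfree \<phi>"
| "qfree (Conj \<phi> \<psi>) \<longleftrightarrow> qfree \<phi> \<and> qfree \<psi>"
| "qfree (Disj \<phi> \<psi>) \<longleftrightarrow> qfree \<phi> \<and> qfree \<psi>"
| "qfree (Exists i \<phi>) \<longleftrightarrow> False"
| "qfree (Forall i \<phi>) \<longleftrightarrow> False"

inductive existential :: "fm \<Rightarrow> bool" where
  "qfree \<phi> \<Longrightarrow> existential \<phi>"
| "existential \<phi> \<Longrightarrow> existential (Exists i \<phi>)"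

text \<open>The formula \<open>\<phi>\<close> with free variable \<open>v\<close> defines \<open>\<int>\<close> in \<open>R\<close>, without parameters.\<close>
definition fm_defines_Z :: "fm \<Rightarrow> nat \<Rightarrow> rat set \<Rightarrow> bool" where
  "fm_defines_Z \<phi> v R \<longleftrightarrow>
     fvars \<phi> = {v} \<and> (\<forall>e. (\<forall>i. e i \<in> R) \<longrightarrow> (sat R e \<phi> \<longleftrightarrow> e v \<in> \<int>))"


subsection \<open>The Cantor space of sets of primes\<close>

definition cantor_top :: "nat set topology" where
  "cantor_top =
     pullback_topology (Pow \<P>) (\<lambda>W. \<lambda>p\<in>\<P>. p \<in> W)
       (product_topology (\<lambda>_. discrete_topology (UNIV :: bool set)) \<P>)"

lemma topspace_cantor_top: "topspace cantor_top = Pow \<P>"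
  by (auto simp: cantor_top_def topspace_pullback_topology)

definition nowhere_dense_in :: "'a topology \<Rightarrow> 'a set \<Rightarrow> bool" where
  "nowhere_dense_in X S \<longleftrightarrow> S \<subseteq> topspace X \<and> X interior_of (X closure_of S) = {}"

definition meager_in :: "'a topology \<Rightarrow> 'a set \<Rightarrow> bool" where
  "meager_in X S \<longleftrightarrow> (\<exists>F. countable F \<and> (\<forall>A\<in>F. nowhere_dense_in X A) \<and> S = \<Union>F)"

text \<open>Partial functions whose domain is a finite initial segment of the primes.\<close>
definition fin_strings :: "(nat \<rightharpoonup> bool) set" where
  "fin_strings =
     {\<sigma>. finite (dom \<sigma>) \<and> dom \<sigma> \<subseteq> \<P> \<and> (\<forall>p\<in>dom \<sigma>. \<forall>q\<in>\<P>. q < p \<longrightarrow> q \<in> dom \<sigma>)}"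

definition basic_open :: "(nat \<rightharpoonup> bool) \<Rightarrow> nat set set" where
  "basic_open \<sigma> = {W. W \<subseteq> \<P> \<and> (\<forall>p\<in>dom \<sigma>. \<sigma> p = Some (p \<in> W))}"


subsection \<open>HTP-genericity\<close>

definition A_set :: "zpoly \<Rightarrow> nat set set" where
  "A_set f = {W. W \<subseteq> \<P> \<and> f \<in> HTP (R_of W)}"

definition B_set :: "zpoly \<Rightarrow> nat set set" where
  "B_set f = Pow \<P> - A_set f - cantor_top interior_of (Pow \<P> - A_set f)"

definition HTP_generic :: "nat set \<Rightarrow> bool" where
  "HTP_generic W \<longleftrightarrow> W \<subseteq> \<P> \<and> (\<forall>f. W \<notin> B_set f)"

definition E_class :: "nat set set" where
  "E_class = {W. W \<subseteq> \<P> \<and> Z_ex_definable (R_of W)}"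

end

theory Submission
  imports Defs "HOL-Number_Theory.Number_Theory" "HOL-Computational_Algebra.Squarefree"
begin

text \<open>
  A cycle of implications. If \<open>E_class\<close> is not meager, then, as there are only countably many
  polynomials, a single \<open>g\<close> defines \<open>\<int>\<close> in \<open>R_of W\<close> for a set of \<open>W\<close> that is dense in some
  \<open>basic_open \<sigma>\<close>. Solvability of a fixed equation is an open condition on \<open>W\<close>, and an HTP-generic
  \<open>V\<close> decides every such condition on a whole neighbourhood; comparing \<open>V\<close> with nearby members of
  the dense set shows that \<open>g\<close> works in \<open>R_of V\<close> too (\<open>nonmeager_imp_generic_definition\<close>).

  Next, let \<open>S\<close> be the finite set of primes that \<open>\<sigma>\<close> excludes. HTP-generic sets are dense by the
  Baire argument (\<open>generic_dense\<close>), and approximating \<open>\<P> - S\<close> by generic sets shows that the same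
  \<open>g\<close> defines \<open>\<int>\<close> in the semilocal ring \<open>R_of (\<P> - S)\<close>. It remains to define this ring in \<open>\<rat>\<close>
  by a Diophantine formula, which is where the arithmetic lies. It suffices to find, for each prime
  \<open>q\<close>, a Diophantine set of rationals between \<open>\<int>\<close> and the rationals with denominator prime to \<open>q\<close>:
  every element of the semilocal ring is then \<open>a / (1 + N c)\<close> with \<open>a\<close>, \<open>c\<close> in the intersection of
  these sets and \<open>N\<close> the product of \<open>S\<close>.

  Such a set comes from the norm form of a quaternion algebra \<open>(r, p)\<close> that is ramified at \<open>q\<close>:
  the solvability of \<open>1 + p (x\<^sup>2 - r W\<^sup>2) = E\<^sup>2 - r F\<^sup>2\<close> in rationals bounds the
  power of \<open>q\<close> in the denominator of \<open>x\<close>, because the form is anisotropic at \<open>q\<close>. That the equation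
  is solvable for every integer \<open>x\<close> divisible by \<open>2 r\<close> is a case of the Hasse principle for
  quaternary forms (\<open>integer_represented\<close>). It is proved in the classical way: an auxiliary prime
  \<open>l\<close> with suitable Legendre symbols splits the quaternary equation into two conics, and these have
  rational points by Legendre's theorem (\<open>legendre_conic\<close>). Only the quadratic symbols of \<open>l\<close> are
  prescribed, so the part of Dirichlet's theorem on primes that is needed involves real characters
  only (\<open>prime_with_prescribed_real_chars\<close>); Mertens' elementary argument proves it.

  Finally, a definition over \<open>\<rat>\<close> passes to subrings by writing the rational unknowns as fractions with
  a common denominator. In a formula one may simply state that the denominator is not zero, so one
  existential formula serves all subrings. In a polynomial one takes denominators of the form
  \<open>(2 v - 1) (3 w - 1)\<close>, which have no zero if neither 2 nor 3 is inverted, and which can be chosen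
  divisible by any given positive integer. This gives a nonempty open set inside
  \<open>E_class\<close>, which therefore is not meager, by Baire again.
\<close>

section \<open>Primes with prescribed values of real characters\<close>

text \<open>
  A real character modulo \<open>N\<close>: a completely multiplicative, \<open>N\<close>-periodic function with values \<open>1\<close>
  and \<open>-1\<close> on the residues prime to \<open>N\<close> and \<open>0\<close> on the others. A value \<open>-1\<close> occurs
  exactly if the character is not principal.
\<close>
definition real_char :: "nat \<Rightarrow> (nat \<Rightarrow> real) \<Rightarrow> bool" where
  "real_char N \<psi> \<longleftrightarrow> N > 0 \<and> (\<forall>a b. \<psi> (a * b) = \<psi> a * \<psi> b) \<and> (\<forall>a. \<psi> (a + N) = \<psi> a) \<and>
     (\<forall>a. \<psi> a \<in> {-1, 0, 1}) \<and> (\<forall>a. \<psi> a \<noteq> 0 \<longleftrightarrow> coprime a N)"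

lemma real_charD:
  assumes "real_char N \<psi>"
  shows "N > 0" "\<psi> (a * b) = \<psi> a * \<psi> b" "\<psi> (a + N) = \<psi> a" "\<psi> a \<in> {-1, 0, 1}"
    "\<psi> a \<noteq> 0 \<longleftrightarrow> coprime a N" "\<bar>\<psi> a\<bar> \<le> 1"
proof -
  show "N > 0" "\<psi> (a * b) = \<psi> a * \<psi> b" "\<psi> (a + N) = \<psi> a" "\<psi> a \<in> {-1, 0, 1}"
    "\<psi> a \<noteq> 0 \<longleftrightarrow> coprime a N"
    using assms unfolding real_char_def by blast+
  then show "\<bar>\<psi> a\<bar> \<le> 1" by auto
qed

lemma real_char_one:
  assumes "real_char N \<psi>" shows "\<psi> 1 = 1"
proof -
  have "\<psi> 1 = \<psi> 1 * \<psi> 1" using real_charD(2)[OF assms, of 1 1] by simp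
  moreover have "\<psi> 1 \<noteq> 0" using real_charD(5)[OF assms, of 1] by simp
  ultimately show ?thesis by simp
qed

lemma real_char_power:
  assumes "real_char N \<psi>" shows "\<psi> (a ^ k) = \<psi> a ^ k"
  by (induction k) (use real_char_one[OF assms] in \<open>simp_all add: real_charD(2)[OF assms]\<close>)

lemma real_char_mult:
  assumes "real_char N \<psi>" "real_char N \<phi>" shows "real_char N (\<lambda>n. \<psi> n * \<phi> n)"
proof -
  have "\<psi> a * \<phi> a \<in> {-1, 0, 1}" for a
    using real_charD(4)[OF assms(1), of a] real_charD(4)[OF assms(2), of a] by auto
  then show ?thesis
    using real_charD[OF assms(1)] real_charD[OF assms(2)] unfolding real_char_def by simp
qed

lemma real_char_mod:
  assumes "real_char N \<psi>" shows "\<psi> (a mod N) = \<psi> a"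
proof -
  have "\<psi> (b + k * N) = \<psi> b" for b k
  proof (induction k)
    case (Suc k)
    then show ?case using real_charD(3)[OF assms, of "b + k * N"] by (simp add: algebra_simps)
  qed simp
  from this[of "a mod N" "a div N"] show ?thesis by simp
qed

lemma real_char_sum_period:
  assumes \<psi>: "real_char N \<psi>" and a: "\<psi> a = -1"
  shows "(\<Sum>n<N. \<psi> n) = 0"
proof -
  have cop: "coprime a N" using real_charD(5)[OF \<psi>, of a] a by simp
  have N: "N > 0" using real_charD(1)[OF \<psi>] .
  have inj: "inj_on (\<lambda>n. (a * n) mod N) {..<N}"
  proof (rule inj_onI)
    fix x y assume "x \<in> {..<N}" "y \<in> {..<N}" "(a * x) mod N = (a * y) mod N"
    then have "[x = y] (mod N)" using cop cong_mult_lcancel_nat unfolding cong_def by blast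
    with \<open>x \<in> _\<close> \<open>y \<in> _\<close> show "x = y" by (simp add: cong_def)
  qed
  have img: "(\<lambda>n. (a * n) mod N) ` {..<N} = {..<N}"
    by (rule endo_inj_surj[OF _ _ inj]) (use N in auto)
  have "(\<Sum>n<N. \<psi> n) = (\<Sum>n\<in>(\<lambda>n. (a * n) mod N) ` {..<N}. \<psi> n)" by (simp only: img)
  also have "\<dots> = (\<Sum>n<N. \<psi> ((a * n) mod N))" by (subst sum.reindex[OF inj]) simp
  also have "\<dots> = (\<Sum>n<N. - \<psi> n)" by (simp add: real_char_mod[OF \<psi>] real_charD(2)[OF \<psi>] a)
  finally show ?thesis by (simp add: sum_negf)
qed

text \<open>
  The sum over a full period vanishes, since multiplication by \<open>a\<close> permutes the residues and changes
  the sign of each term. Hence the partial sums are periodic.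
\<close>
lemma real_char_partial_sums:
  assumes \<psi>: "real_char N \<psi>" and a: "\<psi> a = -1"
  shows "\<bar>\<Sum>n=m..k. \<psi> n\<bar> \<le> 2 * N"
proof -
  define P where "P k = (\<Sum>n<k. \<psi> n)" for k
  have N: "N > 0" using real_charD(1)[OF \<psi>] .
  have per: "P (k + N) = P k" for k
  proof (induction k)
    case 0 then show ?case using real_char_sum_period[OF \<psi> a] by (simp add: P_def)
  next
    case (Suc k) then show ?case using real_charD(3)[OF \<psi>, of k] by (simp add: P_def)
  qed
  have "P (j + i * N) = P j" for j i
  proof (induction i)
    case (Suc i)
    then show ?case using per[of "j + i * N"] by (simp add: algebra_simps)
  qed simp
  from this[of "k mod N" "k div N" for k] have P: "P k = P (k mod N)" for k by simp
  have bd: "\<bar>P k\<bar> \<le> N" for k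
  proof -
    have "\<bar>P (k mod N)\<bar> \<le> (\<Sum>n<k mod N. \<bar>\<psi> n\<bar>)" unfolding P_def by (rule sum_abs)
    also have "\<dots> \<le> (\<Sum>n<k mod N. 1)" by (intro sum_mono real_charD(6)[OF \<psi>])
    also have "\<dots> \<le> N" using N by (simp add: less_imp_le)
    finally show ?thesis using P[of k] by simp
  qed
  show ?thesis
  proof (cases "m \<le> Suc k")
    case True
    have "P (Suc k) = P m + (\<Sum>n=m..k. \<psi> n)"
      unfolding P_def using True
      by (metis atLeast0LessThan atLeastLessThanSuc_atLeastAtMost le0 sum.atLeastLessThan_concat)
    then show ?thesis using bd[of m] bd[of "Suc k"] by linarith
  qed simp
qed

text \<open>
  Summation by parts; the differences of a decreasing weight telescope.
\<close>
lemma abel_summation_bound: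
  fixes c g :: "nat \<Rightarrow> real"
  assumes C: "\<And>k. k \<le> b \<Longrightarrow> \<bar>\<Sum>n=a..k. c n\<bar> \<le> C"
    and dec: "\<And>n. a \<le> n \<Longrightarrow> n < b \<Longrightarrow> g (Suc n) \<le> g n" and pos: "g b \<ge> 0" and ab: "a \<le> b"
  shows "\<bar>\<Sum>n=a..b. c n * g n\<bar> \<le> C * g a"
proof -
  define S where "S k = (\<Sum>n=a..k. c n)" for k
  have "(\<Sum>n=a..b. c n * g n) = g b * S b + (\<Sum>n=a..<b. (g n - g (Suc n)) * S n)"
    using ab
  proof (induction b rule: nat_induct_at_least)
    case base then show ?case by (simp add: S_def)
  next
    case (Suc n)
    then show ?case by (simp add: S_def algebra_simps)
  qed
  also have "\<bar>\<dots>\<bar> \<le> \<bar>g b * S b\<bar> + (\<Sum>n=a..<b. \<bar>(g n - g (Suc n)) * S n\<bar>)"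
    by (rule order_trans[OF abs_triangle_ineq]) (use sum_abs in auto)
  also have "\<dots> \<le> g b * C + (\<Sum>n=a..<b. (g n - g (Suc n)) * C)"
    using C dec pos unfolding S_def
    by (intro add_mono sum_mono) (auto simp: abs_mult intro!: mult_mono)
  also have "(\<Sum>n=a..<b. (g n - g (Suc n)) * C) = (g a - g b) * C"
    using ab by (induction b rule: nat_induct_at_least) (auto simp: algebra_simps)
  finally show ?thesis by (simp add: algebra_simps)
qed

text \<open>
  Both sides sum \<open>f d e\<close> over the pairs with \<open>d * e \<le> x\<close>.
\<close>
lemma sum_divisors_swap:
  fixes f :: "nat \<Rightarrow> nat \<Rightarrow> real"
  shows "(\<Sum>n=1..x. \<Sum>d | d dvd n. f d (n div d)) = (\<Sum>d=1..x. \<Sum>e=1..x div d. f d e)"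
proof -
  have "(\<Sum>n=1..x. \<Sum>d | d dvd n. f d (n div d)) = (\<Sum>(n, d)\<in>Sigma {1..x} (\<lambda>n. {d. d dvd n}). f d (n div d))"
    by (subst sum.Sigma) auto
  also have "\<dots> = (\<Sum>(d, e)\<in>Sigma {1..x} (\<lambda>d. {1..x div d}). f d e)"
  proof (rule sum.reindex_bij_witness[where i = "\<lambda>(d, e). (d * e, d)" and j = "\<lambda>(n, d). (d, n div d)"])
    fix a assume "a \<in> Sigma {1..x} (\<lambda>n. {d. d dvd n})"
    then obtain n d where a: "a = (n, d)" "1 \<le> n" "n \<le> x" "d dvd n" by auto
    then have "d > 0" "d \<le> n" using dvd_imp_le by (auto intro: Nat.gr0I)
    with a show "(case case a of (n, d) \<Rightarrow> (d, n div d) of (d, e) \<Rightarrow> (d * e, d)) = a"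
      "(case a of (n, d) \<Rightarrow> (d, n div d)) \<in> Sigma {1..x} (\<lambda>d. {1..x div d})"
      "(case case a of (n, d) \<Rightarrow> (d, n div d) of (d, e) \<Rightarrow> f d e) = (case a of (n, d) \<Rightarrow> f d (n div d))"
      by (auto simp: div_le_mono Suc_le_eq div_greater_zero_iff)
  next
    fix b assume "b \<in> Sigma {1..x} (\<lambda>d. {1..x div d})"
    then obtain d e where b: "b = (d, e)" "1 \<le> d" "1 \<le> e" "e \<le> x div d" by auto
    then have "d * e \<le> x" by (metis less_eq_div_iff_mult_less_eq mult.commute less_le_trans zero_less_one)
    with b show "(case case b of (d, e) \<Rightarrow> (d * e, d) of (n, d) \<Rightarrow> (d, n div d)) = b"
      "(case b of (d, e) \<Rightarrow> (d * e, d)) \<in> Sigma {1..x} (\<lambda>n. {d. d dvd n})"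
      by auto
  qed
  also have "\<dots> = (\<Sum>d=1..x. \<Sum>e=1..x div d. f d e)"
    by (subst sum.Sigma) auto
  finally show ?thesis .
qed

text \<open>
  The value \<open>L(1, \<psi>)\<close>, with the rate of convergence that the later estimates rely on.
\<close>
lemma real_char_L_value:
  assumes \<psi>: "real_char N \<psi>" and a: "\<psi> a = -1"
  obtains L where "\<And>k. \<bar>(\<Sum>n=1..k. \<psi> n / n) - L\<bar> \<le> 2 * real N / (real k + 1)"
proof -
  define s where "s k = (\<Sum>n=1..k. \<psi> n / n)" for k
  have diff: "\<bar>s k' - s k\<bar> \<le> 2 * real N / (real k + 1)" if "k \<le> k'" for k k'
  proof (cases "k = k'")
    case False
    have "\<bar>\<Sum>n=Suc k..k'. \<psi> n * (1 / n)\<bar> \<le> (2 * N) * (1 / Suc k)"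
      by (rule abel_summation_bound[OF real_char_partial_sums[OF \<psi> a]])
        (use False that in \<open>auto simp: field_simps\<close>)
    moreover have "s k' - s k = (\<Sum>n=Suc k..k'. \<psi> n * (1 / n))"
      using sum.ub_add_nat[of 1 k "\<lambda>n. \<psi> n / n" "k' - k"] that unfolding s_def by simp
    ultimately show ?thesis by (simp add: add.commute)
  qed simp
  have tend: "(\<lambda>k. 2 * real N / (real k + 1)) \<longlonglongrightarrow> 0" by real_asymp
  have "Cauchy s"
  proof (rule CauchyI')
    fix e :: real assume "e > 0"
    from order_tendstoD(2)[OF tend this] obtain M where M: "\<And>k. k \<ge> M \<Longrightarrow> 2 * real N / (real k + 1) < e"
      by (auto simp: eventually_sequentially)
    have "dist (s m) (s n) < e" if "m \<ge> M" "n > m" for m n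
      using diff[of m n] M[of m] that by (simp add: dist_real_def abs_minus_commute)
    then show "\<exists>M. \<forall>m\<ge>M. \<forall>n>m. dist (s m) (s n) < e" by blast
  qed
  then obtain L where L: "s \<longlonglongrightarrow> L" using Cauchy_convergent convergent_def by blast
  have "\<bar>s k - L\<bar> \<le> 2 * real N / (real k + 1)" for k
  proof (rule tendsto_upperbound)
    show "(\<lambda>k'. \<bar>s k - s k'\<bar>) \<longlonglongrightarrow> \<bar>s k - L\<bar>" by (intro tendsto_intros L)
    show "\<forall>\<^sub>F k' in sequentially. \<bar>s k - s k'\<bar> \<le> 2 * real N / (real k + 1)"
      using eventually_ge_at_top[of k] 
    proof eventually_elim
      case (elim k')
      then show ?case using diff[OF elim] by (simp add: abs_minus_commute add.commute)
    qed
  qed simp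
  then show ?thesis using that unfolding s_def by blast
qed

text \<open>
  The divisor sum is multiplicative, and at a prime power it is \<open>1 + \<psi> p + \<dots> + \<psi> p ^ k\<close>, which is
  nonnegative, and at least \<open>1\<close> if \<open>k\<close> is even.
\<close>
lemma real_char_divisor_sum:
  assumes \<psi>: "real_char N \<psi>" and "n > 0"
  shows "0 \<le> (\<Sum>d | d dvd n. \<psi> d) \<and> ((\<forall>p. prime p \<longrightarrow> even (multiplicity p n)) \<longrightarrow> 1 \<le> (\<Sum>d | d dvd n. \<psi> d))"
  using \<open>n > 0\<close>
proof (induction n rule: less_induct)
  case (less n)
  show ?case
  proof (cases "n = 1")
    case True
    then show ?thesis using real_char_one[OF \<psi>] by simp
  next
    case False
    then obtain p where p: "prime p" "p dvd n" using prime_factor_nat by blast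
    define k where "k = multiplicity p n"
    define m where "m = n div p ^ k"
    have n: "n = p ^ k * m" unfolding k_def m_def by (simp add: multiplicity_dvd)
    have k: "k > 0" unfolding k_def using p less.prems by (simp add: prime_multiplicity_gt_zero_iff)
    have pm: "\<not> p dvd m"
      unfolding m_def k_def using less.prems p(1) by (intro multiplicity_decompose) auto
    have "1 < p ^ k" using one_less_power[OF prime_gt_1_nat[OF p(1)] k] .
    then have m: "m > 0" "m < n" using n less.prems by (auto intro!: Nat.gr0I)
    let ?F = "\<lambda>n. \<Sum>d | d dvd n. \<psi> d"
    have cop: "coprime p m" using p(1) pm by (simp add: prime_imp_coprime)
    have F: "?F n = (\<Sum>i\<le>k. \<psi> p ^ i) * ?F m"
    proof -
      have "(\<Sum>x\<in>{..k} \<times> {d. d dvd m}. \<psi> (p ^ fst x * snd x)) = ?F n"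
      proof (rule sum.reindex_bij_betw)
        show "bij_betw (\<lambda>x. p ^ fst x * snd x) ({..k} \<times> {d. d dvd m}) {d. d dvd n}"
          unfolding bij_betw_def
        proof
          show "inj_on (\<lambda>x. p ^ fst x * snd x) ({..k} \<times> {d. d dvd m})"
          proof (rule inj_onI, clarsimp)
            fix i d j e assume "d dvd m" "e dvd m" and eq: "p ^ i * d = p ^ j * e"
            then have nd: "\<not> p dvd d" "\<not> p dvd e" using pm by (auto dest: dvd_trans)
            have "multiplicity p (p ^ i * d) = i" "multiplicity p (p ^ j * e) = j"
              using nd p(1) by (auto intro!: multiplicity_eqI simp: prime_gt_0_nat)
            with eq have "i = j" by simp
            with eq p(1) show "i = j \<and> d = e" by (simp add: prime_gt_0_nat)
          qed
          show "(\<lambda>x. p ^ fst x * snd x) ` ({..k} \<times> {d. d dvd m}) = {d. d dvd n}"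
          proof (intro equalityI subsetI)
            fix x assume "x \<in> (\<lambda>x. p ^ fst x * snd x) ` ({..k} \<times> {d. d dvd m})"
            then show "x \<in> {d. d dvd n}" unfolding n by (auto intro!: mult_dvd_mono le_imp_power_dvd)
          next
            fix x assume "x \<in> {d. d dvd n}"
            then obtain u v where "x = u * v" "u dvd p ^ k" "v dvd m"
              unfolding n using division_decomp by blast
            then show "x \<in> (\<lambda>x. p ^ fst x * snd x) ` ({..k} \<times> {d. d dvd m})"
              using divides_primepow_nat[OF p(1)] by force
          qed
        qed
      qed
      then have "?F n = (\<Sum>x\<in>{..k} \<times> {d. d dvd m}. \<psi> (p ^ fst x * snd x))" by simp
      also have "\<dots> = (\<Sum>i\<le>k. \<Sum>d | d dvd m. \<psi> p ^ i * \<psi> d)"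
        by (simp add: sum.cartesian_product case_prod_beta real_charD(2)[OF \<psi>] real_char_power[OF \<psi>])
      also have "\<dots> = (\<Sum>i\<le>k. \<psi> p ^ i) * ?F m" by (simp add: sum_product)
      finally show ?thesis .
    qed
    have geo: "0 \<le> (\<Sum>i\<le>k. \<psi> p ^ i) \<and> (even k \<longrightarrow> 1 \<le> (\<Sum>i\<le>k. \<psi> p ^ i))"
    proof -
      consider "\<psi> p = -1" | "\<psi> p = 0" | "\<psi> p = 1" using real_charD(4)[OF \<psi>, of p] by auto
      then show ?thesis
      proof cases
        case 1
        have "(\<Sum>i\<le>k. (-1::real) ^ i) = (if even k then 1 else 0)" by (induction k) auto
        with 1 show ?thesis by simp
      qed (simp_all add: power_0_left)
    qed
    have IH: "0 \<le> ?F m" "(\<forall>q. prime q \<longrightarrow> even (multiplicity q m)) \<Longrightarrow> 1 \<le> ?F m"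
      using less.IH[OF m(2) m(1)] by auto
    have "1 \<le> ?F n" if ev: "\<forall>q. prime q \<longrightarrow> even (multiplicity q n)"
    proof -
      have "even (multiplicity q m)" if q: "prime q" for q
      proof (cases "q = p")
        case True
        then show ?thesis using pm by (simp add: not_dvd_imp_multiplicity_0)
      next
        case False
        then have "multiplicity q n = multiplicity q m"
          unfolding n using q p(1) m(1) by (subst prime_elem_multiplicity_mult_distrib)
            (auto simp: prime_elem_multiplicity_power_distrib prime_multiplicity_other prime_gt_0_nat)
        with ev q show ?thesis by metis
      qed
      then have "1 \<le> ?F m" using IH(2) by blast
      moreover have "even k" using ev p(1) by (simp add: k_def)
      ultimately have "1 * 1 \<le> (\<Sum>i\<le>k. \<psi> p ^ i) * ?F m" using geo by (intro mult_mono) auto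
      then show ?thesis using F by simp
    qed
    then show ?thesis using F geo IH(1) by simp
  qed
qed

text \<open>
  Let \<open>F\<close> be the divisor sum of \<open>\<psi>\<close>. By the previous lemma the squares alone make
  \<open>\<Sum>n\<le>x. F n * (x - n)\<close> at least of order \<open>x powr (3/2)\<close>. Written as a sum over divisors \<open>d\<close>, it is
  \<open>\<Sum>d\<le>x. \<psi> d * I d\<close> with \<open>I d = x\<^sup>2 / (2 * d) - x / 2\<close> up to an error of at most \<open>d\<close>. If
  \<open>L(1, \<psi>)\<close> were \<open>0\<close>, then the main term would nearly cancel for \<open>d \<le> D\<close>, and partial summation
  would bound the rest by about \<open>x\<^sup>2 / D\<close>. With \<open>x = w ^ 6\<close> and \<open>D = w ^ 4\<close> everything is at
  most of order \<open>w ^ 8\<close>, against a lower bound of order \<open>w ^ 9\<close>.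
\<close>
lemma real_char_L_nonzero:
  assumes \<psi>: "real_char N \<psi>" and a: "\<psi> a = -1"
    and L: "\<And>k. \<bar>(\<Sum>n=1..k. \<psi> n / n) - L\<bar> \<le> 2 * real N / (real k + 1)"
  shows "L \<noteq> 0"
proof
  assume L0: "L = 0"
  \<comment> \<open>Large enough to refute \<open>w / 3 \<le> 4 * N + 1\<close>, the outcome of the estimates.\<close>
  define w where "w = 12 * N + 4"
  define x where "x = w ^ 6"
  define D where "D = w ^ 4"
  have w: "w \<ge> 2" by (simp add: w_def)
  have Dpos: "D > 0" using w by (simp add: D_def)
  define I where "I d = (\<Sum>e=1..x div d. real x - real d * real e)" for d
  define F where "F n = (\<Sum>d | d dvd n. \<psi> d)" for n
  have nonneg: "real x - real d * real e \<ge> 0" if "e \<le> x div d" "d > 0" for d e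
  proof -
    have "d * e \<le> x" using that by (metis less_eq_div_iff_mult_less_eq mult.commute)
    then show ?thesis by (metis diff_ge_0_iff_ge of_nat_le_iff of_nat_mult)
  qed
  have T: "(\<Sum>n=1..x. F n * (real x - real n)) = (\<Sum>d=1..x. \<psi> d * I d)"
  proof -
    have "(\<Sum>n=1..x. F n * (real x - real n)) =
        (\<Sum>n=1..x. \<Sum>d | d dvd n. \<psi> d * (real x - real d * real (n div d)))"
      unfolding F_def by (intro sum.cong refl) (simp add: sum_distrib_right flip: of_nat_mult)
    also have "\<dots> = (\<Sum>d=1..x. \<Sum>e=1..x div d. \<psi> d * (real x - real d * real e))"
      by (rule sum_divisors_swap)
    finally show ?thesis by (simp add: I_def sum_distrib_left)
  qed
  have I_closed: "\<bar>I d - (real x ^ 2 / (2 * d) - real x / 2)\<bar> \<le> d" if d: "d > 0" for d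
  proof -
    define k where "k = x div d"
    define r where "r = x mod d"
    have gauss: "(\<Sum>e=1..n. real x - real d * real e) = real n * x - d * (real n * (real n + 1)) / 2" for n
      by (induction n) (auto simp: field_simps)
    have xk: "real x = real k * d + r"
      unfolding k_def r_def by (metis div_mult_mod_eq of_nat_add of_nat_mult)
    have "I d - (real x ^ 2 / (2 * d) - real x / 2) = real r * (real d - r) / (2 * d)"
      unfolding I_def gauss k_def[symmetric] using d unfolding xk by (simp add: field_simps power2_eq_square)
    moreover have "r < d" using d by (simp add: r_def)
    moreover have "real r * (real d - r) / (2 * d) \<le> d"
    proof -
      have "real r * (real d - r) \<le> real d * real d" using \<open>r < d\<close> by (intro mult_mono) auto
      then have "real r * (real d - r) / (2 * d) \<le> real d * real d / (2 * d)"
        by (intro divide_right_mono) auto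
      also have "\<dots> \<le> d" using d by simp
      finally show ?thesis .
    qed
    moreover have "0 \<le> real r * (real d - r) / (2 * d)" using \<open>r < d\<close> by simp
    ultimately show ?thesis by simp
  qed
  have I_nonneg: "I d \<ge> 0" if "d > 0" for d
    unfolding I_def using nonneg that by (intro sum_nonneg) auto
  have I_dec: "I (Suc d) \<le> I d" if d: "d > 0" for d
  proof -
    have "x div Suc d \<le> x div d" using d by (intro div_le_mono2) auto
    have "I (Suc d) \<le> (\<Sum>e=1..x div Suc d. real x - real d * real e)"
      unfolding I_def by (intro sum_mono) (simp add: algebra_simps)
    also have "\<dots> \<le> I d"
      unfolding I_def using nonneg d \<open>x div Suc d \<le> x div d\<close> by (intro sum_mono2) auto
    finally show ?thesis .
  qed
  have I_le: "I d \<le> real x ^ 2 / d" if d: "d > 0" for d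
  proof -
    have "I d \<le> (\<Sum>e=1..x div d. real x)" unfolding I_def by (intro sum_mono) auto
    also have "\<dots> = real (x div d) * x" by simp
    also have "\<dots> \<le> (real x / d) * x" by (intro mult_right_mono of_nat_div_le_of_nat) auto
    finally show ?thesis by (simp add: power2_eq_square)
  qed
  have xD: "real x ^ 2 / D = real w ^ 8"
    using w unfolding x_def D_def by (simp add: field_simps flip: power_mult power_add)
  have "D \<le> x" unfolding D_def x_def using w by (intro power_increasing) auto
  have split: "(\<Sum>d=1..x. \<psi> d * I d) = (\<Sum>d=1..D. \<psi> d * I d) + (\<Sum>d=Suc D..x. \<psi> d * I d)"
    using sum.ub_add_nat[of 1 D "\<lambda>d. \<psi> d * I d" "x - D"] \<open>D \<le> x\<close> by simp
  have large: "\<bar>\<Sum>d=Suc D..x. \<psi> d * I d\<bar> \<le> 2 * N * real w ^ 8"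
  proof (cases "Suc D \<le> x")
    case True
    have "\<bar>\<Sum>d=Suc D..x. \<psi> d * I d\<bar> \<le> (2 * N) * I (Suc D)"
      using I_dec I_nonneg[of x] True
      by (intro abel_summation_bound[OF real_char_partial_sums[OF \<psi> a]]) auto
    also have "I (Suc D) \<le> real x ^ 2 / Suc D" by (rule I_le) simp
    also have "\<dots> \<le> real x ^ 2 / D" using Dpos by (intro divide_left_mono) auto
    finally show ?thesis by (simp add: xD mult_left_mono)
  qed simp
  have small: "\<bar>\<Sum>d=1..D. \<psi> d * I d\<bar> \<le> N * real w ^ 8 + N * real w ^ 6 + real w ^ 8"
  proof -
    define \<delta> where "\<delta> d = I d - (real x ^ 2 / (2 * d) - real x / 2)" for d
    have "(\<Sum>d=1..D. \<psi> d * I d) = (real x ^ 2 / 2) * (\<Sum>d=1..D. \<psi> d / d) - (real x / 2) * (\<Sum>d=1..D. \<psi> d)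
        + (\<Sum>d=1..D. \<psi> d * \<delta> d)"
      unfolding sum_distrib_left sum_subtractf[symmetric] sum.distrib[symmetric]
      by (intro sum.cong refl) (simp add: \<delta>_def field_simps)
    moreover have "\<bar>(real x ^ 2 / 2) * (\<Sum>d=1..D. \<psi> d / d)\<bar> \<le> N * real w ^ 8"
    proof -
      have "\<bar>\<Sum>d=1..D. \<psi> d / d\<bar> \<le> 2 * real N / (real D + 1)" using L[of D] L0 by simp
      also have "\<dots> \<le> 2 * real N / real D" using Dpos by (intro divide_left_mono) auto
      finally have "(real x ^ 2 / 2) * \<bar>\<Sum>d=1..D. \<psi> d / d\<bar> \<le> (real x ^ 2 / 2) * (2 * real N / real D)"
        by (intro mult_left_mono) auto
      also have "\<dots> = N * (real x ^ 2 / D)" by simp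
      finally show ?thesis unfolding xD by (simp add: abs_mult)
    qed
    moreover have "\<bar>(real x / 2) * (\<Sum>d=1..D. \<psi> d)\<bar> \<le> N * real w ^ 6"
      using mult_left_mono[OF real_char_partial_sums[OF \<psi> a, of 1 D], of "real x / 2"]
      by (simp add: abs_mult x_def mult.commute)
    moreover have "\<bar>\<Sum>d=1..D. \<psi> d * \<delta> d\<bar> \<le> real w ^ 8"
    proof -
      have "\<bar>\<Sum>d=1..D. \<psi> d * \<delta> d\<bar> \<le> (\<Sum>d=1..D. \<bar>\<psi> d * \<delta> d\<bar>)" by (rule sum_abs)
      also have "\<dots> \<le> (\<Sum>d=1..D. 1 * real D)"
        unfolding abs_mult
      proof (intro sum_mono mult_mono real_charD(6)[OF \<psi>])
        fix d assume "d \<in> {1..D}"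
        then show "\<bar>\<delta> d\<bar> \<le> real D" using I_closed[of d] unfolding \<delta>_def by auto
      qed auto
      also have "\<dots> = real w ^ 8" by (simp add: D_def flip: power_add)
      finally show ?thesis .
    qed
    ultimately show ?thesis by linarith
  qed
  \<comment> \<open>Only the terms at squares are kept.\<close>
  have lower: "(\<Sum>n=1..x. F n * (real x - real n)) \<ge> real w ^ 9 / 3"
  proof -
    have Fpos: "F n \<ge> 0" if "n \<ge> 1" for n
      using real_char_divisor_sum[OF \<psi>, of n] that by (simp add: F_def)
    have Fsq: "F (j ^ 2) \<ge> 1" if "j \<ge> 1" for j
    proof -
      have "even (multiplicity p (j ^ 2))" if "prime p" for p
        using that \<open>j \<ge> 1\<close> by (simp add: prime_elem_multiplicity_power_distrib)
      then show ?thesis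
        using real_char_divisor_sum[OF \<psi>, of "j ^ 2"] that by (simp add: F_def)
    qed
    have sq: "j ^ 2 \<le> x" if "j \<le> w ^ 3" for j
      using power_mono[OF that, of 2] by (simp add: x_def flip: power_mult)
    have sumsq: "(\<Sum>j=1..m. real M ^ 2 - real j ^ 2) = m * real M ^ 2 - real m * (m + 1) * (2 * m + 1) / 6" for m M :: nat
      by (induction m) (auto simp: field_simps power2_eq_square)
    define m where "m = w ^ 3"
    have m2: "real m \<ge> 2" using power_mono[of 2 "real w" 3] w by (simp add: m_def)
    have "real w ^ 9 / 3 = real m ^ 3 / 3" by (simp add: m_def flip: power_mult)
    also have "\<dots> \<le> real m * real m ^ 2 - real m * (m + 1) * (2 * m + 1) / 6"
    proof -
      have "real m * 1 \<le> real m * (2 * real m - 3)" using m2 by (intro mult_left_mono) auto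
      moreover have "2 * real m ^ 2 - 3 * real m - 1 = real m * (2 * real m - 3) - 1"
        by (simp add: power2_eq_square algebra_simps)
      ultimately have "0 \<le> 2 * real m ^ 2 - 3 * real m - 1" using m2 by linarith
      then have "0 \<le> real m * (2 * real m ^ 2 - 3 * real m - 1)" by simp
      then show ?thesis by (simp add: field_simps power2_eq_square power3_eq_cube)
    qed
    also have "\<dots> = (\<Sum>j=1..m. real x - real (j ^ 2))"
      using sumsq[of m m] by (simp add: x_def m_def flip: power_mult)
    also have "\<dots> \<le> (\<Sum>j=1..m. F (j ^ 2) * (real x - real (j ^ 2)))"
    proof (intro sum_mono)
      fix j assume j: "j \<in> {1..m}"
      then have "real (j ^ 2) \<le> real x" using sq[of j] by (simp only: of_nat_le_iff) (simp add: m_def)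
      then have "1 * (real x - real (j ^ 2)) \<le> F (j ^ 2) * (real x - real (j ^ 2))"
        using Fsq[of j] j by (intro mult_right_mono) auto
      then show "real x - real (j ^ 2) \<le> F (j ^ 2) * (real x - real (j ^ 2))" by simp
    qed
    also have "\<dots> = (\<Sum>n\<in>(\<lambda>j. j ^ 2) ` {1..m}. F n * (real x - real n))"
      by (subst sum.reindex) (auto simp: inj_on_def)
    also have "\<dots> \<le> (\<Sum>n=1..x. F n * (real x - real n))"
    proof (intro sum_mono2)
      show "(\<lambda>j. j ^ 2) ` {1..m} \<subseteq> {1..x}" using sq by (auto simp: m_def)
    qed (use Fpos in auto)
    finally show ?thesis .
  qed
  have "real w ^ 9 / 3 \<le> 2 * N * real w ^ 8 + (N * real w ^ 8 + N * real w ^ 6 + real w ^ 8)"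
    using lower large small unfolding T split by linarith
  also have "\<dots> \<le> (4 * N + 1) * real w ^ 8"
    using power_increasing[of 6 8 "real w"] w by (simp add: algebra_simps mult_left_mono)
  finally have "real w ^ 8 * (real w / 3) \<le> real w ^ 8 * (4 * N + 1)"
    by (simp add: field_simps power_add[of _ 8 1, simplified])
  then have "real w / 3 \<le> 4 * N + 1" using w by (simp add: mult_le_cancel_left)
  then show False by (simp add: w_def)
qed

lemma sum_ln_eq_sum_mangoldt:
  "(\<Sum>n=1..x. ln (real n)) = (\<Sum>d=1..x. mangoldt d * real (x div d))"
proof -
  have "(\<Sum>n=1..x. ln (real n)) = (\<Sum>n=1..x. \<Sum>d | d dvd n. mangoldt d :: real)"
    by (intro sum.cong refl) (simp add: mangoldt_sum)
  also have "\<dots> = (\<Sum>d=1..x. \<Sum>e=1..x div d. mangoldt d)" by (rule sum_divisors_swap)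
  finally show ?thesis by (simp add: mult.commute)
qed

lemma ln_fact_eq_sum: "ln (fact n :: real) = (\<Sum>k=1..n. ln (real k))"
  by (induction n) (auto simp: ln_mult)

text \<open>
  Chebyshev's bound, by doubling: each \<open>d\<close> between \<open>n\<close> and \<open>2 * n\<close> contributes its full von Mangoldt
  value to the logarithm of the central binomial coefficient, which is at most \<open>2 * n * ln 2\<close>.
\<close>
lemma chebyshev_mangoldt: "(\<Sum>d=1..x. mangoldt d) \<le> (4 * real x :: real)"
proof (induction x rule: less_induct)
  case (less x)
  define P :: "nat \<Rightarrow> real" where "P x = (\<Sum>d=1..x. mangoldt d)" for x
  have double: "P (2 * n) \<le> P n + 2 * real n" for n
  proof -
    have c: "mangoldt d * real ((2 * n) div d) - 2 * (mangoldt d * real (n div d)) \<ge>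
        (if d > n then mangoldt d else 0 :: real)" if "d \<in> {1..2 * n}" for d
    proof -
      have "2 * (n div d) + (if d > n then 1 else 0) \<le> (2 * n) div d"
      proof (cases "d > n")
        case True
        then have "1 \<le> (2 * n) div d" using that by (simp add: Suc_le_eq div_greater_zero_iff)
        then show ?thesis using True by simp
      next
        case False
        have "d * (2 * (n div d)) \<le> 2 * n"
          using times_div_less_eq_dividend[of d n] by (metis mult.left_commute mult_le_mono2)
        then show ?thesis using False that by (simp add: less_eq_div_iff_mult_less_eq mult.commute)
      qed
      then have "real (2 * (n div d) + (if d > n then 1 else 0)) \<le> real ((2 * n) div d)"
        by (simp only: of_nat_le_iff)
      then have "mangoldt d * (2 * real (n div d) + (if d > n then 1 else 0)) \<le> mangoldt d * real ((2 * n) div d)"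
        using mangoldt_nonneg[of d] by (intro mult_left_mono) (auto split: if_splits)
      then show ?thesis by (auto simp: algebra_simps)
    qed
    have "P (2 * n) - P n = (\<Sum>d=Suc n..2 * n. mangoldt d)"
      using sum.ub_add_nat[of 1 n "mangoldt :: nat \<Rightarrow> real" n] by (simp add: P_def mult_2)
    also have "\<dots> = (\<Sum>d=1..2 * n. if d > n then mangoldt d else 0)"
      by (intro sum.mono_neutral_cong_left) auto
    also have "\<dots> \<le> (\<Sum>d=1..2 * n. mangoldt d * real ((2 * n) div d) - 2 * (mangoldt d * real (n div d)))"
      by (intro sum_mono c)
    also have "\<dots> = (\<Sum>k=1..2 * n. ln (real k)) - 2 * (\<Sum>d=1..2 * n. mangoldt d * real (n div d))"
      by (simp only: sum_subtractf sum_distrib_left sum_ln_eq_sum_mangoldt)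
    also have "(\<Sum>d=1..2 * n. mangoldt d * real (n div d)) = (\<Sum>d=1..n. mangoldt d * real (n div d))"
      by (intro sum.mono_neutral_right) auto
    also have "(\<Sum>k=1..2 * n. ln (real k)) - 2 * \<dots> = ln (fact (2 * n)) - 2 * ln (fact n)"
      by (simp only: ln_fact_eq_sum sum_ln_eq_sum_mangoldt)
    also have "\<dots> = ln (fact (2 * n) / (fact n * fact n))"
      by (simp add: ln_div ln_mult)
    also have "fact (2 * n) / (fact n * fact n) = real ((2 * n) choose n)"
      by (simp add: binomial_fact)
    also have "ln \<dots> \<le> ln (2 ^ (2 * n))"
    proof -
      have "(2 * n) choose n \<le> 2 ^ (2 * n)" by (rule binomial_le_pow2)
      then have "real ((2 * n) choose n) \<le> 2 ^ (2 * n)" by (metis of_nat_le_iff of_nat_numeral of_nat_power)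
      then show ?thesis by (intro ln_mono) (auto simp: )
    qed
    also have "\<dots> = 2 * real n * ln 2" by (simp add: ln_realpow)
    also have "\<dots> \<le> 2 * real n * 1" using ln_less_self[of "2::real"] ln_le_minus_one[of "2::real"] by (intro mult_left_mono) auto
    finally show ?thesis by simp
  qed
  show ?case
  proof (cases "x = 0")
    case False
    define n where "n = x div 2"
    have "n < x" using False by (simp add: n_def)
    then have IH: "P n \<le> 4 * real n" using less by (simp add: P_def)
    show ?thesis
    proof (cases "even x")
      case True
      then have "x = 2 * n" by (simp add: n_def)
      then show ?thesis using IH double[of n] by (simp add: P_def)
    next
      case False
      then have x: "x = Suc (2 * n)" by (simp add: n_def)
      have "mangoldt x \<le> ln (real x)" by (rule mangoldt_le) (use x in simp)
      also have "\<dots> \<le> real x - 1" by (rule ln_le_minus_one) (use x in simp)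
      finally have "mangoldt x \<le> 2 * real n" by (simp add: x)
      then show ?thesis using IH double[of n] by (simp add: P_def x)
    qed
  qed simp
qed

text \<open>
  This is \<open>ln (fact x) = (\<Sum>d=1..x. mangoldt d * real (x div d))\<close> combined with
  \<open>x * ln x - x \<le> ln (fact x)\<close>.
\<close>
lemma mertens_mangoldt_lower:
  assumes "x > 0" shows "ln (real x) - 1 \<le> (\<Sum>d=1..x. mangoldt d / real d)"
proof -
  have "real x * ln x - x \<le> ln (fact x)"
    using assms
  proof (induction x rule: nat_induct_non_zero)
    case (Suc n)
    have "real n * ln (real (Suc n) / n) \<le> real n * (real (Suc n) / n - 1)"
      using Suc.hyps by (intro mult_left_mono ln_le_minus_one) auto
    moreover have "real n * (real (Suc n) / n - 1) = 1" using Suc.hyps by (simp add: field_simps)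
    moreover have "ln (real (Suc n) / n) = ln (real (Suc n)) - ln (real n)"
      using Suc.hyps by (simp add: ln_div)
    ultimately have "real n * ln (real (Suc n)) - real n * ln n \<le> 1"
      by (simp only: right_diff_distrib)
    moreover have "ln (fact (Suc n) :: real) = ln (real (Suc n)) + ln (fact n)"
      by (simp add: ln_fact_eq_sum del: fact_Suc)
    moreover have "real (Suc n) * ln (real (Suc n)) = real n * ln (real (Suc n)) + ln (real (Suc n))"
      by (simp add: distrib_right)
    ultimately show ?case using Suc.IH by simp
  qed simp
  also have "ln (fact x) = (\<Sum>d=1..x. mangoldt d * real (x div d))"
    by (simp only: ln_fact_eq_sum sum_ln_eq_sum_mangoldt)
  also have "\<dots> \<le> (\<Sum>d=1..x. mangoldt d * (real x / real d))"
    by (intro sum_mono mult_left_mono of_nat_div_le_of_nat mangoldt_nonneg)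
  also have "\<dots> = real x * (\<Sum>d=1..x. mangoldt d / real d)"
    by (simp add: sum_distrib_left algebra_simps)
  finally have "real x * (ln x - 1) \<le> real x * (\<Sum>d=1..x. mangoldt d / real d)"
    by (simp add: algebra_simps)
  then show ?thesis using assms by simp
qed

text \<open>
  The sum \<open>\<Sum>n\<le>x. \<psi> n * ln n / n\<close> is bounded by partial summation. Expanding \<open>ln n\<close> over the
  divisors of \<open>n\<close> turns it into \<open>L(1, \<psi>)\<close> times the sum in question, up to an error that Chebyshev's
  bound controls. As \<open>L(1, \<psi>)\<close> is not \<open>0\<close>, the sum in question is bounded.
\<close>
lemma real_char_mangoldt_bounded:
  assumes \<psi>: "real_char N \<psi>" and a: "\<psi> a = -1"
  obtains C where "\<And>x. \<bar>\<Sum>d=1..x. \<psi> d * mangoldt d / real d\<bar> \<le> C"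
proof -
  obtain L where L: "\<And>k. \<bar>(\<Sum>n=1..k. \<psi> n / n) - L\<bar> \<le> 2 * real N / (real k + 1)"
    using real_char_L_value[OF \<psi> a] by blast
  have L0: "L \<noteq> 0" using real_char_L_nonzero[OF \<psi> a L] .
  define A where "A x = (\<Sum>n=1..x. \<psi> n * (ln (real n) / real n))" for x
  define S where "S x = (\<Sum>d=1..x. \<psi> d * mangoldt d / real d)" for x
  define K where "K = \<bar>A 2\<bar> + 2 * real N"
  have A_bound: "\<bar>A x\<bar> \<le> K" for x
  proof -
    consider "x = 0" | "x = 1" | "x = 2" | "x \<ge> 3" by linarith
    then show ?thesis
    proof cases
      case 4
      have "\<bar>\<Sum>n=3..x. \<psi> n * (ln (real n) / real n)\<bar> \<le> (2 * N) * (ln (real 3) / real 3)"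
      proof (rule abel_summation_bound[OF real_char_partial_sums[OF \<psi> a]])
        fix n :: nat assume "3 \<le> n"
        then show "ln (real (Suc n)) / real (Suc n) \<le> ln (real n) / real n"
          using exp_le by (intro ln_x_over_x_mono) auto
      qed (use 4 in auto)
      also have "\<dots> \<le> (2 * N) * (1 :: real)"
        using ln_le_minus_one[of "3::real"] by (intro mult_left_mono) auto
      finally have "\<bar>\<Sum>n=3..x. \<psi> n * (ln (real n) / real n)\<bar> \<le> 2 * N" by simp
      moreover have "A x = A 2 + (\<Sum>n=3..x. \<psi> n * (ln (real n) / real n))"
      proof -
        have "2 + (x - 2) = x" using 4 by simp
        with sum.ub_add_nat[of 1 2 "\<lambda>n. \<psi> n * (ln (real n) / real n)" "x - 2"] show ?thesis
          by (simp add: A_def del: sum.cl_ivl_Suc add_2_eq_Suc add_2_eq_Suc')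
      qed
      ultimately show ?thesis unfolding K_def by linarith
    qed (simp_all add: A_def K_def)
  qed
  have "\<bar>S x\<bar> \<le> (K + 8 * real N) / \<bar>L\<bar>" for x
  proof (cases "x = 0")
    case False
    define R where "R y = (\<Sum>n=1..y. \<psi> n / n) - L" for y
    have "A x = (\<Sum>n=1..x. \<Sum>d | d dvd n. (\<psi> d * mangoldt d / d) * (\<psi> (n div d) / real (n div d)))"
      unfolding A_def
    proof (intro sum.cong refl)
      fix n assume n: "n \<in> {1..x}"
      have "(\<psi> d * mangoldt d / d) * (\<psi> (n div d) / real (n div d)) = (\<psi> n / n) * mangoldt d" if "d dvd n" for d
        using real_charD(2)[OF \<psi>, of d "n div d"] n that by (auto simp: field_simps simp flip: of_nat_mult)
      then have "(\<Sum>d | d dvd n. (\<psi> d * mangoldt d / d) * (\<psi> (n div d) / real (n div d))) = (\<psi> n / n) * (\<Sum>d | d dvd n. mangoldt d)"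
        by (simp add: sum_distrib_left)
      also have "\<dots> = \<psi> n * (ln (real n) / real n)" using n by (simp add: mangoldt_sum)
      finally show "\<psi> n * (ln (real n) / real n) = (\<Sum>d | d dvd n. (\<psi> d * mangoldt d / d) * (\<psi> (n div d) / real (n div d)))" by simp
    qed
    also have "\<dots> = (\<Sum>d=1..x. \<Sum>e=1..x div d. (\<psi> d * mangoldt d / d) * (\<psi> e / real e))"
      by (rule sum_divisors_swap)
    also have "\<dots> = (\<Sum>d=1..x. (\<psi> d * mangoldt d / d) * (L + R (x div d)))"
      by (simp add: R_def sum_distrib_left)
    also have "\<dots> = L * S x + (\<Sum>d=1..x. (\<psi> d * mangoldt d / d) * R (x div d))"
      unfolding S_def distrib_left sum.distrib sum_distrib_left by (simp add: algebra_simps)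
    finally have eq: "L * S x = A x - (\<Sum>d=1..x. (\<psi> d * mangoldt d / d) * R (x div d))" by simp
    have "\<bar>\<Sum>d=1..x. (\<psi> d * mangoldt d / d) * R (x div d)\<bar> \<le> (\<Sum>d=1..x. \<bar>(\<psi> d * mangoldt d / d) * R (x div d)\<bar>)"
      by (rule sum_abs)
    also have "\<dots> \<le> (\<Sum>d=1..x. mangoldt d * (2 * real N / x))"
    proof (intro sum_mono)
      fix d assume d: "d \<in> {1..x}"
      have "real x / d < real (x div d) + 1"
      proof -
        have "x < d * (x div d + 1)" using d by (metis add.commute atLeastAtMost_iff dividend_less_div_times less_le_trans mult.commute mult_Suc_right plus_1_eq_Suc zero_less_one)
        then have "real x < real d * (real (x div d) + 1)" by (metis of_nat_1 of_nat_add of_nat_less_iff of_nat_mult)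
        then show ?thesis using d by (simp add: field_simps)
      qed
      then have "2 * real N / (real (x div d) + 1) \<le> 2 * real N / (real x / d)"
        using d False by (intro divide_left_mono) (auto intro!: mult_pos_pos)
      with L[of "x div d"] have R: "\<bar>R (x div d)\<bar> \<le> 2 * real N * d / x" by (simp add: R_def)
      have "\<bar>(\<psi> d * mangoldt d / d) * R (x div d)\<bar> = \<bar>\<psi> d\<bar> * (mangoldt d / d * \<bar>R (x div d)\<bar>)"
        by (simp add: abs_mult)
      also have "\<dots> \<le> 1 * (mangoldt d / d * (2 * real N * d / x))"
        using R mangoldt_nonneg[of d] by (intro mult_mono mult_left_mono real_charD(6)[OF \<psi>]) auto
      also have "\<dots> = mangoldt d * (2 * real N / x)" using d by simp
      finally show "\<bar>(\<psi> d * mangoldt d / d) * R (x div d)\<bar> \<le> mangoldt d * (2 * real N / x)" .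
    qed
    also have "\<dots> = (\<Sum>d=1..x. mangoldt d) * (2 * real N / x)" by (simp only: sum_distrib_right)
    also have "\<dots> \<le> (4 * real x) * (2 * real N / x)"
      by (intro mult_right_mono chebyshev_mangoldt) auto
    also have "\<dots> = 8 * real N" using False by simp
    finally have "\<bar>L * S x\<bar> \<le> K + 8 * real N" using eq A_bound[of x] by linarith
    then show ?thesis using L0 by (simp add: abs_mult field_simps)
  qed (use L0 in \<open>simp add: S_def K_def\<close>)
  then show ?thesis using that unfolding S_def by blast
qed

text \<open>
  The values \<open>mangoldt (j\<^sup>2) / j\<^sup>2\<close> are dominated by the convergent series of
  \<open>4 * j powr (-3/2)\<close>.
\<close>
lemma mangoldt_square_sum_bounded:
  obtains C :: real where "\<And>x. (\<Sum>d\<in>{d\<in>{1..x}. \<exists>j. d = j ^ 2}. mangoldt d / real d) \<le> C"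
proof -
  have summ: "summable (\<lambda>j. real j powr (-3/2))" by (subst summable_real_powr_iff) simp
  have "(\<Sum>d\<in>{d\<in>{1..x}. \<exists>j. d = j ^ 2}. mangoldt d / real d) \<le> 4 * suminf (\<lambda>j. real j powr (-3/2))" for x
  proof -
    have "(\<Sum>d\<in>{d\<in>{1..x}. \<exists>j. d = j ^ 2}. mangoldt d / real d) \<le> (\<Sum>d\<in>(\<lambda>j. j ^ 2) ` {1..x}. mangoldt d / real d)"
    proof (intro sum_mono2)
      show "{d \<in> {1..x}. \<exists>j. d = j\<^sup>2} \<subseteq> (\<lambda>j. j\<^sup>2) ` {1..x}"
      proof clarsimp
        fix j assume "Suc 0 \<le> j\<^sup>2" "j\<^sup>2 \<le> x"
        moreover have "j \<le> j ^ 2" by (simp add: power2_eq_square)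
        ultimately show "j\<^sup>2 \<in> (\<lambda>j. j\<^sup>2) ` {Suc 0..x}"
          by (intro imageI) (auto simp: Suc_le_eq intro: Nat.gr0I)
      qed
    qed (auto simp: mangoldt_nonneg)
    also have "\<dots> = (\<Sum>j=1..x. mangoldt (j ^ 2) / real (j ^ 2))"
      by (subst sum.reindex) (auto simp: inj_on_def)
    also have "\<dots> \<le> (\<Sum>j=1..x. 4 * real j powr (-3/2))"
    proof (intro sum_mono)
      fix j assume j: "j \<in> {1..x}"
      have "mangoldt (j ^ 2) \<le> ln (real (j ^ 2))" by (rule mangoldt_le) (use j in simp)
      also have "\<dots> = 4 * ln (real j powr (1/2))" using j by (simp add: ln_realpow ln_powr)
      also have "\<dots> \<le> 4 * real j powr (1/2)"
        using ln_less_self[of "real j powr (1/2)"] j by simp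
      finally have "mangoldt (j ^ 2) / real (j ^ 2) \<le> 4 * real j powr (1/2) / real (j ^ 2)"
        by (intro divide_right_mono) auto
      also have "\<dots> = 4 * (real j powr (1/2) / real j powr 2)" using j by simp
      also have "real j powr (1/2) / real j powr 2 = real j powr (-3/2)"
        by (subst powr_diff[symmetric]) simp
      finally show "mangoldt (j ^ 2) / real (j ^ 2) \<le> 4 * real j powr (-3/2)" .
    qed
    also have "\<dots> \<le> 4 * suminf (\<lambda>j. real j powr (-3/2))"
      using sum_le_suminf[OF summ, of "{1..x}"] by (simp add: sum_distrib_left[symmetric])
    finally show ?thesis .
  qed
  then show ?thesis using that by blast
qed

text \<open>
  Only the powers of the finitely many prime factors of \<open>N\<close> contribute, and each of these
  geometric series converges.
\<close>
lemma mangoldt_noncoprime_sum_bounded: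
  fixes N :: nat
  assumes N: "N > 0"
  obtains C :: real where "\<And>x. (\<Sum>d\<in>{d\<in>{1..x}. \<not> coprime d N}. mangoldt d / real d) \<le> C"
proof -
  have "(\<Sum>d\<in>{d\<in>{1..x}. \<not> coprime d N}. mangoldt d / real d) \<le> (\<Sum>p\<in>prime_factors N. ln (real p))" for x
  proof -
    let ?g = "\<lambda>(p, k). p ^ k :: nat"
    have "(\<Sum>d\<in>{d\<in>{1..x}. \<not> coprime d N}. mangoldt d / real d) \<le>
        (\<Sum>d\<in>?g ` (prime_factors N \<times> {1..x}). mangoldt d / real d)"
    proof -
      have "d \<in> ?g ` (prime_factors N \<times> {1..x})" if "d \<in> {1..x}" "\<not> coprime d N" "primepow d" for d
      proof -
        from that(3) obtain p k where pk: "prime p" "k > 0" "d = p ^ k" by (auto simp: primepow_def)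
        have "p dvd N" using that(2) pk by (metis coprime_power_left_iff prime_imp_coprime)
        moreover have "k \<le> x"
        proof -
          have "k < 2 ^ k" by (rule less_exp)
          also have "\<dots> \<le> p ^ k" using prime_ge_2_nat[OF pk(1)] by (intro power_mono) auto
          finally show ?thesis using that(1) pk(3) by simp
        qed
        ultimately have "(p, k) \<in> prime_factors N \<times> {1..x}"
          using pk N by (simp add: in_prime_factors_iff)
        then show ?thesis using pk(3) by force
      qed
      then have "(\<Sum>d\<in>{d\<in>{1..x}. \<not> coprime d N}. mangoldt d / real d) =
          (\<Sum>d\<in>{d\<in>{1..x}. \<not> coprime d N \<and> primepow d}. mangoldt d / real d)"
        by (intro sum.mono_neutral_right) (auto simp: mangoldt_def)
      also have "\<dots> \<le> (\<Sum>d\<in>?g ` (prime_factors N \<times> {1..x}). mangoldt d / real d)"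
        using \<open>\<And>d. _ \<Longrightarrow> _ \<Longrightarrow> _ \<Longrightarrow> d \<in> ?g ` _\<close>
        by (intro sum_mono2) (auto simp: mangoldt_nonneg)
      finally show ?thesis .
    qed
    also have "\<dots> \<le> (\<Sum>z\<in>prime_factors N \<times> {1..x}. mangoldt (?g z) / real (?g z))"
      using sum_image_le[of "prime_factors N \<times> {1..x}" "\<lambda>d. mangoldt d / real d" ?g]
      by (auto simp: mangoldt_nonneg o_def)
    also have "\<dots> = (\<Sum>p\<in>prime_factors N. \<Sum>k=1..x. mangoldt (p ^ k) / real (p ^ k))"
      by (simp add: sum.cartesian_product case_prod_beta)
    also have "\<dots> \<le> (\<Sum>p\<in>prime_factors N. \<Sum>k=1..x. ln (real p) * (1 / 2) ^ k)"
    proof (intro sum_mono)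
      fix p k assume p: "p \<in> prime_factors N" and k: "k \<in> {1..x}"
      have pp: "prime p" using p by (simp add: in_prime_factors_iff)
      have "(2::real) ^ k \<le> real p ^ k" using prime_ge_2_nat[OF pp] by (intro power_mono) auto
      then have "ln (real p) / real p ^ k \<le> ln (real p) / 2 ^ k"
        using prime_ge_2_nat[OF pp] by (intro divide_left_mono) auto
      then show "mangoldt (p ^ k) / real (p ^ k) \<le> ln (real p) * (1 / 2) ^ k"
        using pp k by (simp add: power_one_over field_simps)
    qed
    also have "\<dots> \<le> (\<Sum>p\<in>prime_factors N. ln (real p))"
    proof (intro sum_mono)
      fix p assume "p \<in> prime_factors N"
      then have "real p \<ge> 1" using prime_ge_1_nat by (auto simp: in_prime_factors_iff)
      have "(\<Sum>k=1..x. (1 / 2 :: real) ^ k) = 1 - (1 / 2) ^ x" by (induction x) (auto simp: field_simps)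
      then have "(\<Sum>k=1..x. (1 / 2 :: real) ^ k) \<le> 1" by simp
      then have "ln (real p) * (\<Sum>k=1..x. (1 / 2) ^ k) \<le> ln (real p) * 1"
        using \<open>real p \<ge> 1\<close> by (intro mult_left_mono) auto
      then show "(\<Sum>k=1..x. ln (real p) * (1 / 2) ^ k) \<le> ln (real p)" by (simp add: sum_distrib_left)
    qed
    finally show ?thesis .
  qed
  then show ?thesis using that by blast
qed

text \<open>
  The weight \<open>G B n = (\<Prod>\<psi>\<in>B. 1 + \<psi> a * \<psi> n)\<close> is nonnegative and, on integers prime to \<open>N\<close>,
  vanishes unless every \<open>\<psi> n\<close> equals \<open>\<psi> a\<close>. Multiplying the factors out one at a time shows
  that \<open>\<Sum>n\<le>x. G B n * mangoldt n / n\<close>, over \<open>n\<close> prime to \<open>N\<close>, is unbounded: the empty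
  product contributes an unbounded sum by the estimate of Mertens, each
  nonprincipal product of characters contributes a bounded sum, and each principal one a nonnegative
  sum, because its value at \<open>a\<close> is \<open>1\<close>. If no prime had the prescribed values, then no odd power of a
  prime would carry any weight, and the even powers contribute only a bounded sum.
\<close>
theorem prime_with_prescribed_real_chars:
  assumes B: "finite B" "\<And>\<psi>. \<psi> \<in> B \<Longrightarrow> real_char N \<psi>" and N: "N > 0" and a: "coprime a N"
  shows "\<exists>l. prime l \<and> coprime l N \<and> (\<forall>\<psi>\<in>B. \<psi> l = \<psi> a)"
proof (rule ccontr)
  assume none: "\<not> ?thesis"
  define \<psi>0 :: "nat \<Rightarrow> real" where "\<psi>0 n = (if coprime n N then 1 else 0)" for n
  have "coprime (b + N) N \<longleftrightarrow> coprime b N" for b by (metis coprime_iff_gcd_eq_1 gcd_add1)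
  then have \<psi>0: "real_char N \<psi>0" unfolding real_char_def \<psi>0_def using N by simp
  define G where "G B n = (\<Prod>\<psi>\<in>B. 1 + \<psi> a * \<psi> n)" for B :: "(nat \<Rightarrow> real) set" and n
  define S where "S B \<phi> x = (\<Sum>d=1..x. \<phi> d * G B d * mangoldt d / real d)" for B \<phi> x
  have Gnonneg: "0 \<le> 1 + \<psi> a * \<psi> n \<and> 1 + \<psi> a * \<psi> n \<le> 2" if "real_char N \<psi>" for \<psi> n
    using real_charD(4)[OF that, of a] real_charD(4)[OF that, of n] by auto
  have S_insert: "S (insert \<psi> B) \<phi> x = S B \<phi> x + \<psi> a * S B (\<lambda>n. \<phi> n * \<psi> n) x"
    if "finite B" "\<psi> \<notin> B" for \<psi> B \<phi> x
    unfolding S_def G_def sum_distrib_left sum.distrib[symmetric] using that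
    by (intro sum.cong refl) (simp add: algebra_simps add_divide_distrib)
  have bounded_below: "\<exists>C. \<forall>x. \<phi> a * S B \<phi> x \<ge> - C"
    if "finite B" "\<forall>\<psi>\<in>B. real_char N \<psi>" "real_char N \<phi>" for B \<phi>
    using that
  proof (induction B arbitrary: \<phi> rule: finite_induct)
    case empty
    show ?case
    proof (cases "\<exists>b. \<phi> b = -1")
      case True
      then obtain C where C: "\<And>x. \<bar>\<Sum>d=1..x. \<phi> d * mangoldt d / real d\<bar> \<le> C"
        using real_char_mangoldt_bounded[OF empty(2)] by blast
      have "\<phi> a * S {} \<phi> x \<ge> - C" for x
      proof -
        have "\<bar>\<phi> a * S {} \<phi> x\<bar> \<le> 1 * C"
          unfolding abs_mult using C[of x] real_charD(6)[OF empty(2)]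
          by (intro mult_mono) (auto simp: S_def G_def)
        then show ?thesis by linarith
      qed
      then show ?thesis by blast
    next
      case False
      then have "\<phi> n \<ge> 0" for n using real_charD(4)[OF empty(2), of n] by auto
      then have "\<phi> a * S {} \<phi> x \<ge> - 0" for x
        unfolding S_def G_def by (auto intro!: mult_nonneg_nonneg sum_nonneg divide_nonneg_nonneg mangoldt_nonneg)
      then show ?thesis by blast
    qed
  next
    case (insert \<psi> B)
    have \<psi>: "real_char N \<psi>" and Bc: "\<forall>\<psi>\<in>B. real_char N \<psi>" using insert.prems by auto
    obtain C1 where C1: "\<And>x. \<phi> a * S B \<phi> x \<ge> - C1" using insert.IH[OF Bc insert.prems(2)] by blast
    obtain C2 where C2: "\<And>x. \<phi> a * \<psi> a * S B (\<lambda>n. \<phi> n * \<psi> n) x \<ge> - C2"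
      using insert.IH[OF Bc real_char_mult[OF insert.prems(2) \<psi>]] by blast
    have "\<phi> a * S (insert \<psi> B) \<phi> x \<ge> - (C1 + C2)" for x
      using C1[of x] C2[of x] by (simp add: S_insert[OF insert.hyps(1,2)] algebra_simps)
    then show ?case by blast
  qed
  have trivial_part: "\<exists>C. \<forall>x. S B \<psi>0 x \<ge> S {} \<psi>0 x - C"
    if "finite B" "\<forall>\<psi>\<in>B. real_char N \<psi>" for B
    using that
  proof (induction B rule: finite_induct)
    case empty then show ?case by (intro exI[of _ 0]) simp
  next
    case (insert \<psi> B)
    have \<psi>: "real_char N \<psi>" and Bc: "\<forall>\<psi>\<in>B. real_char N \<psi>" using insert.prems by auto
    obtain C1 where C1: "\<And>x. S B \<psi>0 x \<ge> S {} \<psi>0 x - C1" using insert.IH[OF Bc] by blast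
    obtain C2 where C2: "\<And>x. \<psi>0 a * \<psi> a * S B (\<lambda>n. \<psi>0 n * \<psi> n) x \<ge> - C2"
      using bounded_below[OF insert.hyps(1) Bc real_char_mult[OF \<psi>0 \<psi>]] by blast
    have "\<psi>0 a = 1" using a by (simp add: \<psi>0_def)
    then have "S (insert \<psi> B) \<psi>0 x \<ge> S {} \<psi>0 x - (C1 + C2)" for x
      using C1[of x] C2[of x] by (simp add: S_insert[OF insert.hyps(1,2)])
    then show ?case by blast
  qed
  obtain C1 where C1: "\<And>x. S B \<psi>0 x \<ge> S {} \<psi>0 x - C1" using trivial_part[OF B(1)] B(2) by blast
  obtain C2 where C2: "\<And>x. (\<Sum>d\<in>{d\<in>{1..x}. \<not> coprime d N}. mangoldt d / real d) \<le> C2"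
    using mangoldt_noncoprime_sum_bounded[OF N] by blast
  obtain C3 where C3: "\<And>x. (\<Sum>d\<in>{d\<in>{1..x}. \<exists>j. d = j ^ 2}. mangoldt d / real d) \<le> C3"
    using mangoldt_square_sum_bounded by blast
  have lower: "S {} \<psi>0 x \<ge> ln (real x) - 1 - C2" if "x > 0" for x
  proof -
    have "(\<Sum>d=1..x. mangoldt d / real d) = S {} \<psi>0 x + (\<Sum>d=1..x. if \<not> coprime d N then mangoldt d / real d else 0)"
      unfolding S_def G_def sum.distrib[symmetric] by (intro sum.cong refl) (simp add: \<psi>0_def)
    also have "(\<Sum>d=1..x. if \<not> coprime d N then mangoldt d / real d else 0) =
        (\<Sum>d\<in>{d\<in>{1..x}. \<not> coprime d N}. mangoldt d / real d)"
      by (intro sum.mono_neutral_cong_right) auto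
    finally show ?thesis using C2[of x] mertens_mangoldt_lower[OF that] by linarith
  qed
  have upper: "S B \<psi>0 x \<le> 2 ^ card B * C3" for x
  proof -
    have G2: "0 \<le> G B n" "G B n \<le> 2 ^ card B" for n
    proof -
      show "0 \<le> G B n" unfolding G_def using Gnonneg B(2) by (intro prod_nonneg) auto
      have "G B n \<le> (\<Prod>\<psi>\<in>B. 2)" unfolding G_def using Gnonneg B(2) by (intro prod_mono) auto
      then show "G B n \<le> 2 ^ card B" by simp
    qed
    have "\<psi>0 d * G B d * mangoldt d / real d \<le> (if \<exists>j. d = j ^ 2 then 2 ^ card B * (mangoldt d / real d) else 0)" for d
    proof (cases "\<exists>j. d = j ^ 2")
      case True
      have "(\<psi>0 d * G B d) * (mangoldt d / real d) \<le> (1 * 2 ^ card B) * (mangoldt d / real d)"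
        using G2[of d] by (intro mult_right_mono mult_mono) (auto simp: \<psi>0_def mangoldt_nonneg)
      then show ?thesis using True by simp
    next
      case nsq: False
      have "\<psi>0 d * G B d * mangoldt d = 0"
      proof (cases "primepow d")
        case True
        then obtain l k where lk: "prime l" "k > 0" "d = l ^ k" by (auto simp: primepow_def)
        have "odd k"
        proof
          assume "even k"
          then obtain i where "k = i * 2" by (metis dvd_def mult.commute)
          then have "d = (l ^ i) ^ 2" using lk(3) by (simp add: power_mult)
          with nsq show False by blast
        qed
        \<comment> \<open>A value in \<open>{-1, 0, 1}\<close> equals each of its odd powers.\<close>
        have pow: "\<psi> d = \<psi> l" if "real_char N \<psi>" for \<psi>
          using real_charD(4)[OF that, of l] \<open>odd k\<close> lk by (auto simp: real_char_power[OF that])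
        show ?thesis
        proof (cases "coprime l N")
          case True
          with none lk(1) obtain \<psi> where \<psi>: "\<psi> \<in> B" "\<psi> l \<noteq> \<psi> a" by blast
          have "\<psi> l \<noteq> 0" "\<psi> a \<noteq> 0" using real_charD(5)[OF B(2)[OF \<psi>(1)]] a True by auto
          then have "1 + \<psi> a * \<psi> d = 0"
            using real_charD(4)[OF B(2)[OF \<psi>(1)], of l] real_charD(4)[OF B(2)[OF \<psi>(1)], of a] \<psi>(2)
              pow[OF B(2)[OF \<psi>(1)]] by auto
          then have "G B d = 0" unfolding G_def using B(1) \<psi>(1) by (intro prod_zero) auto
          then show ?thesis by simp
        next
          case False
          then show ?thesis using pow[OF \<psi>0] by (simp add: \<psi>0_def)
        qed
      qed (simp add: mangoldt_def)
      then show ?thesis using nsq by (simp only: if_False)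
    qed
    then have "S B \<psi>0 x \<le> (\<Sum>d=1..x. if \<exists>j. d = j ^ 2 then 2 ^ card B * (mangoldt d / real d) else 0)"
      unfolding S_def by (intro sum_mono)
    also have "\<dots> = (\<Sum>d\<in>{d\<in>{1..x}. \<exists>j. d = j ^ 2}. 2 ^ card B * (mangoldt d / real d))"
      by (intro sum.mono_neutral_cong_right) auto
    also have "\<dots> \<le> 2 ^ card B * C3"
      unfolding sum_distrib_left[symmetric] by (intro mult_left_mono C3) auto
    finally show ?thesis .
  qed
  define K where "K = 2 ^ card B * C3 + C1 + C2 + 1"
  obtain x :: nat where x: "real x > exp K" using reals_Archimedean2 by blast
  have "x > 0" using x exp_gt_zero[of K] by (intro Nat.gr0I) auto
  then have "ln (real x) > K" using x by (metis exp_gt_zero ln_exp ln_less_cancel_iff of_nat_0_less_iff)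
  then show False using lower[OF \<open>x > 0\<close>] upper[of x] C1[of x] unfolding K_def by linarith
qed

section \<open>Legendre symbols and conics over the rationals\<close>

text \<open>
  The square of the volume of the box exceeds \<open>(b * c) * (a * c) * (a * b)\<close>, so the box has more
  than \<open>a * b * c\<close> points.
\<close>
lemma pigeonhole_triple:
  fixes a b c :: nat and f :: "nat \<Rightarrow> nat \<Rightarrow> nat \<Rightarrow> 'r"
  assumes fin: "finite R" and card: "card R \<le> a * b * c"
    and f: "\<And>x y z. f x y z \<in> R"
    and U: "b * c < u ^ 2" "a * c < v ^ 2" "a * b < w ^ 2"
  obtains x y z x' y' z' where "(x, y, z) \<noteq> (x', y', z')" "f x y z = f x' y' z'"
    "x < u" "x' < u" "y < v" "y' < v" "z < w" "z' < w"
proof -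
  let ?D = "{..<u} \<times> {..<v} \<times> {..<w}"
  let ?f = "\<lambda>(x, y, z). f x y z"
  have "(b * c) * ((a * c) * (a * b)) < u ^ 2 * (v ^ 2 * w ^ 2)"
    using U by (intro mult_strict_mono') auto
  then have "(a * b * c) ^ 2 < (u * v * w) ^ 2"
    by (simp add: power2_eq_square algebra_simps)
  then have "a * b * c < u * v * w" using power2_less_imp_less by blast
  then have "card R < card ?D" using card by (simp add: card_cartesian_product)
  moreover have "?f ` ?D \<subseteq> R" using f by auto
  ultimately have "\<not> inj_on ?f ?D"
    using card_inj_on_le[OF _ _ fin] by (metis not_le)
  then show ?thesis using that unfolding inj_on_def by fast
qed

text \<open>
  Legendre's theorem, proved by the pigeonhole principle. The three congruences cut out a set of integer
  vectors, closed under differences, on which the form \<open>a x\<^sup>2 + b y\<^sup>2 - c z\<^sup>2\<close> is divisible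
  by \<open>a b c\<close>. It contains a nonzero vector with \<open>x\<^sup>2 \<le> b c\<close>, \<open>y\<^sup>2 \<le> a c\<close> and
  \<open>z\<^sup>2 \<le> a b\<close>. The first and the last inequality are strict, because the prime \<open>b\<close> occurs exactly
  once in \<open>b c\<close> and \<open>a b\<close>. So the value of the form lies strictly between \<open>- a b c\<close> and
  \<open>2 a b c\<close>, and it is \<open>0\<close> or \<open>a b c\<close>.
\<close>
theorem legendre_conic:
  fixes a b c :: nat and t1 t2 t3 :: int
  assumes pos: "a > 0" "b > 0" "c > 0"
    and cop: "coprime a b" "coprime a c" "coprime b c"
    and b: "prime b"
    and t1: "[int b * t1\<^sup>2 = int c] (mod int a)"
    and t2: "[int a * t2\<^sup>2 = int c] (mod int b)"
    and t3: "[int a * t3\<^sup>2 = - int b] (mod int c)"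
  obtains x y z :: int where "int a * x\<^sup>2 + int b * y\<^sup>2 = int c * z\<^sup>2" "z \<noteq> 0"
proof -
  \<comment> \<open>The integers below \<open>isq n\<close> are those whose square is at most \<open>n\<close>.\<close>
  define isq :: "nat \<Rightarrow> nat" where "isq n = (LEAST u. n < u ^ 2)" for n
  have isq: "n < isq n ^ 2" "\<And>x. x < isq n \<Longrightarrow> x ^ 2 \<le> n" for n
  proof -
    have "n < Suc n ^ 2" by (simp add: power2_eq_square)
    then show "n < isq n ^ 2" unfolding isq_def by (rule LeastI)
    show "\<And>x. x < isq n \<Longrightarrow> x ^ 2 \<le> n" unfolding isq_def by (metis not_less_Least not_less)
  qed
  let ?f = "\<lambda>x y z :: nat. ((int y - t1 * int z) mod int a, (int x - t2 * int z) mod int b, (int x - t3 * int y) mod int c)"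
  let ?R = "{0..<int a} \<times> {0..<int b} \<times> {0..<int c}"
  have finR: "finite ?R" by simp
  have cardR: "card ?R \<le> a * b * c" by (simp add: card_cartesian_product)
  have fR: "?f x y z \<in> ?R" for x y z using pos by simp
  obtain x y z x' y' z' where ne: "(x, y, z) \<noteq> (x', y', z')" and eq: "?f x y z = ?f x' y' z'"
    and le: "x < isq (b * c)" "x' < isq (b * c)" "y < isq (a * c)" "y' < isq (a * c)" "z < isq (a * b)" "z' < isq (a * b)"
    by (rule pigeonhole_triple[where f = ?f, OF finR cardR fR isq(1) isq(1) isq(1)]) blast
  define X where "X = int x - int x'"
  define Y where "Y = int y - int y'"
  define Z where "Z = int z - int z'"
  have sq_le: "(int u - int v) ^ 2 \<le> int n" if "u < isq n" "v < isq n" for u v n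
  proof -
    have "\<bar>int u - int v\<bar> \<le> int (max u v)" by linarith
    then have "(int u - int v) ^ 2 \<le> int (max u v) ^ 2" by (metis abs_ge_zero power2_abs power_mono)
    also have "\<dots> = int ((max u v) ^ 2)" by simp
    also have "\<dots> \<le> int n" using isq(2)[of "max u v" n] that by (simp only: of_nat_le_iff)
    finally show ?thesis .
  qed
  have bounds: "X ^ 2 \<le> int b * int c" "Y ^ 2 \<le> int a * int c" "Z ^ 2 \<le> int a * int b"
    unfolding X_def Y_def Z_def using sq_le[OF le(1,2)] sq_le[OF le(3,4)] sq_le[OF le(5,6)] by auto
  have cong: "[Y = t1 * Z] (mod int a)" "[X = t2 * Z] (mod int b)" "[X = t3 * Y] (mod int c)"
    using eq unfolding X_def Y_def Z_def by (simp_all add: cong_iff_dvd_diff mod_eq_dvd_iff algebra_simps)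
  let ?Q = "int a * X\<^sup>2 + int b * Y\<^sup>2 - int c * Z\<^sup>2"
  have "[int b * Y\<^sup>2 = int c * Z\<^sup>2] (mod int a)"
  proof -
    have "[int b * Y\<^sup>2 = int b * (t1 * Z)\<^sup>2] (mod int a)" by (intro cong_mult cong_pow cong(1) cong_refl)
    also have "int b * (t1 * Z)\<^sup>2 = (int b * t1\<^sup>2) * Z\<^sup>2" by (simp add: power_mult_distrib)
    also have "[\<dots> = int c * Z\<^sup>2] (mod int a)" by (intro cong_mult t1 cong_refl)
    finally show ?thesis .
  qed
  then have "int a dvd int b * Y\<^sup>2 - int c * Z\<^sup>2" by (simp add: cong_iff_dvd_diff)
  then have da: "int a dvd ?Q" by (metis add_diff_eq dvd_add dvd_triv_left)
  have "[int a * X\<^sup>2 = int c * Z\<^sup>2] (mod int b)"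
  proof -
    have "[int a * X\<^sup>2 = int a * (t2 * Z)\<^sup>2] (mod int b)" by (intro cong_mult cong_pow cong(2) cong_refl)
    also have "int a * (t2 * Z)\<^sup>2 = (int a * t2\<^sup>2) * Z\<^sup>2" by (simp add: power_mult_distrib)
    also have "[\<dots> = int c * Z\<^sup>2] (mod int b)" by (intro cong_mult t2 cong_refl)
    finally show ?thesis .
  qed
  then have "int b dvd int a * X\<^sup>2 - int c * Z\<^sup>2" by (simp add: cong_iff_dvd_diff)
  then have "int b dvd (int a * X\<^sup>2 - int c * Z\<^sup>2) + int b * Y\<^sup>2" by (intro dvd_add) auto
  then have db: "int b dvd ?Q" by (simp add: algebra_simps)
  have "[int a * X\<^sup>2 = - int b * Y\<^sup>2] (mod int c)"
  proof -
    have "[int a * X\<^sup>2 = int a * (t3 * Y)\<^sup>2] (mod int c)" by (intro cong_mult cong_pow cong(3) cong_refl)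
    also have "int a * (t3 * Y)\<^sup>2 = (int a * t3\<^sup>2) * Y\<^sup>2" by (simp add: power_mult_distrib)
    also have "[\<dots> = - int b * Y\<^sup>2] (mod int c)" by (intro cong_mult t3 cong_refl)
    finally show ?thesis .
  qed
  then have "int c dvd int a * X\<^sup>2 + int b * Y\<^sup>2" by (simp add: cong_iff_dvd_diff)
  then have dc: "int c dvd ?Q" by (intro dvd_diff) auto
  have "int a * int b * int c dvd ?Q"
  proof -
    have "int a * int b dvd ?Q" using da db cop(1) by (intro divides_mult) auto
    moreover have "coprime (int a * int b) (int c)" using cop(2,3) by simp
    ultimately show ?thesis using dc by (rule_tac divides_mult)
  qed
  then obtain k where k: "?Q = int a * int b * int c * k" by blast
  let ?M = "int a * int b * int c"
  have Mpos: "?M > 0" using pos by simp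
  \<comment> \<open>The prime \<open>b\<close> divides \<open>a * b\<close> and \<open>b * c\<close> exactly once, so neither is a square.\<close>
  have nosq: "S ^ 2 \<noteq> int b * int n" if "coprime b n" for S :: int and n :: nat
  proof
    assume S: "S ^ 2 = int b * int n"
    then have "int b dvd S" using b by (metis dvd_triv_left prime_dvd_power prime_nat_int_transfer)
    then obtain S' where "S = int b * S'" by blast
    then have "int b * S' ^ 2 = int n" using S pos(2) by (simp add: power2_eq_square mult_ac)
    then have "b dvd n" by (metis dvd_triv_left int_dvd_int_iff)
    then show False using that b by (metis coprime_absorb_left not_prime_unit)
  qed
  have Zlt: "Z ^ 2 < int a * int b"
    using bounds(3) nosq[of a Z] cop(1) by (simp add: coprime_commute mult.commute less_le)
  have Xlt: "X ^ 2 < int b * int c"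
    using bounds(1) nosq[of c X] cop(3) by (simp add: less_le)
  have "k > -1"
  proof -
    have "int c * Z\<^sup>2 < int c * (int a * int b)" using Zlt pos(3) by simp
    moreover have "int a * X\<^sup>2 + int b * Y\<^sup>2 \<ge> 0" by simp
    moreover have "int c * (int a * int b) = ?M" by (simp add: mult_ac)
    ultimately have "?M * k > ?M * (-1)" unfolding k[symmetric] by linarith
    then show ?thesis using Mpos by (simp only: mult_less_cancel_left_pos)
  qed
  moreover have "k < 2"
  proof -
    have "int a * X\<^sup>2 < int a * (int b * int c)" using Xlt pos(1) by simp
    moreover have "int b * Y\<^sup>2 \<le> int b * (int a * int c)" using bounds(2) by (simp add: mult_left_mono)
    moreover have "int c * Z\<^sup>2 \<ge> 0" by simp
    moreover have "int a * (int b * int c) = ?M" "int b * (int a * int c) = ?M" by (simp_all add: mult_ac)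
    ultimately have "?M * k < ?M * 2" unfolding k[symmetric] by linarith
    then show ?thesis using Mpos by (simp only: mult_less_cancel_left_pos)
  qed
  ultimately consider "k = 0" | "k = 1" by linarith
  then show ?thesis
  proof cases
    case 1
    then have "int a * X\<^sup>2 + int b * Y\<^sup>2 = int c * Z\<^sup>2" using k by simp
    moreover have "Z \<noteq> 0"
    proof
      assume "Z = 0"
      then have "int a * X\<^sup>2 + int b * Y\<^sup>2 = 0" using calculation by simp
      then have "int a * X\<^sup>2 = 0" "int b * Y\<^sup>2 = 0"
        using zero_le_mult_iff[of "int a" "X\<^sup>2"] zero_le_mult_iff[of "int b" "Y\<^sup>2"] by (smt (verit) of_nat_0_le_iff zero_le_power2)+
      then have "X = 0" "Y = 0" using pos by auto
      then show False using ne \<open>Z = 0\<close> by (auto simp: X_def Y_def Z_def)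
    qed
    ultimately show ?thesis using that by blast
  next
    case 2
    \<comment> \<open>Multiplying \<open>a X\<^sup>2 + b Y\<^sup>2\<close> by \<open>Z\<^sup>2 + a b\<close> gives another value of the same form.\<close>
    then have Q: "int a * X\<^sup>2 + int b * Y\<^sup>2 = int c * (Z\<^sup>2 + int a * int b)" using k by (simp add: algebra_simps)
    have "int a * (X * Z + int b * Y)\<^sup>2 + int b * (Y * Z - int a * X)\<^sup>2 =
        (int a * X\<^sup>2 + int b * Y\<^sup>2) * (Z\<^sup>2 + int a * int b)"
      by (simp add: power2_eq_square algebra_simps)
    also have "\<dots> = int c * (Z\<^sup>2 + int a * int b)\<^sup>2" unfolding Q by (simp add: power2_eq_square)
    finally have "int a * (X * Z + int b * Y)\<^sup>2 + int b * (Y * Z - int a * X)\<^sup>2 = int c * (Z\<^sup>2 + int a * int b)\<^sup>2" .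
    moreover have "Z\<^sup>2 + int a * int b > 0" using pos by (simp add: add_nonneg_pos)
    ultimately show ?thesis using that by (metis less_irrefl)
  qed
qed

lemma Legendre_cong:
  assumes "[a = b] (mod p)" shows "Legendre a p = Legendre b p"
proof -
  have "[a = 0] (mod p) \<longleftrightarrow> [b = 0] (mod p)" "QuadRes p a \<longleftrightarrow> QuadRes p b"
    using assms unfolding QuadRes_def by (meson cong_sym cong_trans)+
  then show ?thesis by (simp add: Legendre_def)
qed

lemma Legendre_values: "Legendre a p \<in> {-1, 0, 1}"
  by (simp add: Legendre_def)

lemma Legendre_0_iff: "Legendre a p = 0 \<longleftrightarrow> p dvd a"
  by (simp add: Legendre_def cong_0_iff)

lemma Legendre_mult:
  fixes p :: nat
  assumes p: "prime p" "2 < p"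
  shows "Legendre (a * b) p = Legendre a p * Legendre b p"
proof -
  have "[Legendre (a * b) p = (a * b) ^ ((p - 1) div 2)] (mod int p)"
    by (rule euler_criterion[OF p])
  also have "(a * b) ^ ((p - 1) div 2) = a ^ ((p - 1) div 2) * b ^ ((p - 1) div 2)"
    by (rule power_mult_distrib)
  also have "[\<dots> = Legendre a p * Legendre b p] (mod int p)"
    by (intro cong_mult cong_sym[OF euler_criterion[OF p]])
  finally have dv: "int p dvd Legendre (a * b) p - Legendre a p * Legendre b p"
    by (simp add: cong_iff_dvd_diff)
  have "\<bar>Legendre (a * b) p - Legendre a p * Legendre b p\<bar> \<le> 2"
    using Legendre_values[of "a * b" "int p"] Legendre_values[of a "int p"] Legendre_values[of b "int p"] by auto
  then show ?thesis using dv p(2) zdvd_not_zless[of "\<bar>Legendre (a * b) p - Legendre a p * Legendre b p\<bar>" "int p"] by fastforce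
qed

lemma Legendre_square:
  fixes p :: nat
  assumes "prime p" "\<not> int p dvd a" shows "Legendre (a\<^sup>2) p = 1"
proof -
  have "QuadRes (int p) (a\<^sup>2)" unfolding QuadRes_def by (intro exI[of _ a]) simp
  moreover have "\<not> [a\<^sup>2 = 0] (mod int p)" using assms prime_dvd_power[of "int p"] by (auto simp: cong_0_iff)
  ultimately show ?thesis by (simp add: Legendre_def)
qed

lemma real_char_Legendre:
  fixes q N :: nat
  assumes q: "prime q" "2 < q" "q dvd N" and N: "N > 0"
  shows "real_char N (\<lambda>n. if coprime n N then real_of_int (Legendre (int n) (int q)) else 0)"
    (is "real_char N ?\<psi>")
  unfolding real_char_def
proof (intro conjI allI)
  fix a b :: nat
  show "?\<psi> (a * b) = ?\<psi> a * ?\<psi> b" using Legendre_mult[OF q(1,2), of "int a" "int b"] by simp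
  have "coprime (a + N) N \<longleftrightarrow> coprime a N" by (metis coprime_iff_gcd_eq_1 gcd_add1)
  moreover have "Legendre (int (a + N)) (int q) = Legendre (int a) (int q)"
    by (rule Legendre_cong) (use q(3) in \<open>auto simp: cong_iff_dvd_diff\<close>)
  ultimately show "?\<psi> (a + N) = ?\<psi> a" by simp
  show "?\<psi> a \<in> {-1, 0, 1}" using Legendre_values[of "int a" "int q"] by auto
  have "Legendre (int a) (int q) \<noteq> 0" if "coprime a N"
  proof
    assume "Legendre (int a) (int q) = 0"
    then have "q dvd a" by (simp add: Legendre_0_iff)
    then show False using that q(1,3) by (metis coprime_common_divisor not_prime_unit)
  qed
  then show "?\<psi> a \<noteq> 0 \<longleftrightarrow> coprime a N" by simp
qed (use N in simp)

lemma real_char_mod4: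
  fixes N :: nat
  assumes N: "4 dvd N" "N > 0"
  shows "real_char N (\<lambda>n. if coprime n N then if n mod 4 = 1 then 1 else -1 else 0)"
    (is "real_char N ?\<psi>")
  unfolding real_char_def
proof (intro conjI allI)
  have odd: "n mod 4 = 1 \<or> n mod 4 = 3" if "coprime n N" for n
  proof -
    have "odd n" using that N by (meson coprime_common_divisor dvd_trans even_numeral odd_one)
    then show ?thesis by presburger
  qed
  fix a b :: nat
  show "?\<psi> (a * b) = ?\<psi> a * ?\<psi> b"
  proof (cases "coprime (a * b) N")
    case True
    then have cop: "coprime a N" "coprime b N" by auto
    have "(a * b) mod 4 = ((a mod 4) * (b mod 4)) mod 4" by (simp add: mod_mult_eq)
    then show ?thesis using cop odd[OF cop(1)] odd[OF cop(2)] by auto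
  qed auto
  have "coprime (a + N) N \<longleftrightarrow> coprime a N" by (metis coprime_iff_gcd_eq_1 gcd_add1)
  moreover have "(a + N) mod 4 = a mod 4" using N(1) by (metis dvd_imp_mod_0 add.right_neutral mod_add_right_eq)
  ultimately show "?\<psi> (a + N) = ?\<psi> a" by simp
qed (use N in auto)

text \<open>
  The characters are the Legendre symbols at the primes in \<open>Q\<close> and the character modulo \<open>4\<close>, all
  regarded modulo the common multiple \<open>4 * \<Prod>Q\<close>.
\<close>
lemma prime_with_prescribed_Legendre:
  fixes Q :: "nat set" and a :: nat
  assumes Q: "finite Q" "\<And>q. q \<in> Q \<Longrightarrow> prime q \<and> 2 < q \<and> \<not> q dvd a" and a: "a mod 4 = 1"
  obtains l where "prime l" "l mod 4 = 1" "l \<notin> Q" "\<And>q. q \<in> Q \<Longrightarrow> Legendre (int l) (int q) = Legendre (int a) (int q)"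
proof -
  define N where "N = 4 * \<Prod>Q"
  define \<psi> :: "nat \<Rightarrow> nat \<Rightarrow> real" where
    "\<psi> q n = (if coprime n N then real_of_int (Legendre (int n) (int q)) else 0)" for q n
  define \<psi>4 :: "nat \<Rightarrow> real" where
    "\<psi>4 n = (if coprime n N then if n mod 4 = 1 then 1 else -1 else 0)" for n
  have N: "N > 0" using Q prime_gt_0_nat unfolding N_def by (auto intro!: prod_pos)
  have qN: "q dvd N" if "q \<in> Q" for q using that Q(1) unfolding N_def by (simp add: dvd_prod_eqI)
  have cop: "coprime a N"
  proof -
    have "coprime a q" if "q \<in> Q" for q using Q(2)[OF that] prime_imp_coprime[of q a] by (simp add: coprime_commute)
    then have "coprime a (\<Prod>Q)" by (intro prod_coprime_right) auto
    moreover have "odd a" using a by presburger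
    then have "coprime a (2 ^ 2)" unfolding coprime_power_right_iff by (simp add: coprime_right_2_iff_odd)
    then have "coprime a 4" by simp
    ultimately show ?thesis by (simp add: N_def)
  qed
  have "\<exists>l. prime l \<and> coprime l N \<and> (\<forall>\<phi>\<in>insert \<psi>4 (\<psi> ` Q). \<phi> l = \<phi> a)"
  proof (rule prime_with_prescribed_real_chars[OF _ _ N cop])
    fix \<phi> assume "\<phi> \<in> insert \<psi>4 (\<psi> ` Q)"
    then show "real_char N \<phi>"
      using real_char_mod4[of N] real_char_Legendre[of _ N] Q(2) qN N
      unfolding \<psi>4_def[abs_def] \<psi>_def[abs_def] by (auto simp: N_def)
  qed (use Q in simp)
  then obtain l where l: "prime l" "coprime l N" "\<psi>4 l = \<psi>4 a" "\<And>q. q \<in> Q \<Longrightarrow> \<psi> q l = \<psi> q a" by blast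
  show ?thesis
  proof (rule that[OF l(1)])
    show "l mod 4 = 1" using l(2,3) cop a by (simp add: \<psi>4_def split: if_splits)
    show "l \<notin> Q" using l(1,2) qN by (metis coprime_common_divisor dvd_refl not_prime_unit)
    show "Legendre (int l) (int q) = Legendre (int a) (int q)" if "q \<in> Q" for q
      using l(4)[OF that] l(2) cop by (simp add: \<psi>_def)
  qed
qed

lemma quadratic_cong_solution:
  fixes u v :: int and q :: nat
  assumes q: "prime q" and L: "Legendre (u * v) q = 1"
  obtains t where "[u * t\<^sup>2 = v] (mod int q)"
proof -
  have nd: "\<not> int q dvd u * v" and "QuadRes (int q) (u * v)"
    using L by (auto simp: Legendre_def cong_0_iff split: if_splits)
  then obtain s where s: "[s\<^sup>2 = u * v] (mod int q)" unfolding QuadRes_def by blast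
  have "coprime u (int q)" using nd q by (metis coprime_commute dvd_mult2 prime_imp_coprime prime_nat_int_transfer)
  then obtain w where w: "[u * w = 1] (mod int q)" using cong_solve_coprime_int by blast
  have "[u * (s * w)\<^sup>2 = (u * w) * w * s\<^sup>2] (mod int q)" by (simp add: power2_eq_square algebra_simps)
  also have "[(u * w) * w * s\<^sup>2 = 1 * w * (u * v)] (mod int q)" by (intro cong_mult w s cong_refl)
  also have "1 * w * (u * v) = (u * w) * v" by simp
  also have "[(u * w) * v = 1 * v] (mod int q)" by (intro cong_mult w cong_refl)
  finally show ?thesis using that by simp
qed

text \<open>
  Solutions modulo the individual primes are combined by the Chinese remainder theorem.
\<close>
lemma quadratic_cong_solution_prod:
  fixes u v :: int and Q :: "nat set"
  assumes "finite Q" "\<And>q. q \<in> Q \<Longrightarrow> prime q \<and> Legendre (u * v) q = 1"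
  shows "\<exists>t. [u * t\<^sup>2 = v] (mod int (\<Prod>Q))"
  using assms
proof (induction Q rule: finite_induct)
  case empty
  then show ?case by simp
next
  case (insert q Q)
  obtain t1 where t1: "[u * t1\<^sup>2 = v] (mod int (\<Prod>Q))" using insert by auto
  obtain t2 where t2: "[u * t2\<^sup>2 = v] (mod int q)" using insert.prems quadratic_cong_solution by blast
  have "coprime q (\<Prod>Q)"
    using insert by (intro prod_coprime_right) (metis id_apply insertCI primes_coprime)
  then have "coprime (int q) (int (\<Prod>Q))" by (simp only: coprime_int_iff)
  then obtain t where t: "[t = t2] (mod int q)" "[t = t1] (mod int (\<Prod>Q))"
    using binary_chinese_remainder_int by blast
  have "[u * t\<^sup>2 = u * t2\<^sup>2] (mod int q)" "[u * t\<^sup>2 = u * t1\<^sup>2] (mod int (\<Prod>Q))"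
    by (intro cong_mult cong_pow t cong_refl)+
  then have "[u * t\<^sup>2 = v] (mod int q)" "[u * t\<^sup>2 = v] (mod int (\<Prod>Q))"
    using t1 t2 cong_trans by blast+
  then have "[u * t\<^sup>2 = v] (mod int q * int (\<Prod>Q))"
    using \<open>coprime (int q) _\<close> coprime_cong_mult by blast
  then show ?case using insert.hyps by (simp add: prod.insert) blast
qed

lemma Legendre_prod:
  fixes q :: nat and A :: "nat set"
  assumes "prime q" "2 < q" "finite A"
  shows "Legendre (int (\<Prod>A)) q = (\<Prod>a\<in>A. Legendre (int a) q)"
  using assms(3)
proof (induction A rule: finite_induct)
  case empty
  have "\<not> [1 = 0] (mod int q)" using assms(2) by (simp add: cong_0_iff)
  moreover have "QuadRes (int q) 1" unfolding QuadRes_def by (intro exI[of _ 1]) simp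
  ultimately show ?case by (simp add: Legendre_def)
next
  case (insert a A)
  then show ?case using Legendre_mult[OF assms(1,2), of "int a" "int (\<Prod>A)"] by simp
qed

text \<open>
  Quadratic reciprocity for a product of distinct primes, that is, for a Jacobi symbol. Only the residue
  of the product modulo \<open>4\<close> enters the sign.
\<close>
lemma reciprocity_prod:
  fixes r :: nat and A :: "nat set"
  assumes r: "prime r" "2 < r" and A: "finite A" "\<And>q. q \<in> A \<Longrightarrow> prime q \<and> 2 < q \<and> q \<noteq> r"
  shows "odd (\<Prod>A) \<and> (\<Prod>q\<in>A. Legendre (int r) (int q)) =
    Legendre (int (\<Prod>A)) (int r) * (-1) ^ ((r - 1) div 2 * ((\<Prod>A - 1) div 2))"
  using A
proof (induction A rule: finite_induct)
  case empty
  show ?case using Legendre_prod[OF r, of "{}"] by simp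
next
  case (insert q A)
  define n where "n = \<Prod>A"
  have IH: "odd n" "(\<Prod>q\<in>A. Legendre (int r) (int q)) = Legendre (int n) (int r) * (-1) ^ ((r - 1) div 2 * ((n - 1) div 2))"
    using insert by (auto simp: n_def)
  have q: "prime q" "2 < q" "q \<noteq> r" using insert.prems by auto
  then have "odd q" using prime_odd_nat by blast
  have "Legendre q r * Legendre q r = 1"
  proof -
    have "\<not> int r dvd int q" using q r primes_dvd_imp_eq[of r q] by auto
    then have "Legendre q r \<noteq> 0" by (simp add: Legendre_0_iff)
    then show ?thesis using Legendre_values[of "int q" "int r"] by auto
  qed
  then have rq: "Legendre r q = Legendre q r * (-1) ^ ((r - 1) div 2 * ((q - 1) div 2))"
    using Quadratic_Reciprocity[OF r q(1,2)] q(3)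
    by (metis mult.assoc mult.commute mult.right_neutral mult_cancel_left)
  have par: "even ((q * n - 1) div 2) = even ((q - 1) div 2 + (n - 1) div 2)"
  proof -
    obtain i j where ij: "q = 2 * i + 1" "n = 2 * j + 1" using \<open>odd q\<close> IH(1) by (auto elim!: oddE)
    have "(q * n - 1) div 2 = 2 * (i * j) + i + j" unfolding ij by (simp add: algebra_simps)
    then show ?thesis by (simp add: ij)
  qed
  have "(-1::int) ^ ((r - 1) div 2 * ((q - 1) div 2)) * (-1) ^ ((r - 1) div 2 * ((n - 1) div 2)) =
      (-1) ^ ((r - 1) div 2 * ((q * n - 1) div 2))"
    unfolding power_add[symmetric] distrib_left[symmetric] using par by (auto simp: minus_one_power_iff)
  then show ?case
    using insert.hyps IH rq \<open>odd q\<close> Legendre_mult[OF r, of "int q" "int n"]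
    by (simp add: n_def[symmetric] mult_ac)
qed

section \<open>Certificates of integrality at one prime\<close>

text \<open>
  Write \<open>m = 1 + p X\<^sup>2 = m0 t\<^sup>2\<close> with \<open>m0\<close> squarefree; it has to be represented by
  \<open>E\<^sup>2 - r F\<^sup>2 + p r W\<^sup>2\<close>. It suffices to find a prime \<open>l\<close> such that a nonzero square times
  \<open>l\<close> is of the form \<open>e\<^sup>2 - r f\<^sup>2\<close> as well as of the form
  \<open>m0 u\<^sup>2 - p r w\<^sup>2\<close>. By Legendre's theorem this amounts to conditions on residue
  symbols at \<open>p\<close>, \<open>r\<close>, \<open>l\<close> and the primes \<open>q\<close> dividing \<open>m0\<close>. As \<open>-p\<close> is a square modulo
  such \<open>q\<close>, the condition at \<open>q\<close> is that \<open>l\<close> and \<open>r\<close> have the same symbol. The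
  conditions at \<open>l\<close> itself then follow from reciprocity, and this is the point where it matters that
  \<open>X\<close> is an integer: \<open>m\<close> is \<open>1\<close> modulo \<open>4\<close>, \<open>p\<close> and \<open>r\<close>.
\<close>
lemma integer_represented:
  fixes p r :: nat and X :: int
  assumes p: "prime p" "2 < p" and r: "prime r" "2 < r" and ne: "p \<noteq> r" and X: "2 * int r dvd X"
  shows "\<exists>W E F :: rat. 1 + of_nat p * ((of_int X)\<^sup>2 - of_nat r * W\<^sup>2) = E\<^sup>2 - of_nat r * F\<^sup>2"
proof -
  define m where "m = nat (1 + int p * X\<^sup>2)"
  have m: "int m = 1 + int p * X\<^sup>2" by (simp add: m_def)
  then have "m > 0" by (metis add_nonneg_pos less_numeral_extra(1) of_nat_0_le_iff of_nat_0_less_iff zero_le_mult_iff zero_le_power2 add.commute)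
  define m0 where "m0 = squarefree_part m"
  define t where "t = square_part m"
  have mt: "m = m0 * t\<^sup>2" unfolding m0_def t_def by (rule squarefree_decompose)
  have m0: "squarefree m0" "m0 > 0" unfolding m0_def by (auto intro: Nat.gr0I)
  define A where "A = prime_factors m0"
  have A: "finite A" "\<Prod>A = m0"
  proof -
    show "finite A" by (simp add: A_def)
    have "m0 = (\<Prod>q\<in>A. q ^ multiplicity q m0)" unfolding A_def by (rule prime_factorization_nat[OF m0(2)])
    also have "\<dots> = \<Prod>A" using m0 squarefree_factorial_semiring'[of m0] by (intro prod.cong) (auto simp: A_def)
    finally show "\<Prod>A = m0" by simp
  qed
  obtain Y where Y: "X = 2 * int r * Y" using X by blast
  have m_mod: "[int m = 1] (mod int p)" "[int m = 1] (mod int r)" "[int m = 1] (mod 4)"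
    unfolding m Y by (simp_all add: cong_iff_dvd_diff power2_eq_square)
  have odd_m: "odd m" using m Y by (metis even_add even_mult_iff even_of_nat even_power odd_one dvd_triv_left mult.assoc pos2)
  have qm: "prime q \<and> q dvd m" if "q \<in> A" for q
    using that mt unfolding A_def by (auto simp: in_prime_factors_iff)
  have A_prime: "prime q \<and> 2 < q \<and> q \<noteq> p \<and> q \<noteq> r" if "q \<in> A" for q
  proof (intro conjI)
    show q: "prime q" using qm[OF that] ..
    have "q \<noteq> 2" using qm[OF that] odd_m by auto
    then show "2 < q" using prime_ge_2_nat[OF q] by simp
    have "int q dvd int m" using qm[OF that] by simp
    then have "\<not> [int m = 1] (mod int q)"
      using prime_gt_1_nat[OF q] by (metis cong_0_iff cong_sym cong_trans int_dvd_int_iff nat_dvd_1_iff_1 of_nat_1 less_irrefl)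
    then show "q \<noteq> p" "q \<noteq> r" using m_mod by auto
  qed
  have L1: "Legendre 1 (int s) = 1" if "prime s" "2 < s" for s :: nat
    using Legendre_square[of s 1] that by simp
  have m0_sq: "Legendre (int m0) (int s) = 1" if s: "prime s" "2 < s" "[int m = 1] (mod int s)" for s
  proof -
    have "\<not> int s dvd int t"
    proof
      assume "int s dvd int t"
      then have "int s dvd int m0 * (int t * int t)" by (meson dvd_mult)
      then have "int s dvd int m" unfolding mt by (simp add: power2_eq_square)
      then have "int s dvd 1" using cong_dvd_iff[OF s(3)] by simp
      then show False using s by simp
    qed
    then have "Legendre (int m) (int s) = Legendre (int m0) (int s)"
      unfolding mt using Legendre_mult[OF s(1,2), of "int m0" "(int t)\<^sup>2"] Legendre_square[OF s(1), of "int t"] by simp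
    then show ?thesis using Legendre_cong[OF s(3)] L1[OF s(1,2)] by simp
  qed
  \<comment> \<open>The auxiliary prime \<open>l\<close> will have the Legendre symbols of \<open>a\<close>, which is \<open>1\<close> modulo the fixed primes
    and \<open>r\<close> modulo the primes dividing \<open>m0\<close>.\<close>
  have "coprime m0 (4 * p * r)"
  proof -
    have "coprime q (4 * p * r)" if "q \<in> A" for q
    proof -
      have "coprime q 2" "coprime q p" "coprime q r"
        using A_prime[OF that] p r prime_odd_nat[of q] by (auto intro!: primes_coprime)
      then have "coprime q (2 ^ 2 * p * r)" by (simp only: coprime_mult_right_iff coprime_power_right_iff) simp
      then show ?thesis by simp
    qed
    then show ?thesis unfolding A(2)[symmetric] by (intro prod_coprime_left) auto
  qed
  then obtain a where a: "[a = r] (mod m0)" "[a = 1] (mod 4 * p * r)"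
    using binary_chinese_remainder_nat by blast
  have a_mod: "[int a = int r] (mod int q)" if "q \<in> A" for q
    using that a(1) unfolding A_def by (meson cong_dvd_modulus_nat cong_int_iff in_prime_factors_iff)
  have a1: "[a = 1] (mod p)" "[a = 1] (mod r)" "[a = 1] (mod 4)"
    using a(2) by (auto intro: cong_dvd_modulus_nat)
  have a_nd: "\<not> q dvd a" if "q \<in> A \<union> {p, r}" for q
  proof
    assume "q dvd a"
    consider "q \<in> A" | "q = p" | "q = r" using \<open>q \<in> A \<union> {p, r}\<close> by blast
    then show False
    proof cases
      case 1
      then have "q dvd r" using cong_dvd_iff[OF a_mod[OF 1]] \<open>q dvd a\<close> by simp
      then show False using A_prime[OF 1] r(1) primes_dvd_imp_eq by blast
    next
      case 2
      then show False using cong_dvd_iff[OF a1(1)] \<open>q dvd a\<close> p by simp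
    next
      case 3
      then show False using cong_dvd_iff[OF a1(2)] \<open>q dvd a\<close> r by simp
    qed
  qed
  obtain l where l: "prime l" "l mod 4 = 1" "l \<notin> A \<union> {p, r}"
    and lL: "\<And>q. q \<in> A \<union> {p, r} \<Longrightarrow> Legendre (int l) (int q) = Legendre (int a) (int q)"
  proof (rule prime_with_prescribed_Legendre[of "A \<union> {p, r}" a])
    show "a mod 4 = 1" using a1(3) by (simp add: cong_def)
  qed (use A(1) A_prime p r a_nd in auto)
  have l2: "2 < l" using l(1,2) prime_ge_2_nat[OF l(1)] by (cases "l = 2") auto
  have lA: "Legendre (int l) (int q) = Legendre (int r) (int q)" if "q \<in> A" for q
    using lL[of q] Legendre_cong[OF a_mod[OF that]] that by simp
  have lp: "Legendre (int l) (int p) = 1" and lr: "Legendre (int l) (int r) = 1"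
    using lL[of p] lL[of r] Legendre_cong[of "int a" 1 "int p"] Legendre_cong[of "int a" 1 "int r"] a1 L1 p r
    by (auto simp: cong_int_iff[symmetric])
  have recip: "Legendre (int s) (int l) = Legendre (int l) (int s)" if "prime s" "2 < s" "s \<noteq> l" for s
  proof -
    have "even ((l - 1) div 2)" using l(2) by presburger
    then have "Legendre (int s) (int l) * Legendre (int l) (int s) = 1"
      using Quadratic_Reciprocity[OF that(1,2) l(1) l2 that(3)] by simp
    then show ?thesis using Legendre_values[of "int s" "int l"] Legendre_values[of "int l" "int s"] by auto
  qed
  have pl: "Legendre (int p) (int l) = 1" "Legendre (int r) (int l) = 1"
    using recip[of p] recip[of r] lp lr p r l(3) by auto
  have rA: "(\<Prod>q\<in>A. Legendre (int r) (int q)) = 1"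
  proof -
    have "[int m0 * (int t)\<^sup>2 = 1] (mod 4)" using m_mod(3) unfolding mt by simp
    moreover have "[(int t)\<^sup>2 = 1] (mod 4)"
    proof -
      have "odd t" using odd_m mt by simp
      then obtain j where "t = 2 * j + 1" by (elim oddE)
      then have "(int t)\<^sup>2 - 1 = 4 * (int j * int j + int j)" by (simp add: power2_eq_square algebra_simps)
      then show ?thesis by (simp add: cong_iff_dvd_diff)
    qed
    then have "[int m0 * (int t)\<^sup>2 = int m0 * 1] (mod 4)" by (intro cong_mult cong_refl)
    ultimately have "[int m0 = 1] (mod 4)" by (metis cong_sym cong_trans mult.right_neutral)
    then have "m0 mod 4 = 1" unfolding cong_def by (metis of_nat_eq_iff of_nat_numeral of_nat_1 zmod_int mod_less one_less_numeral_iff semiring_norm(76) numeral_One)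
    then have "even ((m0 - 1) div 2)" by presburger
    then show ?thesis
      using reciprocity_prod[OF r A(1)] A_prime m0_sq[OF r m_mod(2)] A(2) by auto
  qed
  have m0l: "Legendre (int m0) (int l) = 1"
  proof -
    have "Legendre (int m0) (int l) = (\<Prod>q\<in>A. Legendre (int q) (int l))"
      using Legendre_prod[OF l(1) l2 A(1)] A(2) by simp
    also have "\<dots> = (\<Prod>q\<in>A. Legendre (int r) (int q))"
    proof (intro prod.cong refl)
      fix q assume q: "q \<in> A"
      then have "q \<noteq> l" using l(3) by auto
      then show "Legendre (int q) (int l) = Legendre (int r) (int q)"
        using recip[of q] A_prime[OF q] lA[OF q] by auto
    qed
    finally show ?thesis using rA by simp
  qed
  have cop_l: "coprime s l" if "prime s" "s \<noteq> l" for s using that l(1) by (simp add: primes_coprime)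
  \<comment> \<open>\<open>l\<close> times a square is a value of \<open>E\<^sup>2 - r F\<^sup>2\<close> \<dots>\<close>
  obtain e f g :: int where norm: "int r * f\<^sup>2 + int l * g\<^sup>2 = e\<^sup>2" "e \<noteq> 0"
  proof -
    obtain t1 where t1: "[int l * t1\<^sup>2 = 1] (mod int r)"
      using quadratic_cong_solution[OF r(1), of "int l" 1] lr by auto
    obtain t2 where t2: "[int r * t2\<^sup>2 = 1] (mod int l)"
      using quadratic_cong_solution[OF l(1), of "int r" 1] pl by auto
    show ?thesis
    proof (rule legendre_conic[of r l 1 t1 t2 0])
      show "coprime r l" using cop_l r(1) l(3) by auto
    qed (use t1 t2 r l prime_gt_0_nat that in auto)
  qed
  \<comment> \<open>\<open>\<dots>\<close> and of \<open>m\<^sub>0 U\<^sup>2 - p r W\<^sup>2\<close>.\<close>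
  obtain w v u :: int where conic: "int (p * r) * w\<^sup>2 + int l * v\<^sup>2 = int m0 * u\<^sup>2" "u \<noteq> 0"
  proof -
    have pr: "\<Prod>{p, r} = p * r" using ne by simp
    obtain t1 where t1: "[int l * t1\<^sup>2 = int m0] (mod int (p * r))"
      using quadratic_cong_solution_prod[of "{p, r}" "int l" "int m0"] p r lp lr
        m0_sq[OF p m_mod(1)] m0_sq[OF r m_mod(2)]
        Legendre_mult[OF p, of "int l" "int m0"] Legendre_mult[OF r, of "int l" "int m0"]
      unfolding pr by auto
    obtain t2 where t2: "[int (p * r) * t2\<^sup>2 = int m0] (mod int l)"
      using quadratic_cong_solution[OF l(1), of "int (p * r)" "int m0"] Legendre_mult[OF l(1) l2] pl m0l by auto
    have "Legendre (int (p * r) * (- int l)) (int q) = 1" if q: "q \<in> A" for q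
    proof -
      have q2: "prime q" "2 < q" using A_prime[OF q] by auto
      have sq: "[(int p * X)\<^sup>2 = - int p] (mod int q)"
      proof -
        have "(int p * X)\<^sup>2 - (- int p) = int p * int m" unfolding m by (simp add: power2_eq_square algebra_simps)
        then show ?thesis using qm[OF q] by (simp add: cong_iff_dvd_diff)
      qed
      then have "int q dvd (int p * X)\<^sup>2 \<longleftrightarrow> int q dvd - int p" by (rule cong_dvd_iff)
      moreover have ndp: "\<not> int q dvd - int p" using A_prime[OF q] p(1) primes_dvd_imp_eq by auto
      ultimately have "\<not> int q dvd int p * X" by (metis dvd_mult2 power2_eq_square)
      then have "Legendre (- int p) (int q) = 1"
        using Legendre_square[OF q2(1)] Legendre_cong[OF sq] by simp
      moreover have "Legendre (int (p * r) * (- int l)) (int q) = Legendre (- int p) (int q) * Legendre (int r * int l) (int q)"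
        by (subst Legendre_mult[OF q2, symmetric]) (simp add: mult.assoc)
      moreover have "Legendre (int r * int l) (int q) = 1"
      proof -
        have "Legendre (int r) (int q) \<noteq> 0" using A_prime[OF q] r(1) primes_dvd_imp_eq by (auto simp: Legendre_0_iff)
        then show ?thesis using Legendre_mult[OF q2] lA[OF q] Legendre_values[of "int r" "int q"] by auto
      qed
      ultimately show ?thesis by simp
    qed
    then obtain t3 where t3: "[int (p * r) * t3\<^sup>2 = - int l] (mod int m0)"
      using quadratic_cong_solution_prod[OF A(1), of "int (p * r)" "- int l"] A_prime A(2) by auto
    show ?thesis
    proof (rule legendre_conic[of "p * r" l m0 t1 t2 t3])
      show "coprime (p * r) l" using cop_l p r l(3) by auto
      show "coprime (p * r) m0" using \<open>coprime m0 (4 * p * r)\<close> by (simp add: coprime_commute)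
      have "coprime q l" if "q \<in> A" for q using cop_l A_prime[OF that] l(3) that by auto
      then show "coprime l m0" unfolding A(2)[symmetric] by (intro prod_coprime_right) (auto simp: coprime_commute)
    qed (use t1 t2 t3 p r l m0 prime_gt_0_nat that in auto)
  qed
  have "g \<noteq> 0"
  proof
    assume "g = 0"
    then have eq: "int r * f\<^sup>2 = e\<^sup>2" using norm by simp
    then have "multiplicity (int r) (int r * f\<^sup>2) = multiplicity (int r) (e\<^sup>2)" by simp
    moreover have "f \<noteq> 0" using eq norm(2) by auto
    ultimately have "1 + 2 * multiplicity (int r) f = 2 * multiplicity (int r) e"
      using norm(2) r(1) by (simp add: prime_elem_multiplicity_mult_distrib prime_elem_multiplicity_power_distrib)
    then show False by presburger
  qed
  define W E F where "W = (of_int w * of_nat t / of_int u :: rat)"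
    and "E = (of_int v * of_nat t * of_int e / (of_int u * of_int g) :: rat)"
    and "F = (of_int v * of_nat t * of_int f / (of_int u * of_int g) :: rat)"
  have norm': "of_int e ^ 2 - of_nat r * of_int f ^ 2 = (of_nat l * of_int g ^ 2 :: rat)"
    using arg_cong[OF norm(1), of "of_int :: int \<Rightarrow> rat"] by simp
  have conic': "of_nat m0 * of_int u ^ 2 = (of_nat p * of_nat r * of_int w ^ 2 + of_nat l * of_int v ^ 2 :: rat)"
    using arg_cong[OF conic(1), of "of_int :: int \<Rightarrow> rat"] by simp
  have "E\<^sup>2 - of_nat r * F\<^sup>2 = (of_int v * of_nat t / (of_int u * of_int g))\<^sup>2 * (of_int e ^ 2 - of_nat r * of_int f ^ 2)"
    unfolding E_def F_def by (simp add: power_divide power_mult_distrib algebra_simps diff_divide_distrib)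
  also have "\<dots> = of_nat l * of_int v ^ 2 * (of_nat t / of_int u)\<^sup>2"
    unfolding norm' using \<open>g \<noteq> 0\<close> by (simp add: power_divide power_mult_distrib)
  also have "\<dots> = (of_nat m0 * of_int u ^ 2 - of_nat p * of_nat r * of_int w ^ 2) * (of_nat t / of_int u)\<^sup>2"
    unfolding conic' by simp
  also have "\<dots> = of_nat m0 * of_nat t ^ 2 - of_nat p * of_nat r * W\<^sup>2"
    unfolding W_def using conic(2) by (simp add: power_divide power_mult_distrib field_simps)
  also have "of_nat m0 * of_nat t ^ 2 = (of_nat m :: rat)" by (simp add: mt)
  also have "of_nat m = (of_int (int m) :: rat)" by simp
  also have "\<dots> = 1 + of_nat p * (of_int X)\<^sup>2" unfolding m by simp
  finally show ?thesis by (intro exI[of _ W] exI[of _ E] exI[of _ F]) (simp add: algebra_simps)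
qed

definition integrality_certificate :: "nat \<Rightarrow> nat \<Rightarrow> rat \<Rightarrow> bool" where
  "integrality_certificate p r x \<longleftrightarrow>
     (\<exists>W E F. 1 + of_nat p * (x\<^sup>2 - of_nat r * W\<^sup>2) = E\<^sup>2 - of_nat r * F\<^sup>2)"

lemma rat_common_denominator:
  fixes A :: "rat set"
  assumes "finite A"
  obtains d :: nat where "d > 0" "\<And>x. x \<in> A \<Longrightarrow> of_nat d * x \<in> \<int>"
proof -
  have "\<exists>d::nat. d > 0 \<and> (\<forall>x\<in>A. of_nat d * x \<in> \<int>)"
    using assms
  proof (induction A rule: finite_induct)
    case (insert x A)
    then obtain d :: nat where d: "d > 0" "\<forall>x\<in>A. of_nat d * x \<in> \<int>" by blast
    obtain a b where ab: "x = of_int a / of_int b" "b > 0"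
      using quotient_of_div[of x] quotient_of_denom_pos[of x] by (metis prod.exhaust)
    define e where "e = nat b"
    have e: "e > 0" "of_nat e * x = of_int a" using ab by (simp_all add: e_def)
    have "of_nat (d * e) * y \<in> \<int>" if "y \<in> insert x A" for y
    proof (cases "y = x")
      case True
      have "of_nat (d * e) * y = of_nat d * (of_nat e * x)" unfolding True by (simp only: of_nat_mult mult.assoc)
      also have "\<dots> \<in> \<int>" unfolding e(2) by (intro Ints_mult) auto
      finally show ?thesis .
    next
      case False
      then have "of_nat d * y \<in> \<int>" using d(2) that by blast
      then have "of_nat e * (of_nat d * y) \<in> \<int>" by (rule Ints_mult[OF Ints_of_nat])
      then show ?thesis by (simp add: mult_ac)
    qed
    then show ?case using d(1) e(1) by (intro exI[of _ "d * e"]) auto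
  qed (auto intro: exI[of _ 1])
  then show ?thesis using that by blast
qed

text \<open>
  Clearing denominators with the least possible \<open>T\<close>.
\<close>
lemma integrality_certificate_primitive:
  assumes cert: "integrality_certificate p r x" and q: "q > (1::nat)"
  obtains T :: nat and X W E F :: int where "T > 0" "of_nat T * x = of_int X"
    "(int T)\<^sup>2 + int p * (X\<^sup>2 - int r * W\<^sup>2) = E\<^sup>2 - int r * F\<^sup>2"
    "\<not> (q dvd T \<and> int q dvd X \<and> int q dvd W \<and> int q dvd E \<and> int q dvd F)"
proof -
  define P where "P T X W E F \<longleftrightarrow> T > 0 \<and> of_nat T * x = of_int X \<and>
    (int T)\<^sup>2 + int p * (X\<^sup>2 - int r * W\<^sup>2) = E\<^sup>2 - int r * F\<^sup>2" for T :: nat and X W E F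
  obtain w e f where eq: "1 + of_nat p * (x\<^sup>2 - of_nat r * w\<^sup>2) = e\<^sup>2 - of_nat r * f\<^sup>2"
    using cert by (auto simp: integrality_certificate_def)
  obtain d where d: "d > 0" "\<And>y. y \<in> {x, w, e, f} \<Longrightarrow> of_nat d * y \<in> \<int>"
    using rat_common_denominator[of "{x, w, e, f}"] by auto
  obtain X W E F where XWEF: "of_nat d * x = of_int X" "of_nat d * w = of_int W"
    "of_nat d * e = of_int E" "of_nat d * f = of_int F"
    using d(2)[of x] d(2)[of w] d(2)[of e] d(2)[of f] by (auto elim!: Ints_cases)
  have "(of_int ((int d)\<^sup>2 + int p * (X\<^sup>2 - int r * W\<^sup>2)) :: rat) = (of_nat d)\<^sup>2 * (1 + of_nat p * (x\<^sup>2 - of_nat r * w\<^sup>2))"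
    by (simp add: XWEF[symmetric] power_mult_distrib algebra_simps)
  also have "\<dots> = of_int (E\<^sup>2 - int r * F\<^sup>2)"
    unfolding eq by (simp add: XWEF[symmetric] power_mult_distrib algebra_simps)
  finally have "P d X W E F" unfolding P_def using d(1) XWEF(1) by (simp only: of_int_eq_iff)
  then have ex: "\<exists>T X W E F. P T X W E F" by blast
  define T where "T = (LEAST T. \<exists>X W E F. P T X W E F)"
  obtain X W E F where T: "P T X W E F" using LeastI_ex[OF ex] unfolding T_def by blast
  have "\<not> (q dvd T \<and> int q dvd X \<and> int q dvd W \<and> int q dvd E \<and> int q dvd F)"
  proof
    assume dv: "q dvd T \<and> int q dvd X \<and> int q dvd W \<and> int q dvd E \<and> int q dvd F"
    then obtain T' X' W' E' F' where eqs: "T = q * T'" "X = int q * X'" "W = int q * W'" "E = int q * E'" "F = int q * F'"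
      unfolding dvd_def by blast
    have "T' > 0" using T eqs(1) by (auto simp: P_def intro!: Nat.gr0I)
    moreover have "of_nat T' * x = of_int X'" using T q by (simp add: P_def eqs)
    moreover have "(int q)\<^sup>2 * ((int T')\<^sup>2 + int p * (X'\<^sup>2 - int r * W'\<^sup>2)) = (int q)\<^sup>2 * (E'\<^sup>2 - int r * F'\<^sup>2)"
      using T by (simp add: P_def eqs power_mult_distrib algebra_simps)
    then have "(int T')\<^sup>2 + int p * (X'\<^sup>2 - int r * W'\<^sup>2) = E'\<^sup>2 - int r * F'\<^sup>2" using q by simp
    ultimately have "P T' X' W' E' F'" by (simp add: P_def)
    then have "T \<le> T'" unfolding T_def by (intro Least_le) blast
    then show False using eqs(1) q \<open>T' > 0\<close> by simp
  qed
  then show ?thesis using that T unfolding P_def by blast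
qed

lemma anisotropic_mod_prime:
  fixes p r :: nat and E F :: int
  assumes p: "prime p" "2 < p" and r: "Legendre (int r) (int p) = -1" and dv: "int p dvd E\<^sup>2 - int r * F\<^sup>2"
  shows "int p dvd E" "int p dvd F"
proof -
  have c: "[E\<^sup>2 = int r * F\<^sup>2] (mod int p)" using dv by (simp add: cong_iff_dvd_diff)
  have "Legendre (E\<^sup>2) (int p) = Legendre (int r) (int p) * Legendre (F\<^sup>2) (int p)"
    using Legendre_cong[OF c] Legendre_mult[OF p] by simp
  moreover have "Legendre (a\<^sup>2) (int p) = (if int p dvd a then 0 else 1)" for a
    using Legendre_square[OF p(1), of a] by (simp add: Legendre_0_iff power2_eq_square)
  ultimately show "int p dvd E" "int p dvd F" using r by (auto split: if_splits)
qed

text \<open>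
  In a primitive solution \<open>p\<close> does not divide \<open>T\<close>: otherwise it would divide \<open>E\<close> and \<open>F\<close>, as \<open>r\<close>
  is not a square modulo \<open>p\<close>, and then, after division by \<open>p\<close>, also \<open>X\<close> and \<open>W\<close>.
\<close>
lemma integrality_certificate_odd_prime:
  assumes cert: "integrality_certificate p r x" and p: "prime p" "2 < p" and r: "Legendre (int r) (int p) = -1"
  obtains T :: nat and X :: int where "of_nat T * x = of_int X" "\<not> p dvd T"
proof -
  obtain T :: nat and X W E F :: int where T: "T > 0" "of_nat T * x = of_int X"
    and eq: "(int T)\<^sup>2 + int p * (X\<^sup>2 - int r * W\<^sup>2) = E\<^sup>2 - int r * F\<^sup>2"
    and prim: "\<not> (p dvd T \<and> int p dvd X \<and> int p dvd W \<and> int p dvd E \<and> int p dvd F)"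
    using integrality_certificate_primitive[OF cert prime_gt_1_nat[OF p(1)]] by blast
  have "\<not> p dvd T"
  proof
    assume pT: "p dvd T"
    then have pT': "int p dvd int T" by simp
    then have "int p dvd (int T)\<^sup>2 + int p * (X\<^sup>2 - int r * W\<^sup>2)" by (simp add: power2_eq_square)
    then have EF: "int p dvd E" "int p dvd F" using anisotropic_mod_prime[OF p r, of E F] eq by auto
    then have "int p * int p dvd E * E - int r * (F * F)" "int p * int p dvd int T * int T"
      using mult_dvd_mono[OF EF(1) EF(1)] mult_dvd_mono[OF EF(2) EF(2)] mult_dvd_mono[OF pT' pT']
      by (auto intro: dvd_diff)
    then have "int p * int p dvd int p * (X\<^sup>2 - int r * W\<^sup>2)"
      using eq by (metis add_diff_cancel_left' dvd_diff power2_eq_square)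
    then have "int p dvd X\<^sup>2 - int r * W\<^sup>2" using p(1) by simp
    then show False using anisotropic_mod_prime[OF p r, of X W] EF pT prim by auto
  qed
  then show ?thesis using that T by blast
qed

text \<open>
  Modulo \<open>4\<close> the equation says that the sum of the four variables is divisible by \<open>4\<close>, so they are all
  even or all odd; the second case is impossible modulo \<open>8\<close>. The variables stand for squares.
\<close>
lemma form_two_adic:
  fixes s x w e f :: int
  assumes x: "x = 4 * k1 \<or> x = 8 * k1 + 1" and w: "w = 4 * k2 \<or> w = 8 * k2 + 1"
    and e: "e = 4 * k3 \<or> e = 8 * k3 + 1" and f: "f = 4 * k4 \<or> f = 8 * k4 + 1"
    and eq: "16 * s + 7 * (x - 3 * w) = e - 3 * f"
  shows "even x \<and> even w \<and> even e \<and> even f"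
proof -
  have split: "\<exists>i a. y = 4 * i + a \<and> (a = 0 \<and> even y \<or> a = 1 \<and> y = 8 * k + 1)"
    if "y = 4 * k \<or> y = 8 * k + 1" for y k :: int
    using that
  proof
    assume "y = 4 * k"
    then show ?thesis by (intro exI[of _ k] exI[of _ 0]) simp
  next
    assume "y = 8 * k + 1"
    then show ?thesis by (intro exI[of _ "2 * k"] exI[of _ 1]) simp
  qed
  obtain i1 a1 where 1: "x = 4 * i1 + a1" "a1 = 0 \<and> even x \<or> a1 = 1 \<and> x = 8 * k1 + 1" using split[OF x] by blast
  obtain i2 a2 where 2: "w = 4 * i2 + a2" "a2 = 0 \<and> even w \<or> a2 = 1 \<and> w = 8 * k2 + 1" using split[OF w] by blast
  obtain i3 a3 where 3: "e = 4 * i3 + a3" "a3 = 0 \<and> even e \<or> a3 = 1 \<and> e = 8 * k3 + 1" using split[OF e] by blast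
  obtain i4 a4 where 4: "f = 4 * i4 + a4" "a4 = 0 \<and> even f \<or> a4 = 1 \<and> f = 8 * k4 + 1" using split[OF f] by blast
  define m where "m = 4 * s + 2 * x - 5 * w + f - i1 - i2 - i3 - i4"
  have m: "a1 + a2 + a3 + a4 = 4 * m" 
  proof -
    have "a1 = x - 4 * i1" "a2 = w - 4 * i2" "a3 = e - 4 * i3" "a4 = f - 4 * i4"
      using 1(1) 2(1) 3(1) 4(1) by simp_all
    moreover have "e = 16 * s + 7 * (x - 3 * w) + 3 * f" using eq by simp
    ultimately show ?thesis unfolding m_def by simp
  qed
  have b: "0 \<le> a1 \<and> a1 \<le> 1" "0 \<le> a2 \<and> a2 \<le> 1" "0 \<le> a3 \<and> a3 \<le> 1" "0 \<le> a4 \<and> a4 \<le> 1"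
    using 1(2) 2(2) 3(2) 4(2) by auto
  have "m = 0 \<or> m = 1" using m b by linarith
  then show ?thesis
  proof
    assume "m = 0"
    then have "a1 = 0" "a2 = 0" "a3 = 0" "a4 = 0" using m b by linarith+
    then show ?thesis using 1(2) 2(2) 3(2) 4(2) by simp
  next
    assume "m = 1"
    then have "a1 = 1" "a2 = 1" "a3 = 1" "a4 = 1" using m b by linarith+
    then have "x = 8 * k1 + 1" "w = 8 * k2 + 1" "e = 8 * k3 + 1" "f = 8 * k4 + 1"
      using 1(2) 2(2) 3(2) 4(2) by simp_all
    then have "8 * (2 * s + 7 * k1 - 21 * k2 - k3 + 3 * k4) = 12" using eq by simp
    then show ?thesis by presburger
  qed
qed

text \<open>
  The quaternion algebra \<open>(3, 7)\<close> is ramified at \<open>2\<close> although both entries are odd, which keeps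
  the prime \<open>2\<close> out of the arithmetic that produces the certificates.
\<close>
lemma integrality_certificate_two:
  assumes cert: "integrality_certificate 7 3 x"
  obtains T :: nat and X :: int where "of_nat T * x = of_int X" "\<not> 4 dvd T"
proof -
  have two: "1 < (2 :: nat)" by simp
  obtain T :: nat and X W E F :: int where T: "T > 0" "of_nat T * x = of_int X"
    and eq: "(int T)\<^sup>2 + int 7 * (X\<^sup>2 - int 3 * W\<^sup>2) = E\<^sup>2 - int 3 * F\<^sup>2"
    and prim: "\<not> (2 dvd T \<and> int 2 dvd X \<and> int 2 dvd W \<and> int 2 dvd E \<and> int 2 dvd F)"
    using integrality_certificate_primitive[OF cert two] by blast
  have sq: "\<exists>k. (even a \<and> a\<^sup>2 = 4 * k) \<or> (odd a \<and> a\<^sup>2 = 8 * k + 1)" for a :: int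
  proof (cases "even a")
    case True
    then obtain b where "a = 2 * b" by blast
    then show ?thesis by (intro exI[of _ "b\<^sup>2"]) (simp add: power_mult_distrib)
  next
    case False
    then obtain b where b: "a = 2 * b + 1" by (elim oddE)
    have "even (b * (b + 1))" by simp
    then obtain c where "b * (b + 1) = 2 * c" by blast
    then have "a\<^sup>2 = 8 * c + 1" unfolding b by (simp add: power2_eq_square algebra_simps)
    then show ?thesis using False by blast
  qed
  have "\<not> 4 dvd T"
  proof
    assume T4: "4 dvd T"
    then obtain S where S: "T = 4 * S" by blast
    have T2: "(int T)\<^sup>2 = 16 * (int S)\<^sup>2" by (simp add: S power_mult_distrib)
    have eq': "16 * (int S)\<^sup>2 + 7 * (X\<^sup>2 - 3 * W\<^sup>2) = E\<^sup>2 - 3 * F\<^sup>2" using eq unfolding T2 by simp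
    have "even T" using T4 by auto
    then have "odd X \<or> odd W \<or> odd E \<or> odd F" using prim by auto
    moreover have "\<exists>k. a\<^sup>2 = 4 * k \<or> a\<^sup>2 = 8 * k + 1" for a :: int using sq by blast
    then obtain k1 k2 k3 k4 where "X\<^sup>2 = 4 * k1 \<or> X\<^sup>2 = 8 * k1 + 1" "W\<^sup>2 = 4 * k2 \<or> W\<^sup>2 = 8 * k2 + 1"
      "E\<^sup>2 = 4 * k3 \<or> E\<^sup>2 = 8 * k3 + 1" "F\<^sup>2 = 4 * k4 \<or> F\<^sup>2 = 8 * k4 + 1" by meson
    from form_two_adic[OF this eq'] have "even X \<and> even W \<and> even E \<and> even F" by simp
    ultimately show False by blast
  qed
  then show ?thesis using that T by blast
qed

text \<open>
  The Legendre symbol is multiplicative, so a nonresidue has a prime factor that is a nonresidue.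
\<close>
lemma nonresidue_prime_factor:
  fixes p n :: nat
  assumes p: "prime p" "2 < p" and "odd n" "Legendre (int n) (int p) = -1"
  shows "\<exists>r. prime r \<and> 2 < r \<and> Legendre (int r) (int p) = -1"
  using assms(3,4)
proof (induction n rule: less_induct)
  case (less n)
  have "Legendre 1 (int p) = 1" using Legendre_prod[OF p, of "{}"] by simp
  then have "n \<noteq> 1" using less.prems(2) by (intro notI) simp
  then obtain q where q: "prime q" "q dvd n" using prime_factor_nat by blast
  then obtain k where k: "n = q * k" by (elim dvdE)
  have "odd q" "odd k" using less.prems(1) unfolding k by simp_all
  then have "q \<noteq> 2" by (intro notI) simp
  then have "2 < q" using prime_ge_2_nat[OF q(1)] by simp
  have "Legendre (int q) (int p) * Legendre (int k) (int p) = -1"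
    using less.prems(2) Legendre_mult[OF p, of "int q" "int k"] unfolding k by simp
  then consider "Legendre (int q) (int p) = -1" | "Legendre (int k) (int p) = -1"
    using Legendre_values[of "int q" "int p"] Legendre_values[of "int k" "int p"] by fastforce
  then show ?case
  proof cases
    case 1 then show ?thesis using q(1) \<open>2 < q\<close> by blast
  next
    case 2
    have "k > 0" using \<open>odd k\<close> by (intro Nat.gr0I notI) simp
    then have "k < n" using \<open>2 < q\<close> unfolding k by simp
    then show ?thesis using less.IH[OF _ \<open>odd k\<close> 2] by blast
  qed
qed

lemma exists_odd_prime_nonresidue:
  assumes p: "prime p" "2 < p"
  obtains r :: nat where "prime r" "2 < r" "Legendre (int r) (int p) = -1"
proof -
  \<comment> \<open>Squaring identifies \<open>1\<close> and \<open>p - 1\<close>, so it misses some residue.\<close>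
  have "\<not> inj_on (\<lambda>x. x\<^sup>2 mod p) {..<p}"
  proof
    assume inj: "inj_on (\<lambda>x. x\<^sup>2 mod p) {..<p}"
    have sq: "(p - 1)\<^sup>2 = p * (p - 2) + 1"
    proof -
      obtain j where "p = j + 2" using p(2) by (metis add.commute less_imp_add_positive)
      then show ?thesis by (simp add: power2_eq_square algebra_simps)
    qed
    have "(p - 1)\<^sup>2 mod p = 1\<^sup>2 mod p" unfolding sq mod_mult_self4 by simp
    then have "p - 1 = 1" using inj_onD[OF inj, of "p - 1" 1] p(2) by simp
    then show False using p(2) by simp
  qed
  then have "(\<lambda>x. x\<^sup>2 mod p) ` {..<p} \<noteq> {..<p}"
    using eq_card_imp_inj_on[of "{..<p}" "\<lambda>x. x\<^sup>2 mod p"] by auto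
  moreover have "(\<lambda>x. x\<^sup>2 mod p) ` {..<p} \<subseteq> {..<p}" using p(2) by auto
  ultimately obtain n where n: "n < p" "n \<notin> (\<lambda>x. x\<^sup>2 mod p) ` {..<p}" by blast
  have "0 \<in> (\<lambda>x. x\<^sup>2 mod p) ` {..<p}" using p(2) by (intro image_eqI[of _ _ 0]) auto
  then have "n \<noteq> 0" using n(2) by (intro notI) simp
  have nres: "Legendre (int n) (int p) = -1"
  proof -
    have "\<not> int p dvd int n" using n(1) \<open>n \<noteq> 0\<close> by (auto dest: dvd_imp_le)
    moreover have "\<not> QuadRes (int p) (int n)"
    proof
      assume "QuadRes (int p) (int n)"
      then obtain y where y: "[y\<^sup>2 = int n] (mod int p)" by (auto simp: QuadRes_def)
      define z where "z = nat (y mod int p)"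
      have z: "z < p" "int z = y mod int p" using p(2) by (auto simp: z_def nat_less_iff)
      have "[(int z)\<^sup>2 = int n] (mod int p)" unfolding z(2) using y by (simp add: cong_def power_mod)
      then have "[z\<^sup>2 = n] (mod p)" by (metis cong_int_iff of_nat_power)
      then have "z\<^sup>2 mod p = n" using n(1) by (simp add: cong_def)
      then show False using n(2) z(1) by blast
    qed
    ultimately show ?thesis by (simp add: Legendre_def cong_0_iff)
  qed
  show ?thesis
  proof (cases "odd n")
    case True
    then show ?thesis using nonresidue_prime_factor[OF p _ nres] that by blast
  next
    case False
    have "odd p" using p prime_odd_nat by auto
    then have "odd (n + p)" using False by simp
    moreover have "Legendre (int (n + p)) (int p) = -1"
      using nres Legendre_cong[of "int (n + p)" "int n" "int p"] by (simp add: cong_iff_dvd_diff)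
    ultimately show ?thesis using nonresidue_prime_factor[OF p] that by blast
  qed
qed

text \<open>
  The factor \<open>2 * r\<close> makes the certificate available for every integer. The cube absorbs the bounded
  defects: for \<open>q = 2\<close> the certificate only excludes \<open>4\<close> from the denominator of \<open>6 * x ^ 3\<close>, but an even
  denominator of \<open>x\<close> would contribute a factor \<open>8\<close>.
\<close>
theorem prime_integrality_certificate:
  assumes "prime q"
  obtains p r :: nat where
    "\<And>n::int. integrality_certificate p r (2 * of_nat r * (of_int n) ^ 3)"
    "\<And>x. integrality_certificate p r (2 * of_nat r * x ^ 3) \<Longrightarrow> \<exists>a b. x = of_int a / of_int b \<and> b > 0 \<and> \<not> int q dvd b"
proof -
  have lowest: "\<exists>a b. x = of_int a / of_int b \<and> b > 0 \<and> \<not> int q dvd b"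
    if T: "of_nat T * (2 * of_nat r * x ^ 3) = of_int X" and
      nd: "\<And>a b. coprime a b \<Longrightarrow> int q dvd b \<Longrightarrow> int T * (2 * int r * a ^ 3) \<noteq> X * b ^ 3" for x :: rat and r T :: nat and X
  proof -
    obtain a b where ab: "quotient_of x = (a, b)" by fastforce
    have x: "x = of_int a / of_int b" "b > 0" "coprime a b"
      using quotient_of_div[OF ab] quotient_of_denom_pos[OF ab] quotient_of_coprime[OF ab] by auto
    have "(of_int (int T * (2 * int r * a ^ 3)) :: rat) = of_int (X * b ^ 3)"
      using T x(2) by (simp add: x(1) field_simps)
    then have "int T * (2 * int r * a ^ 3) = X * b ^ 3" by (simp only: of_int_eq_iff)
    then show ?thesis using nd[OF x(3)] x by blast
  qed
  have ints: "integrality_certificate p r (2 * of_nat r * (of_int n) ^ 3)"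
    if "prime p" "2 < p" "prime r" "2 < r" "p \<noteq> r" for p r and n :: int
    using integer_represented[OF that, of "2 * int r * n ^ 3"] by (simp add: integrality_certificate_def)
  show ?thesis
  proof (cases "q = 2")
    case True
    show ?thesis
    proof (rule that[of 7 3])
      show "integrality_certificate 7 3 (2 * of_nat 3 * (of_int n) ^ 3)" for n :: int
        by (rule ints) auto
      fix x assume "integrality_certificate 7 3 (2 * of_nat 3 * x ^ 3)"
      then obtain T X where T: "of_nat T * (2 * of_nat 3 * x ^ 3) = of_int X" "\<not> 4 dvd T"
        using integrality_certificate_two by blast
      show "\<exists>a b. x = of_int a / of_int b \<and> b > 0 \<and> \<not> int q dvd b"
      proof (rule lowest[OF T(1)])
        fix a b :: int assume ab: "coprime a b" "int q dvd b"
        show "int T * (2 * int 3 * a ^ 3) \<noteq> X * b ^ 3"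
        proof
          assume eq: "int T * (2 * int 3 * a ^ 3) = X * b ^ 3"
          obtain c where c: "b = 2 * c" using ab(2) True by auto
          have "4 * (X * c ^ 3) = int T * (3 * a ^ 3)" using eq by (simp add: c power_mult_distrib)
          then have "4 dvd int T * (3 * a ^ 3)" by (metis dvd_triv_left)
          moreover have "odd a" using ab(1) c by (metis coprime_common_divisor dvd_triv_left odd_one)
          then have "coprime (2 ^ 2) (3 * a ^ 3)" by (simp only: coprime_power_left_iff) simp
          then have "coprime 4 (3 * a ^ 3)" by simp
          ultimately have "4 dvd int T" by (metis coprime_dvd_mult_left_iff)
          then show False using T(2) by presburger
        qed
      qed
    qed
  next
    case False
    then have q: "2 < q" using prime_ge_2_nat[OF assms] by simp
    obtain r where r: "prime r" "2 < r" "Legendre (int r) (int q) = -1"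
      using exists_odd_prime_nonresidue[OF assms q] by blast
    then have "q \<noteq> r" by (auto simp: Legendre_def cong_0_iff)
    show ?thesis
    proof (rule that[of q r])
      show "integrality_certificate q r (2 * of_nat r * (of_int n) ^ 3)" for n :: int
        by (rule ints[OF assms q r(1,2) \<open>q \<noteq> r\<close>])
      fix x assume "integrality_certificate q r (2 * of_nat r * x ^ 3)"
      then obtain T X where T: "of_nat T * (2 * of_nat r * x ^ 3) = of_int X" "\<not> q dvd T"
        using integrality_certificate_odd_prime[OF _ assms q r(3)] by blast
      show "\<exists>a b. x = of_int a / of_int b \<and> b > 0 \<and> \<not> int q dvd b"
      proof (rule lowest[OF T(1)])
        fix a b :: int assume ab: "coprime a b" "int q dvd b"
        show "int T * (2 * int r * a ^ 3) \<noteq> X * b ^ 3"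
        proof
          assume eq: "int T * (2 * int r * a ^ 3) = X * b ^ 3"
          have qi: "prime (int q)" using assms by simp
          have "int q dvd X * b ^ 3" using ab(2) by (simp add: power3_eq_cube)
          then have "int q dvd int T * (2 * int r * a ^ 3)" using eq by simp
          then consider "int q dvd int T" | "int q dvd 2" | "int q dvd int r" | "int q dvd a"
            by (auto simp: prime_dvd_mult_iff[OF qi] prime_dvd_power_iff[OF qi])
          then show False
          proof cases
            case 2 then show False using q by (auto dest: zdvd_imp_le)
          next
            case 3 then show False using \<open>q \<noteq> r\<close> r(1) assms primes_dvd_imp_eq by auto
          next
            case 4 then show False using ab qi by (metis coprime_common_divisor not_prime_unit)
          qed (use T(2) in simp)
        qed
      qed
    qed
  qed
qed

section \<open>Polynomial functions and Diophantine predicates\<close>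

text \<open>
  Terms of the language of rings denote the polynomial functions with integer coefficients. They are more
  convenient than \<open>zpoly\<close> for closure properties such as substitution; both describe the same
  functions.
\<close>
definition polyfun :: "((nat \<Rightarrow> rat) \<Rightarrow> rat) \<Rightarrow> bool" where
  "polyfun F \<longleftrightarrow> (\<exists>t. \<forall>e. tval e t = F e)"

lemma polyfun_const_int: "polyfun (\<lambda>e. of_int c)"
proof -
  have nat: "\<exists>t. \<forall>e. tval e t = of_nat n" for n
  proof (induction n)
    case 0
    show ?case by (intro exI[of _ Zero]) simp
  next
    case (Suc n)
    then obtain t where "\<forall>e. tval e t = of_nat n" by blast
    then show ?case by (intro exI[of _ "Add One t"]) simp
  qed
  show ?thesis
  proof (cases "c \<ge> 0")
    case True
    then show ?thesis unfolding polyfun_def using nat[of "nat c"] by (simp add: of_nat_nat)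
  next
    case False
    obtain t where "\<forall>e. tval e t = of_nat (nat (- c))" using nat by blast
    then show ?thesis unfolding polyfun_def using False
      by (intro exI[of _ "Minus t"]) (simp add: of_nat_nat)
  qed
qed

lemma polyfun_var: "polyfun (\<lambda>e. e i)"
  unfolding polyfun_def by (intro exI[of _ "Var i"]) simp

lemma polyfun_uminus: "polyfun F \<Longrightarrow> polyfun (\<lambda>e. - F e)"
  unfolding polyfun_def by (metis tval.simps(4))

lemma polyfun_add: "polyfun F \<Longrightarrow> polyfun G \<Longrightarrow> polyfun (\<lambda>e. F e + G e)"
  unfolding polyfun_def by (metis tval.simps(5))

lemma polyfun_mult: "polyfun F \<Longrightarrow> polyfun G \<Longrightarrow> polyfun (\<lambda>e. F e * G e)"
  unfolding polyfun_def by (metis tval.simps(6))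

lemma polyfun_diff: "polyfun F \<Longrightarrow> polyfun G \<Longrightarrow> polyfun (\<lambda>e. F e - G e)"
  using polyfun_add[OF _ polyfun_uminus] by simp

lemma polyfun_const_nat: "polyfun (\<lambda>e. of_nat n)"
  using polyfun_const_int[of "int n"] by simp

lemma polyfun_0: "polyfun (\<lambda>e. 0)" and polyfun_1: "polyfun (\<lambda>e. 1)"
  and polyfun_numeral: "polyfun (\<lambda>e. numeral n)"
  using polyfun_const_int[of 0] polyfun_const_int[of 1] polyfun_const_int[of "numeral n"] by simp_all

lemma polyfun_power: "polyfun F \<Longrightarrow> polyfun (\<lambda>e. F e ^ n)"
  by (induction n) (auto intro: polyfun_1 polyfun_mult)

lemma polyfun_sum: "(\<And>i. i \<in> A \<Longrightarrow> polyfun (F i)) \<Longrightarrow> polyfun (\<lambda>e. \<Sum>i\<in>A. F i e)"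
  by (induction A rule: infinite_finite_induct) (auto intro: polyfun_0 polyfun_add)

lemma polyfun_prod: "(\<And>i. i \<in> A \<Longrightarrow> polyfun (F i)) \<Longrightarrow> polyfun (\<lambda>e. \<Prod>i\<in>A. F i e)"
  by (induction A rule: infinite_finite_induct) (auto intro: polyfun_1 polyfun_mult)

lemmas polyfun_intros = polyfun_const_int polyfun_const_nat polyfun_0 polyfun_1 polyfun_numeral polyfun_var
  polyfun_uminus polyfun_add polyfun_diff polyfun_mult polyfun_power

lemma polyfun_induct [consumes 1, case_names var zero one uminus add mult]:
  assumes "polyfun F" and "\<And>i. P (\<lambda>e. e i)" "P (\<lambda>e. 0)" "P (\<lambda>e. 1)"
    and "\<And>F. P F \<Longrightarrow> P (\<lambda>e. - F e)"
    and "\<And>F G. P F \<Longrightarrow> P G \<Longrightarrow> P (\<lambda>e. F e + G e)" "\<And>F G. P F \<Longrightarrow> P G \<Longrightarrow> P (\<lambda>e. F e * G e)"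
  shows "P F"
proof -
  have "P (\<lambda>e. tval e t)" for t
    by (induction t) (simp_all add: assms(2-))
  moreover obtain t where "F = (\<lambda>e. tval e t)" using assms(1) unfolding polyfun_def by (metis ext)
  ultimately show ?thesis by simp
qed

lemma polyfun_compose:
  assumes "polyfun F" "\<And>i. polyfun (G i)"
  shows "polyfun (\<lambda>e. F (\<lambda>i. G i e))"
  using assms(1) by (induction rule: polyfun_induct) (auto intro: assms(2) polyfun_intros)

lemma polyfun_finite_dependence:
  assumes "polyfun F"
  obtains n where "\<And>e e'. (\<And>i. i < n \<Longrightarrow> e i = e' i) \<Longrightarrow> F e = F e'"
proof -
  have "\<exists>n. \<forall>e e'. (\<forall>i<n. e i = e' i) \<longrightarrow> F e = F e'"
    using assms
  proof (induction rule: polyfun_induct)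
    case (var i)
    show ?case by (intro exI[of _ "Suc i"]) auto
  next
    case (uminus F)
    then show ?case by metis
  next
    case (add F G)
    then obtain n m where "\<forall>e e'. (\<forall>i<n. e i = e' i) \<longrightarrow> F e = F e'" "\<forall>e e'. (\<forall>i<m. e i = e' i) \<longrightarrow> G e = G e'" by blast
    then show ?case by (intro exI[of _ "max n m"]) (metis less_max_iff_disj)
  next
    case (mult F G)
    then obtain n m where "\<forall>e e'. (\<forall>i<n. e i = e' i) \<longrightarrow> F e = F e'" "\<forall>e e'. (\<forall>i<m. e i = e' i) \<longrightarrow> G e = G e'" by blast
    then show ?case by (intro exI[of _ "max n m"]) (metis less_max_iff_disj)
  qed auto
  then show ?thesis using that by blast
qed

lemma polyfun_eval_poly: "polyfun (eval_poly f)"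
  unfolding eval_poly_def[abs_def]
  by (intro polyfun_sum polyfun_mult polyfun_prod polyfun_power polyfun_intros)

definition eval_mono :: "(nat \<Rightarrow>\<^sub>0 nat) \<Rightarrow> (nat \<Rightarrow> rat) \<Rightarrow> rat" where
  "eval_mono m x = (\<Prod>i\<in>Poly_Mapping.keys m. x i ^ Poly_Mapping.lookup m i)"

lemma eval_mono_superset:
  "finite A \<Longrightarrow> Poly_Mapping.keys m \<subseteq> A \<Longrightarrow> eval_mono m x = (\<Prod>i\<in>A. x i ^ Poly_Mapping.lookup m i)"
  unfolding eval_mono_def by (intro prod.mono_neutral_left) (auto simp: in_keys_iff)

lemma eval_mono_add: "eval_mono (m + n) x = eval_mono m x * eval_mono n x"
proof -
  let ?A = "Poly_Mapping.keys m \<union> Poly_Mapping.keys n"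
  show ?thesis
    using eval_mono_superset[of ?A m] eval_mono_superset[of ?A n] eval_mono_superset[of ?A "m + n"]
      Poly_Mapping.keys_add[of m n]
    by (simp add: lookup_add power_add prod.distrib)
qed

lemma eval_poly_superset:
  "finite A \<Longrightarrow> Poly_Mapping.keys f \<subseteq> A \<Longrightarrow> eval_poly f x = (\<Sum>m\<in>A. of_int (Poly_Mapping.lookup f m) * eval_mono m x)"
  unfolding eval_poly_def eval_mono_def[symmetric] by (intro sum.mono_neutral_left) (auto simp: in_keys_iff)

lemma eval_poly_add: "eval_poly (f + g) x = eval_poly f x + eval_poly g x"
proof -
  let ?A = "Poly_Mapping.keys f \<union> Poly_Mapping.keys g"
  show ?thesis
    using eval_poly_superset[of ?A f] eval_poly_superset[of ?A g] eval_poly_superset[of ?A "f + g"]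
      Poly_Mapping.keys_add[of f g]
    by (simp add: lookup_add distrib_right sum.distrib)
qed

lemma eval_poly_0: "eval_poly 0 x = 0"
  by (simp add: eval_poly_def)

lemma eval_poly_uminus: "eval_poly (- f) x = - eval_poly f x"
  using eval_poly_add[of f "- f" x] by (simp add: eval_poly_0)

lemma eval_poly_single: "eval_poly (Poly_Mapping.single m c) x = of_int c * eval_mono m x"
  by (subst eval_poly_superset[of "{m}"]) auto

lemma eval_poly_sum: "eval_poly (\<Sum>i\<in>A. f i) x = (\<Sum>i\<in>A. eval_poly (f i) x)"
  by (induction A rule: infinite_finite_induct) (auto simp: eval_poly_0 eval_poly_add)

text \<open>
  Only the product needs a computation, since a product of monomials is a monomial.
\<close>
lemma polyfun_is_eval_poly:
  assumes "polyfun F" obtains f where "eval_poly f = F"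
proof -
  have "\<exists>f. \<forall>x. eval_poly f x = F x"
    using assms
  proof (induction rule: polyfun_induct)
    case (var i)
    have "eval_mono (Poly_Mapping.single i 1) x = x i" for x
      by (subst eval_mono_superset[of "{i}"]) auto
    then show ?case by (intro exI[of _ "Poly_Mapping.single (Poly_Mapping.single i 1) 1"]) (simp add: eval_poly_single)
  next
    case zero
    show ?case by (intro exI[of _ 0]) (simp add: eval_poly_0)
  next
    case one
    show ?case by (intro exI[of _ "Poly_Mapping.single 0 1"]) (simp add: eval_poly_single eval_mono_def del: single_one)
  next
    case (uminus F)
    then show ?case by (metis eval_poly_uminus)
  next
    case (add F G)
    then show ?case by (metis eval_poly_add)
  next
    case (mult F G)
    then obtain f g where fg: "\<And>x. eval_poly f x = F x" "\<And>x. eval_poly g x = G x" by blast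
    define h where "h = (\<Sum>m\<in>Poly_Mapping.keys f. \<Sum>n\<in>Poly_Mapping.keys g.
      Poly_Mapping.single (m + n) (Poly_Mapping.lookup f m * Poly_Mapping.lookup g n))"
    have "eval_poly h x = F x * G x" for x
    proof -
      have "eval_poly h x = eval_poly f x * eval_poly g x"
        unfolding h_def eval_poly_sum eval_poly_single eval_mono_add
        unfolding eval_poly_def eval_mono_def[symmetric] sum_product
        by (intro sum.cong refl) (simp add: algebra_simps)
      then show ?thesis by (simp add: fg)
    qed
    then show ?case by blast
  qed
  then show ?thesis using that by blast
qed

definition interleave :: "(nat \<Rightarrow> 'a) \<Rightarrow> (nat \<Rightarrow> 'a) \<Rightarrow> nat \<Rightarrow> 'a" where
  "interleave e y i = (if even i then e (i div 2) else y (i div 2))"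

lemma interleave_simps [simp]: "interleave e y (2 * i) = e i" "interleave e y (Suc (2 * i)) = y i"
  by (simp_all add: interleave_def)

text \<open>
  The even variables of \<open>F\<close> hold the parameters and the odd ones the existentially quantified unknowns.
\<close>
definition diophantine :: "((nat \<Rightarrow> rat) \<Rightarrow> bool) \<Rightarrow> bool" where
  "diophantine P \<longleftrightarrow> (\<exists>F. polyfun F \<and> (\<forall>e. P e \<longleftrightarrow> (\<exists>y. F (interleave e y) = 0)))"

lemma diophantineI:
  assumes "polyfun F" "\<And>e. P e \<longleftrightarrow> (\<exists>y. F (interleave e y) = 0)"
  shows "diophantine P"
  using assms unfolding diophantine_def by blast

lemma diophantine_eq_0:
  assumes "polyfun F" shows "diophantine (\<lambda>e. F e = 0)"
proof (rule diophantineI)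
  show "polyfun (\<lambda>z. F (\<lambda>i. z (2 * i)))" by (rule polyfun_compose[OF assms polyfun_var])
qed simp

text \<open>
  A rational number is nonzero if and only if it has an inverse.
\<close>
lemma diophantine_neq_0:
  assumes "polyfun F" shows "diophantine (\<lambda>e. F e \<noteq> 0)"
proof (rule diophantineI)
  show "polyfun (\<lambda>z. F (\<lambda>i. z (2 * i)) * z (Suc (2 * 0)) - 1)"
    by (intro polyfun_diff polyfun_mult polyfun_compose[OF assms polyfun_var] polyfun_var polyfun_1)
  show "F e \<noteq> 0 \<longleftrightarrow> (\<exists>y. F (\<lambda>i. interleave e y (2 * i)) * interleave e y (Suc (2 * 0)) - 1 = 0)" for e
    unfolding interleave_simps
    by (auto intro: exI[of _ "\<lambda>_. inverse (F e)"])
qed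

lemma diophantine_disj:
  assumes "diophantine P" "diophantine Q" shows "diophantine (\<lambda>e. P e \<or> Q e)"
proof -
  obtain F G where F: "polyfun F" "\<And>e. P e \<longleftrightarrow> (\<exists>y. F (interleave e y) = 0)"
    and G: "polyfun G" "\<And>e. Q e \<longleftrightarrow> (\<exists>y. G (interleave e y) = 0)"
    using assms unfolding diophantine_def by blast
  show ?thesis
    by (rule diophantineI[OF polyfun_mult[OF F(1) G(1)]]) (auto simp: F(2) G(2))
qed

text \<open>
  The two systems of unknowns are kept apart by giving them the even and the odd positions among the
  unknowns; the two equations become one as a sum of squares.
\<close>
lemma diophantine_conj:
  assumes "diophantine P" "diophantine Q" shows "diophantine (\<lambda>e. P e \<and> Q e)"
proof -
  obtain F G where F: "polyfun F" "\<And>e. P e \<longleftrightarrow> (\<exists>y. F (interleave e y) = 0)"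
    and G: "polyfun G" "\<And>e. Q e \<longleftrightarrow> (\<exists>y. G (interleave e y) = 0)"
    using assms unfolding diophantine_def by blast
  define r where "r b z = interleave (\<lambda>i. z (2 * i)) (\<lambda>i. z (Suc (2 * (2 * i + b))))" for b :: nat and z :: "nat \<Rightarrow> rat"
  have r: "r b (interleave e y) = interleave e (\<lambda>i. y (2 * i + b))" for b e y
    unfolding r_def interleave_simps ..
  have pr: "polyfun (\<lambda>z. r b z i)" for b i
    unfolding r_def interleave_def by (cases "even i") (auto intro: polyfun_var)
  show ?thesis
  proof (rule diophantineI)
    show "polyfun (\<lambda>z. (F (r 0 z))\<^sup>2 + (G (r 1 z))\<^sup>2)"
      using polyfun_compose[OF F(1) pr[of 0]] polyfun_compose[OF G(1) pr[of 1]] by (intro polyfun_intros) auto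
    fix e
    show "P e \<and> Q e \<longleftrightarrow> (\<exists>y. (F (r 0 (interleave e y)))\<^sup>2 + (G (r 1 (interleave e y)))\<^sup>2 = 0)"
      unfolding r sum_power2_eq_zero_iff F(2) G(2)
    proof safe
      fix y y' assume yy: "F (interleave e y) = 0" "G (interleave e y') = 0"
      have "(\<lambda>i. interleave y y' (2 * i + 0)) = y" "(\<lambda>i. interleave y y' (2 * i + 1)) = y'" by auto
      with yy show "\<exists>y. F (interleave e (\<lambda>i. y (2 * i + 0))) = 0 \<and> G (interleave e (\<lambda>i. y (2 * i + 1))) = 0"
        by (intro exI[of _ "interleave y y'"]) simp
    qed auto
  qed
qed

lemma diophantine_True: "diophantine (\<lambda>e. True)"
  using diophantine_eq_0[OF polyfun_0] by simp

lemma diophantine_ball: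
  assumes "finite A" "\<And>i. i \<in> A \<Longrightarrow> diophantine (P i)"
  shows "diophantine (\<lambda>e. \<forall>i\<in>A. P i e)"
  using assms by (induction A rule: finite_induct) (auto intro: diophantine_True diophantine_conj)

lemma diophantine_subst:
  assumes "diophantine P" "\<And>i. polyfun (G i)" shows "diophantine (\<lambda>e. P (\<lambda>i. G i e))"
proof -
  obtain F where F: "polyfun F" "\<And>e. P e \<longleftrightarrow> (\<exists>y. F (interleave e y) = 0)"
    using assms unfolding diophantine_def by blast
  define r where "r z = interleave (\<lambda>i. G i (\<lambda>j. z (2 * j))) (\<lambda>i. z (Suc (2 * i)))" for z :: "nat \<Rightarrow> rat"
  have pr: "polyfun (\<lambda>z. r z i)" for i
    unfolding r_def interleave_def
    by (cases "even i") (auto intro: polyfun_var polyfun_compose[OF assms(2)])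
  show ?thesis
    by (rule diophantineI[OF polyfun_compose[OF F(1) pr]]) (simp add: r_def F(2))
qed

lemma diophantine_ex:
  assumes "diophantine P" shows "diophantine (\<lambda>e. \<exists>y. P (\<lambda>i. if i \<in> I then y i else e i))"
proof -
  obtain F where F: "polyfun F" "\<And>e. P e \<longleftrightarrow> (\<exists>y. F (interleave e y) = 0)"
    using assms unfolding diophantine_def by blast
  define r where "r z = interleave (\<lambda>i. if i \<in> I then z (Suc (2 * (2 * i))) else z (2 * i)) (\<lambda>i. z (Suc (2 * (Suc (2 * i)))))"
    for z :: "nat \<Rightarrow> rat"
  have pr: "polyfun (\<lambda>z. r z i)" for i
    unfolding r_def interleave_def
    by (cases "even i"; cases "i div 2 \<in> I") (auto intro: polyfun_var)
  show ?thesis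
  proof (rule diophantineI[OF polyfun_compose[OF F(1) pr]])
    fix e
    show "(\<exists>y. P (\<lambda>i. if i \<in> I then y i else e i)) \<longleftrightarrow> (\<exists>y. F (r (interleave e y)) = 0)"
      unfolding r_def interleave_simps F(2)
    proof safe
      fix y y' assume "F (interleave (\<lambda>i. if i \<in> I then y i else e i) y') = 0"
      then show "\<exists>y. F (interleave (\<lambda>i. if i \<in> I then y (2 * i) else e i) (\<lambda>i. y (Suc (2 * i)))) = 0"
        by (intro exI[of _ "interleave y y'"]) (unfold interleave_simps)
    next
      fix y assume "F (interleave (\<lambda>i. if i \<in> I then y (2 * i) else e i) (\<lambda>i. y (Suc (2 * i)))) = 0"
      then show "\<exists>y y'. F (interleave (\<lambda>i. if i \<in> I then y i else e i) y') = 0"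
        by (intro exI[of _ "\<lambda>i. y (2 * i)"] exI[of _ "\<lambda>i. y (Suc (2 * i))"])
    qed
  qed
qed

lemma diophantine_Ex:
  assumes "diophantine P" shows "diophantine (\<lambda>e. \<exists>a. P (e(i := a)))"
proof -
  have "(\<exists>y. P (\<lambda>j. if j \<in> {i} then y j else e j)) \<longleftrightarrow> (\<exists>a. P (e(i := a)))" for e
  proof safe
    fix y assume "P (\<lambda>j. if j \<in> {i} then y j else e j)"
    moreover have "(\<lambda>j. if j \<in> {i} then y j else e j) = e(i := y i)" by auto
    ultimately show "\<exists>a. P (e(i := a))" by auto
  next
    fix a assume "P (e(i := a))"
    moreover have "(\<lambda>j. if j \<in> {i} then a else e j) = e(i := a)" by auto
    ultimately show "\<exists>y. P (\<lambda>j. if j \<in> {i} then y j else e j)" by (intro exI[of _ "\<lambda>_. a"]) simp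
  qed
  then show ?thesis using diophantine_ex[OF assms, of "{i}"] by simp
qed

text \<open>
  All parameters are identified with the variable of index \<open>0\<close>.
\<close>
lemma diophantine_to_poly:
  assumes "diophantine P"
  obtains g where "\<And>q. P (\<lambda>_. q) \<longleftrightarrow> (\<exists>y. eval_poly g (case_nat q y) = 0)"
proof -
  obtain F where F: "polyfun F" "\<And>e. P e \<longleftrightarrow> (\<exists>y. F (interleave e y) = 0)"
    using assms unfolding diophantine_def by blast
  define r where "r z = interleave (\<lambda>i. z 0) (\<lambda>i. z (Suc i))" for z :: "nat \<Rightarrow> rat"
  have pr: "polyfun (\<lambda>z. r z i)" for i
    unfolding r_def interleave_def by (cases "even i") (auto intro: polyfun_var)
  obtain g where "eval_poly g = (\<lambda>z. F (r z))"
    by (rule polyfun_is_eval_poly[OF polyfun_compose[OF F(1) pr]])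
  then have "P (\<lambda>_. q) \<longleftrightarrow> (\<exists>y. eval_poly g (case_nat q y) = 0)" for q
    unfolding F(2) by (simp add: r_def)
  then show ?thesis using that by blast
qed

lemma diophantine_existential:
  assumes "existential \<phi>" shows "diophantine (\<lambda>e. sat UNIV e \<phi>)"
proof -
  have pt: "polyfun (\<lambda>e. tval e t)" for t unfolding polyfun_def by blast
  have qf: "diophantine (\<lambda>e. sat UNIV e \<phi>) \<and> diophantine (\<lambda>e. \<not> sat UNIV e \<phi>)" if "qfree \<phi>" for \<phi>
    using that
  proof (induction \<phi>)
    case (Eq s t)
    have "polyfun (\<lambda>e. tval e s - tval e t)" by (intro polyfun_diff pt)
    from diophantine_eq_0[OF this] diophantine_neq_0[OF this] show ?case by simp
  next
    case (Neg \<phi>)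
    then show ?case by simp
  next
    case (Conj \<phi> \<psi>)
    then have *: "diophantine (\<lambda>e. sat UNIV e \<phi>)" "diophantine (\<lambda>e. \<not> sat UNIV e \<phi>)"
      "diophantine (\<lambda>e. sat UNIV e \<psi>)" "diophantine (\<lambda>e. \<not> sat UNIV e \<psi>)" by auto
    show ?case
      using diophantine_conj[OF *(1,3)] diophantine_disj[OF *(2,4)] by (simp only: sat.simps de_Morgan_conj simp_thms)
  next
    case (Disj \<phi> \<psi>)
    then show ?case by (simp add: diophantine_conj diophantine_disj)
  qed auto
  show ?thesis
    using assms
  proof (induction rule: existential.induct)
    case (2 \<phi> i)
    show ?case using diophantine_Ex[OF 2(2), of i] by (simp only: sat.simps Bex_def UNIV_I simp_thms)
  qed (use qf in blast)
qed

text \<open>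
  The variable of index \<open>0\<close> of \<open>H\<close> is the common denominator.
\<close>
lemma polyfun_homogenize:
  assumes "polyfun F"
  obtains N H where "polyfun H" "\<And>b x. b \<noteq> 0 \<Longrightarrow> H (case_nat b x) = b ^ N * F (\<lambda>i. x i / b)"
proof -
  have "\<exists>N H. polyfun H \<and> (\<forall>b x. b \<noteq> 0 \<longrightarrow> H (case_nat b x) = b ^ N * F (\<lambda>i. x i / b))"
    using assms
  proof (induction rule: polyfun_induct)
    case (var i)
    show ?case by (intro exI[of _ 1] exI[of _ "\<lambda>z. z (Suc i)"]) (simp add: polyfun_var)
  next
    case zero
    show ?case by (intro exI[of _ 0] exI[of _ "\<lambda>z. 0"]) (simp add: polyfun_0)
  next
    case one
    show ?case by (intro exI[of _ 0] exI[of _ "\<lambda>z. 1"]) (simp add: polyfun_1)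
  next
    case (uminus F)
    then obtain N H where "polyfun H" "\<forall>b x. b \<noteq> 0 \<longrightarrow> H (case_nat b x) = b ^ N * F (\<lambda>i. x i / b)" by blast
    then show ?case by (intro exI[of _ N] exI[of _ "\<lambda>z. - H z"]) (simp add: polyfun_uminus)
  next
    case (add F G)
    then obtain N H M K where H: "polyfun H" "\<And>b x. b \<noteq> 0 \<Longrightarrow> H (case_nat b x) = b ^ N * F (\<lambda>i. x i / b)"
      and K: "polyfun K" "\<And>b x. b \<noteq> 0 \<Longrightarrow> K (case_nat b x) = b ^ M * G (\<lambda>i. x i / b)" by metis
    show ?case
    proof (intro exI[of _ "N + M"] exI[of _ "\<lambda>z. z 0 ^ M * H z + z 0 ^ N * K z"] conjI allI impI)
      show "polyfun (\<lambda>z. z 0 ^ M * H z + z 0 ^ N * K z)" by (intro polyfun_intros H K)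
    qed (simp add: H K power_add algebra_simps)
  next
    case (mult F G)
    then obtain N H M K where H: "polyfun H" "\<And>b x. b \<noteq> 0 \<Longrightarrow> H (case_nat b x) = b ^ N * F (\<lambda>i. x i / b)"
      and K: "polyfun K" "\<And>b x. b \<noteq> 0 \<Longrightarrow> K (case_nat b x) = b ^ M * G (\<lambda>i. x i / b)" by metis
    show ?case
    proof (intro exI[of _ "N + M"] exI[of _ "\<lambda>z. H z * K z"] conjI allI impI)
      show "polyfun (\<lambda>z. H z * K z)" by (intro polyfun_intros H K)
    qed (simp add: H K power_add algebra_simps)
  qed
  then show ?thesis using that by blast
qed

text \<open>
  Solving \<open>F = 0\<close> in fractions with a common denominator: \<open>z 0\<close> is the parameter, \<open>z 1\<close> the
  denominator, and the remaining variables are the numerators.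
\<close>
lemma fraction_zero:
  assumes "polyfun F"
  obtains H :: "(nat \<Rightarrow> rat) \<Rightarrow> rat" where "polyfun H"
    "\<And>z. z 1 \<noteq> 0 \<Longrightarrow> H z = 0 \<longleftrightarrow> F (case_nat (z 0) (\<lambda>i. z (i + 2) / z 1)) = 0"
proof -
  obtain H N where H: "polyfun H" "\<And>b x. b \<noteq> 0 \<Longrightarrow> H (case_nat b x) = b ^ N * F (\<lambda>i. x i / b)"
    by (rule polyfun_homogenize[OF assms]) blast
  define r where "r z = case_nat (z 1) (case_nat (z 0 * z 1) (\<lambda>i. z (i + 2)))" for z :: "nat \<Rightarrow> rat"
  have "polyfun (\<lambda>z. r z i)" for i
  proof (cases i)
    case (Suc j)
    then show ?thesis unfolding r_def by (cases j) (simp_all add: polyfun_mult polyfun_var)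
  qed (simp add: r_def polyfun_var)
  then have "polyfun (\<lambda>z. H (\<lambda>i. r z i))" by (rule polyfun_compose[OF H(1)])
  moreover have "H (\<lambda>i. r z i) = 0 \<longleftrightarrow> F (case_nat (z 0) (\<lambda>i. z (i + 2) / z 1)) = 0" if "z 1 \<noteq> 0" for z
  proof -
    have "H (r z) = z 1 ^ N * F (\<lambda>i. case_nat (z 0 * z 1) (\<lambda>i. z (i + 2)) i / z 1)"
      unfolding r_def by (rule H(2)[OF that])
    moreover have "(\<lambda>i. case_nat (z 0 * z 1) (\<lambda>i. z (i + 2)) i / z 1) = case_nat (z 0) (\<lambda>i. z (i + 2) / z 1)"
      using that by (auto split: nat.split)
    ultimately have "H (r z) = z 1 ^ N * F (case_nat (z 0) (\<lambda>i. z (i + 2) / z 1))" by (simp only:)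
    then show ?thesis using that by simp
  qed
  ultimately show ?thesis using that by blast
qed

section \<open>The subrings of the rationals\<close>

definition denom :: "rat \<Rightarrow> int" where "denom x = snd (quotient_of x)"

lemma denom_pos: "denom x > 0"
  unfolding denom_def using quotient_of_denom_pos[of x] by (metis prod.collapse)

lemma denom_numerator: obtains a where "x = of_int a / of_int (denom x)" "coprime a (denom x)"
proof -
  have "quotient_of x = (fst (quotient_of x), denom x)" by (simp add: denom_def)
  from quotient_of_div[OF this] quotient_of_coprime[OF this] show ?thesis using that by blast
qed

lemma denom_dvd:
  assumes "x = of_int a / of_int b" "b \<noteq> 0" shows "denom x dvd b"
proof -
  obtain c where c: "x = of_int c / of_int (denom x)" "coprime c (denom x)" by (rule denom_numerator)
  define d where "d = denom x"
  have "of_int a / of_int b = (of_int c / of_int d :: rat)" using c(1) assms(1) by (simp add: d_def)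
  then have "(of_int (a * denom x) :: rat) = of_int (c * b)"
    using denom_pos[of x] assms(2) unfolding d_def[symmetric] by (simp add: frac_eq_eq)
  then have "a * denom x = c * b" by (simp only: of_int_eq_iff)
  then have "denom x dvd c * b" by (metis dvd_triv_right)
  then show ?thesis using c(2) by (metis coprime_commute coprime_dvd_mult_right_iff)
qed

lemma is_subringD:
  assumes "is_subring R"
  shows "1 \<in> R" "0 \<in> R" "x \<in> R \<Longrightarrow> y \<in> R \<Longrightarrow> x - y \<in> R" "x \<in> R \<Longrightarrow> y \<in> R \<Longrightarrow> x * y \<in> R"
    "x \<in> R \<Longrightarrow> - x \<in> R" "x \<in> R \<Longrightarrow> y \<in> R \<Longrightarrow> x + y \<in> R" "of_int k \<in> R" "of_nat n \<in> R" "x \<in> R \<Longrightarrow> x ^ n \<in> R"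
proof -
  show one: "1 \<in> R" and diff: "\<And>x y. x \<in> R \<Longrightarrow> y \<in> R \<Longrightarrow> x - y \<in> R"
    and mult: "\<And>x y. x \<in> R \<Longrightarrow> y \<in> R \<Longrightarrow> x * y \<in> R"
    using assms by (auto simp: is_subring_def)
  show zero: "0 \<in> R" using diff[OF one one] by simp
  show neg: "\<And>x. x \<in> R \<Longrightarrow> - x \<in> R" using diff[OF zero] by simp
  show add: "\<And>x y. x \<in> R \<Longrightarrow> y \<in> R \<Longrightarrow> x + y \<in> R" using diff[OF _ neg] by simp
  show nat: "of_nat n \<in> R" for n by (induction n) (auto intro: zero one add)
  show "of_int k \<in> R" using nat[of "nat k"] neg[OF nat[of "nat (- k)"]] by (cases "k \<ge> 0") auto
  show "x ^ n \<in> R" if "x \<in> R" by (induction n) (use that in \<open>auto intro: one mult\<close>)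
qed

text \<open>
  By the lemma \<open>mem_R_of_iff\<close> below, the primes that have to be inverted in order to obtain \<open>x\<close>.
\<close>
definition denom_primes :: "rat \<Rightarrow> nat set" where
  "denom_primes x = {p. prime p \<and> int p dvd denom x}"

lemma denom_primes_fraction:
  assumes "x = of_int a / of_nat b" "b > 0" "\<And>p. prime p \<Longrightarrow> p dvd b \<Longrightarrow> p \<in> W"
  shows "denom_primes x \<subseteq> W"
proof -
  have "denom x dvd int b" by (rule denom_dvd[of x a]) (use assms in auto)
  then show ?thesis using assms(3) unfolding denom_primes_def by (auto dest: dvd_trans)
qed

lemma denom_primes_finite: "finite (denom_primes x)"
proof (rule finite_subset)
  show "denom_primes x \<subseteq> {..nat (denom x)}"
    using denom_pos[of x] by (auto simp: denom_primes_def dest!: zdvd_imp_le)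
qed simp

lemma denom_primes_fractionE:
  obtains a b where "x = of_int a / of_nat b" "b > 0" "\<And>p. prime p \<Longrightarrow> p dvd b \<longleftrightarrow> p \<in> denom_primes x"
proof -
  obtain a where a: "x = of_int a / of_int (denom x)" by (rule denom_numerator)
  have "x = of_int a / of_nat (nat (denom x))" using a denom_pos[of x] by (simp add: of_nat_nat)
  moreover have "p dvd nat (denom x) \<longleftrightarrow> p \<in> denom_primes x" if "prime p" for p
  proof -
    have "p dvd nat (denom x) \<longleftrightarrow> int p dvd int (nat (denom x))" by (simp only: of_nat_dvd_iff)
    then show ?thesis using that denom_pos[of x] by (simp add: denom_primes_def)
  qed
  ultimately show ?thesis using that[of a "nat (denom x)"] denom_pos[of x] by simp
qed

lemma mem_R_of_iff: "x \<in> R_of W \<longleftrightarrow> denom_primes x \<subseteq> W" if W: "W \<subseteq> \<P>"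
proof
  let ?S = "{x. denom_primes x \<subseteq> W}"
  have "is_subring ?S"
    unfolding is_subring_def
  proof (intro conjI ballI)
    have "denom_primes 1 \<subseteq> W" by (rule denom_primes_fraction[of _ 1 1]) auto
    then show "1 \<in> ?S" by simp
    fix x y assume xy: "x \<in> ?S" "y \<in> ?S"
    obtain a b where ab: "x = of_int a / of_nat b" "b > 0" "\<And>p. prime p \<Longrightarrow> p dvd b \<longleftrightarrow> p \<in> denom_primes x"
      by (rule denom_primes_fractionE[of x]) blast
    obtain c d where cd: "y = of_int c / of_nat d" "d > 0" "\<And>p. prime p \<Longrightarrow> p dvd d \<longleftrightarrow> p \<in> denom_primes y"
      by (rule denom_primes_fractionE[of y]) blast
    have W: "\<And>p. prime p \<Longrightarrow> p dvd b * d \<Longrightarrow> p \<in> W" using ab(3) cd(3) xy by (auto simp: prime_dvd_mult_iff)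
    have "denom_primes (x - y) \<subseteq> W"
    proof (rule denom_primes_fraction[OF _ _ W])
      show "x - y = of_int (a * int d - c * int b) / of_nat (b * d)"
        unfolding ab(1) cd(1) using ab(2) cd(2) by (simp add: field_simps)
    qed (use ab(2) cd(2) in auto)
    then show "x - y \<in> ?S" by simp
    have "denom_primes (x * y) \<subseteq> W"
    proof (rule denom_primes_fraction[OF _ _ W])
      show "x * y = of_int (a * c) / of_nat (b * d)" unfolding ab(1) cd(1) by simp
    qed (use ab(2) cd(2) in auto)
    then show "x * y \<in> ?S" by simp
  qed
  moreover have "(\<lambda>p. 1 / of_nat p) ` W \<subseteq> ?S"
  proof clarsimp
    fix p q assume "p \<in> W" "q \<in> denom_primes (1 / rat_of_nat p)"
    moreover have "prime p" using \<open>p \<in> W\<close> W by auto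
    moreover have "denom_primes (1 / rat_of_nat p) \<subseteq> W"
      by (rule denom_primes_fraction[of _ 1 p])
        (use \<open>p \<in> W\<close> \<open>prime p\<close> in \<open>auto simp: prime_gt_0_nat dest: primes_dvd_imp_eq\<close>)
    ultimately show "q \<in> W" by blast
  qed
  ultimately have "R_of W \<subseteq> ?S" unfolding R_of_def by (intro hull_minimal)
  then show "x \<in> R_of W \<Longrightarrow> denom_primes x \<subseteq> W" by blast
next
  assume x: "denom_primes x \<subseteq> W"
  note sub = is_subringD[OF is_subring_R_of[of W]]
  obtain a b where ab: "x = of_int a / of_nat b" "b > 0" "\<And>p. prime p \<Longrightarrow> p dvd b \<longleftrightarrow> p \<in> denom_primes x"
    by (rule denom_primes_fractionE[of x]) blast
  have "1 / of_nat b \<in> R_of W" if "b > 0" "\<And>p. prime p \<Longrightarrow> p dvd b \<Longrightarrow> p \<in> W" for b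
    using that
  proof (induction b rule: prime_divisors_induct)
    case (factor p n)
    have "1 / of_nat p \<in> R_of W"
      unfolding R_of_def using factor by (intro hull_inc) auto
    moreover have "1 / of_nat n \<in> R_of W" using factor by auto
    ultimately have "(1 / of_nat p) * (1 / of_nat n) \<in> R_of W" by (rule sub(4))
    then show ?case by simp
  qed (use sub(1) in auto)
  from this[OF ab(2)] have "1 / of_nat b \<in> R_of W" using ab(3) x by blast
  then have "of_int a * (1 / of_nat b) \<in> R_of W" by (rule sub(4)[OF sub(7)])
  then show "x \<in> R_of W" using ab(1) by simp
qed

section \<open>Baire category in the Cantor space and HTP-genericity\<close>

text \<open>
  These relations define the basic neighbourhoods of the Cantor space.
\<close>
definition agree :: "nat \<Rightarrow> nat set \<Rightarrow> nat set \<Rightarrow> bool" where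
  "agree M V W \<longleftrightarrow> (\<forall>p\<le>M. p \<in> V \<longleftrightarrow> p \<in> W)"

lemma agree_refl: "agree M V V"
  and agree_trans: "agree M U V \<Longrightarrow> agree M V W \<Longrightarrow> agree M U W"
  and agree_mono: "agree M V W \<Longrightarrow> M' \<le> M \<Longrightarrow> agree M' V W"
  by (auto simp: agree_def)

text \<open>
  A basic neighbourhood in the product topology constrains finitely many primes, and all of these lie below
  some bound \<open>M\<close>.
\<close>
lemma openin_cantor_top:
  "openin cantor_top U \<longleftrightarrow> U \<subseteq> Pow \<P> \<and> (\<forall>V\<in>U. \<exists>M. \<forall>W\<subseteq>\<P>. agree M V W \<longrightarrow> W \<in> U)"
    (is "_ \<longleftrightarrow> ?R U")
proof
  let ?f = "\<lambda>W. \<lambda>p\<in>\<P>. p \<in> W"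
  let ?X = "product_topology (\<lambda>_. discrete_topology (UNIV :: bool set)) \<P>"
  {
    assume "openin cantor_top U"
    then obtain O' where O: "openin ?X O'" "U = ?f -` O' \<inter> Pow \<P>"
      unfolding cantor_top_def openin_pullback_topology by blast
    have "\<exists>M. \<forall>W\<subseteq>\<P>. agree M V W \<longrightarrow> W \<in> U" if V: "V \<in> U" for V
    proof -
      have "?f V \<in> O'" using V O(2) by blast
      then obtain B where B: "finite {i \<in> \<P>. B i \<noteq> UNIV}" "?f V \<in> PiE \<P> B" "PiE \<P> B \<subseteq> O'"
        using O(1) unfolding openin_product_topology_alt by auto
      obtain M where M: "\<And>i. i \<in> \<P> \<Longrightarrow> B i \<noteq> UNIV \<Longrightarrow> i \<le> M"
        using finite_nat_set_iff_bounded_le[THEN iffD1, OF B(1)] by auto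
      have "W \<in> U" if W: "W \<subseteq> \<P>" "agree M V W" for W
      proof -
        have "?f W \<in> PiE \<P> B"
        proof (rule PiE_I)
          fix p assume p: "p \<in> \<P>"
          show "?f W p \<in> B p"
          proof (cases "B p = UNIV")
            case False
            then have "?f W p = ?f V p" using M[OF p] W(2) p by (simp add: agree_def)
            then show ?thesis using B(2) p by (simp only: PiE_mem)
          qed simp
        qed simp
        then show ?thesis using B(3) O(2) W(1) by blast
      qed
      then show ?thesis by blast
    qed
    then show "?R U" using O(2) by auto
  next
    assume R: "?R U"
    define O' where "O' = {g \<in> PiE \<P> (\<lambda>_. UNIV). {p \<in> \<P>. g p} \<in> U}"
    have "openin ?X O'"
      unfolding openin_product_topology_alt
    proof
      fix g assume g: "g \<in> O'"
      define V where "V = {p \<in> \<P>. g p}"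
      have "V \<in> U" using g by (simp add: O'_def V_def)
      then obtain M where M: "\<And>W. W \<subseteq> \<P> \<Longrightarrow> agree M V W \<Longrightarrow> W \<in> U" using R by blast
      define B where "B p = (if p \<le> M then {g p} else UNIV)" for p
      have "PiE \<P> B \<subseteq> O'"
      proof
        fix h assume h: "h \<in> PiE \<P> B"
        have "agree M V {p \<in> \<P>. h p}"
          unfolding agree_def
        proof (intro allI impI)
          fix p assume "p \<le> M"
          show "p \<in> V \<longleftrightarrow> p \<in> {p \<in> \<P>. h p}"
            using PiE_mem[OF h, of p] \<open>p \<le> M\<close> by (auto simp: V_def B_def)
        qed
        then have "{p \<in> \<P>. h p} \<in> U" by (intro M) auto
        then show "h \<in> O'" using h by (auto simp: O'_def PiE_def)
      qed
      moreover have "g \<in> PiE \<P> B" using g by (auto simp: O'_def B_def PiE_def)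
      moreover have "finite {i \<in> \<P>. B i \<noteq> topspace (discrete_topology UNIV)}"
        by (rule finite_subset[of _ "{..M}"]) (auto simp: B_def split: if_splits)
      ultimately show "\<exists>Ua. finite {i \<in> \<P>. Ua i \<noteq> topspace (discrete_topology UNIV)} \<and>
          (\<forall>i\<in>\<P>. openin (discrete_topology UNIV) (Ua i)) \<and> g \<in> PiE \<P> Ua \<and> PiE \<P> Ua \<subseteq> O'"
        by (intro exI[of _ B]) simp
    qed
    moreover have "U = ?f -` O' \<inter> Pow \<P>"
    proof -
      have mem: "?f W \<in> O' \<longleftrightarrow> W \<in> U" if W: "W \<subseteq> \<P>" for W
      proof -
        have eq: "{p. prime p \<and> ?f W p} = W" using W by auto
        have "?f W \<in> PiE \<P> (\<lambda>_. UNIV)" by simp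
        then show ?thesis by (simp only: O'_def mem_Collect_eq eq simp_thms)
      qed
      have sub: "U \<subseteq> Pow \<P>" using R by (rule conjunct1)
      show ?thesis
      proof (rule Set.set_eqI)
        fix W
        show "W \<in> U \<longleftrightarrow> W \<in> ?f -` O' \<inter> Pow \<P>"
        proof (cases "W \<subseteq> \<P>")
          case True
          then show ?thesis using mem[OF True] by (simp only: vimage_eq Int_iff Pow_iff simp_thms)
        next
          case False
          then show ?thesis using sub by blast
        qed
      qed
    qed
    ultimately show "openin cantor_top U" unfolding cantor_top_def openin_pullback_topology by blast
  }
qed

lemma openin_cantor_topD:
  assumes "openin cantor_top U" "V \<in> U"
  obtains M where "V \<subseteq> \<P>" "\<And>W. W \<subseteq> \<P> \<Longrightarrow> agree M V W \<Longrightarrow> W \<in> U"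
proof -
  note U = assms(1)[unfolded openin_cantor_top]
  have "V \<subseteq> \<P>" using conjunct1[OF U] assms(2) by blast
  moreover obtain M where "\<forall>W\<subseteq>\<P>. agree M V W \<longrightarrow> W \<in> U" using bspec[OF conjunct2[OF U] assms(2)] ..
  ultimately show ?thesis using that by blast
qed

lemma closure_cantor_top:
  assumes "S \<subseteq> Pow \<P>"
  shows "V \<in> cantor_top closure_of S \<longleftrightarrow> V \<subseteq> \<P> \<and> (\<forall>M. \<exists>W\<in>S. agree M V W)"
proof -
  have op: "openin cantor_top {W. W \<subseteq> \<P> \<and> agree M V W}" for M V
    unfolding openin_cantor_top by (auto intro: agree_trans)
  show ?thesis
  proof (intro iffI conjI allI)
    assume V: "V \<in> cantor_top closure_of S"
    then show "V \<subseteq> \<P>" by (simp add: in_closure_of topspace_cantor_top)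
    fix M
    have "\<forall>T. V \<in> T \<and> openin cantor_top T \<longrightarrow> (\<exists>y. y \<in> S \<and> y \<in> T)"
      using V unfolding in_closure_of by (rule conjunct2)
    moreover have "V \<in> {W. W \<subseteq> \<P> \<and> agree M V W}" using \<open>V \<subseteq> \<P>\<close> agree_refl by simp
    ultimately have "\<exists>y. y \<in> S \<and> y \<in> {W. W \<subseteq> \<P> \<and> agree M V W}" using op[of M V] by meson
    then show "\<exists>W\<in>S. agree M V W" by blast
  next
    assume R: "V \<subseteq> \<P> \<and> (\<forall>M. \<exists>W\<in>S. agree M V W)"
    have "\<exists>y. y \<in> S \<and> y \<in> T" if T: "V \<in> T" "openin cantor_top T" for T
    proof -
      obtain M where M: "V \<subseteq> \<P>" "\<And>W. W \<subseteq> \<P> \<Longrightarrow> agree M V W \<Longrightarrow> W \<in> T" by (rule openin_cantor_topD[OF T(2,1)]) blast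
      obtain W where W: "W \<in> S" "agree M V W" using R by blast
      then have "W \<subseteq> \<P>" using assms by blast
      then show ?thesis using M(2) W by blast
    qed
    then have "\<forall>T. V \<in> T \<and> openin cantor_top T \<longrightarrow> (\<exists>y. y \<in> S \<and> y \<in> T)" by (intro allI impI) simp
    then show "V \<in> cantor_top closure_of S"
      using R unfolding in_closure_of topspace_cantor_top Pow_iff by (intro conjI) simp_all
  qed
qed

lemma nowhere_dense_cantor_top:
  "nowhere_dense_in cantor_top S \<longleftrightarrow> S \<subseteq> Pow \<P> \<and>
     (\<forall>V\<subseteq>\<P>. \<forall>M. \<exists>W\<subseteq>\<P>. agree M V W \<and> (\<exists>M'. \<forall>W'\<in>S. \<not> agree M' W W'))"
proof (cases "S \<subseteq> Pow \<P>")
  case True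
  let ?C = "cantor_top closure_of S"
  have "cantor_top interior_of ?C = {} \<longleftrightarrow> (\<forall>V\<subseteq>\<P>. \<forall>M. \<exists>W\<subseteq>\<P>. agree M V W \<and> W \<notin> ?C)"
  proof
    assume empty: "cantor_top interior_of ?C = {}"
    show "\<forall>V\<subseteq>\<P>. \<forall>M. \<exists>W\<subseteq>\<P>. agree M V W \<and> W \<notin> ?C"
    proof (rule ccontr)
      assume "\<not> ?thesis"
      then obtain V M where V: "V \<subseteq> \<P>" "\<And>W. W \<subseteq> \<P> \<Longrightarrow> agree M V W \<Longrightarrow> W \<in> ?C" by blast
      have "openin cantor_top {W. W \<subseteq> \<P> \<and> agree M V W}"
        unfolding openin_cantor_top by (auto intro: agree_trans)
      then have "{W. W \<subseteq> \<P> \<and> agree M V W} \<subseteq> cantor_top interior_of ?C"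
        using V(2) by (intro interior_of_maximal) auto
      then show False using empty V(1) agree_refl by blast
    qed
  next
    assume R: "\<forall>V\<subseteq>\<P>. \<forall>M. \<exists>W\<subseteq>\<P>. agree M V W \<and> W \<notin> ?C"
    show "cantor_top interior_of ?C = {}"
    proof (rule ccontr)
      assume "cantor_top interior_of ?C \<noteq> {}"
      then obtain V where V: "V \<in> cantor_top interior_of ?C" by blast
      have "openin cantor_top (cantor_top interior_of ?C)" by simp
      then obtain M where M: "V \<subseteq> \<P>" "\<And>W. W \<subseteq> \<P> \<Longrightarrow> agree M V W \<Longrightarrow> W \<in> cantor_top interior_of ?C"
        using V by (rule openin_cantor_topD) blast
      obtain W where W: "W \<subseteq> \<P>" "agree M V W" "W \<notin> ?C" using R M(1) by blast
      then show False using M(2)[OF W(1,2)] interior_of_subset[of cantor_top ?C] by blast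
    qed
  qed
  moreover have "(\<exists>W\<subseteq>\<P>. agree M V W \<and> W \<notin> ?C) \<longleftrightarrow>
      (\<exists>W\<subseteq>\<P>. agree M V W \<and> (\<exists>M'. \<forall>W'\<in>S. \<not> agree M' W W'))" for V M
    unfolding closure_cantor_top[OF True] by meson
  ultimately show ?thesis
    unfolding nowhere_dense_in_def topspace_cantor_top using True by (simp only: Pow_iff subset_iff)
qed (simp add: nowhere_dense_in_def topspace_cantor_top)

lemma nowhere_dense_cantor_topD:
  assumes "nowhere_dense_in cantor_top S" "V \<subseteq> \<P>"
  obtains W M' where "W \<subseteq> \<P>" "agree M V W" "\<And>W'. W' \<in> S \<Longrightarrow> \<not> agree M' W W'"
proof -
  note nd = conjunct2[OF assms(1)[unfolded nowhere_dense_cantor_top]]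
  from spec[OF mp[OF spec[OF nd] assms(2)], of M] show ?thesis using that by (elim exE conjE) blast
qed

text \<open>
  The Baire category theorem, proved by building a sequence of sets \<open>V n\<close> and increasing bounds \<open>M n\<close>
  such that the sets agreeing with \<open>V (Suc n)\<close> up to \<open>M (Suc n)\<close> lie in \<open>D n\<close>. The limit is obtained
  by a diagonal: the prime \<open>p\<close> belongs to it if and only if it belongs to \<open>V p\<close>.
\<close>
lemma cantor_baire:
  fixes D :: "nat \<Rightarrow> nat set set"
  assumes V: "V \<subseteq> \<P>"
    and D: "\<And>n V M. V \<subseteq> \<P> \<Longrightarrow> \<exists>W\<subseteq>\<P>. agree M V W \<and> (\<exists>M'. \<forall>W'\<subseteq>\<P>. agree M' W W' \<longrightarrow> W' \<in> D n)"
  obtains W where "W \<subseteq> \<P>" "agree M V W" "\<And>n. W \<in> D n"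
proof -
  define Q where "Q n x y \<longleftrightarrow> agree (snd x) (fst x) (fst y) \<and> snd x < snd y \<and>
    (\<forall>W'\<subseteq>\<P>. agree (snd y) (fst y) W' \<longrightarrow> W' \<in> D n)" for n and x y :: "nat set \<times> nat"
  obtain s where s: "\<And>n. fst (s n) \<subseteq> \<P>" "s 0 = (V, M)" "\<And>n. Q n (s n) (s (Suc n))"
  proof -
    have "\<exists>s. \<forall>n. (fst (s n) \<subseteq> \<P> \<and> (n = 0 \<longrightarrow> s n = (V, M))) \<and> Q n (s n) (s (Suc n))"
    proof (rule dependent_nat_choice)
      show "\<exists>x. fst x \<subseteq> \<P> \<and> ((0::nat) = 0 \<longrightarrow> x = (V, M))" using V by auto
      fix x :: "nat set \<times> nat" and n :: nat
      assume "fst x \<subseteq> \<P> \<and> (n = 0 \<longrightarrow> x = (V, M))"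
      then obtain W M' where W: "W \<subseteq> \<P>" "agree (snd x) (fst x) W" "\<And>W'. W' \<subseteq> \<P> \<Longrightarrow> agree M' W W' \<Longrightarrow> W' \<in> D n"
        using D[of "fst x" "snd x" n] by blast
      have "Q n x (W, max M' (Suc (snd x)))"
        unfolding Q_def using W by (auto intro!: W(3) elim: agree_mono)
      then show "\<exists>y. (fst y \<subseteq> \<P> \<and> (Suc n = 0 \<longrightarrow> y = (V, M))) \<and> Q n x y"
        using W(1) by (intro exI[of _ "(W, max M' (Suc (snd x)))"]) (simp only: fst_conv nat.simps simp_thms)
    qed
    then obtain s where s: "\<forall>n. (fst (s n) \<subseteq> \<P> \<and> (n = 0 \<longrightarrow> s n = (V, M))) \<and> Q n (s n) (s (Suc n))" ..
    show ?thesis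
    proof (rule that[of s])
      show "fst (s n) \<subseteq> \<P>" "Q n (s n) (s (Suc n))" for n using spec[OF s, of n] by simp_all
      show "s 0 = (V, M)" using spec[OF s, of 0] by simp
    qed
  qed
  have ge: "n \<le> snd (s n)" for n
    by (induction n) (use s(3) in \<open>auto simp: Q_def intro: order_le_less_trans Suc_leI\<close>)
  have step: "agree (snd (s n)) (fst (s n)) (fst (s (n + k))) \<and> snd (s n) \<le> snd (s (n + k))" for n k
  proof (induction k)
    case (Suc k)
    have "agree (snd (s (n + k))) (fst (s (n + k))) (fst (s (Suc (n + k))))" "snd (s (n + k)) < snd (s (Suc (n + k)))"
      using s(3)[of "n + k"] by (auto simp: Q_def)
    then show ?case using Suc by (auto intro: agree_trans elim: agree_mono)
  qed (simp add: agree_refl)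
  define W where "W = {p. p \<in> fst (s p)}"
  have W: "agree (snd (s n)) (fst (s n)) W" for n
    unfolding agree_def
  proof (intro allI impI)
    fix p assume p: "p \<le> snd (s n)"
    show "p \<in> fst (s n) \<longleftrightarrow> p \<in> W"
    proof (cases "n \<le> p")
      case True
      then show ?thesis using step[of n "p - n"] p by (simp add: agree_def W_def)
    next
      case False
      then show ?thesis using step[of p "n - p"] ge[of p] by (simp add: agree_def W_def)
    qed
  qed
  show ?thesis
  proof (rule that)
    show "W \<subseteq> \<P>" using s(1) by (auto simp: W_def)
    then show "W \<in> D n" for n using s(3)[of n] W[of "Suc n"] by (simp add: Q_def)
    show "agree M V W" using W[of 0] s(2) by simp
  qed
qed

definition prefix_of :: "nat set \<Rightarrow> nat \<Rightarrow> nat \<rightharpoonup> bool" where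
  "prefix_of V M p = (if prime p \<and> p \<le> M then Some (p \<in> V) else None)"

lemma dom_prefix_of: "dom (prefix_of V M) = {p. prime p \<and> p \<le> M}"
  by (auto simp: prefix_of_def split: if_splits)

lemma prefix_of_fin_string: "prefix_of V M \<in> fin_strings"
proof -
  have "finite {p. prime p \<and> p \<le> M}" by (rule finite_subset[of _ "{..M}"]) auto
  then show ?thesis unfolding fin_strings_def mem_Collect_eq dom_prefix_of by auto
qed

lemma basic_open_prefix_of:
  assumes "V \<subseteq> \<P>" shows "basic_open (prefix_of V M) = {W. W \<subseteq> \<P> \<and> agree M V W}"
  using assms unfolding basic_open_def dom_prefix_of by (auto simp: prefix_of_def agree_def)

lemma fin_string_bound:
  assumes "\<sigma> \<in> fin_strings" obtains M where "\<And>p. p \<in> dom \<sigma> \<Longrightarrow> p \<le> M"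
proof -
  have "finite (dom \<sigma>)" using assms by (simp add: fin_strings_def)
  then obtain M where "\<forall>p\<in>dom \<sigma>. p \<le> M" using finite_nat_set_iff_bounded_le by blast
  then show ?thesis by (intro that[of M]) blast
qed

lemma meager_no_open:
  assumes meager: "meager_in cantor_top S" and V: "V \<subseteq> \<P>"
  obtains W where "W \<subseteq> \<P>" "agree M V W" "W \<notin> S"
proof -
  obtain F where F: "countable F" "\<And>A. A \<in> F \<Longrightarrow> nowhere_dense_in cantor_top A" "S = \<Union>F"
    using meager unfolding meager_in_def by blast
  define A where "A = from_nat_into (insert {} F)"
  have ran: "range A = insert {} F"
    unfolding A_def using F(1) by (intro range_from_nat_into) auto
  have empty: "nowhere_dense_in cantor_top {}" unfolding nowhere_dense_cantor_top using agree_refl by blast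
  have nd: "nowhere_dense_in cantor_top (A n)" for n
    using ran F(2) empty by (metis insertE rangeI)
  obtain W where W: "W \<subseteq> \<P>" "agree M V W" "\<And>n. W \<in> - A n"
  proof (rule cantor_baire[OF V, of "\<lambda>n. - A n" M])
    fix n V M assume "V \<subseteq> \<P>"
    then obtain W M' where "W \<subseteq> \<P>" "agree M V W" "\<And>W'. W' \<in> A n \<Longrightarrow> \<not> agree M' W W'"
      by (rule nowhere_dense_cantor_topD[OF nd[of n]]) blast
    then show "\<exists>W\<subseteq>\<P>. agree M V W \<and> (\<exists>M'. \<forall>W'\<subseteq>\<P>. agree M' W W' \<longrightarrow> W' \<in> - A n)" by blast
  qed blast
  have "W \<notin> S"
  proof
    assume "W \<in> S"
    then obtain n where "W \<in> A n" using F(3) ran by (metis UnionE insertCI rangeE)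
    then show False using W(3) by blast
  qed
  then show ?thesis using that W by blast
qed

lemma R_of_sub: "W \<subseteq> W' \<Longrightarrow> W' \<subseteq> \<P> \<Longrightarrow> x \<in> R_of W \<Longrightarrow> x \<in> R_of W'"
  using mem_R_of_iff[of W] mem_R_of_iff[of W'] by blast

text \<open>
  A solution involves only finitely many variables, hence only finitely many primes in denominators. The
  other variables may be set to \<open>0\<close>; the variable of index \<open>0\<close> is kept, because it will be the
  parameter.
\<close>
lemma solution_open:
  assumes W: "W \<subseteq> \<P>" and F: "polyfun F" and y: "\<And>i. y i \<in> R_of W" "F y = 0"
  obtains M where "\<And>W'. W' \<subseteq> \<P> \<Longrightarrow> agree M W W' \<Longrightarrow> \<exists>y'. (\<forall>i. y' i \<in> R_of W') \<and> F y' = 0 \<and> y' 0 = y 0"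
proof -
  obtain n where n: "\<And>e e'. (\<And>i. i < n \<Longrightarrow> e i = e' i) \<Longrightarrow> F e = F e'"
    by (rule polyfun_finite_dependence[OF F]) blast
  define y' where "y' i = (if i \<le> n then y i else 0)" for i
  define T where "T = (\<Union>i\<le>n. denom_primes (y i))"
  have "finite T" unfolding T_def by (intro finite_UN_I denom_primes_finite) auto
  then obtain M where M: "\<forall>p\<in>T. p \<le> M" unfolding finite_nat_set_iff_bounded_le ..
  have TW: "T \<subseteq> W" using y(1) mem_R_of_iff[OF W] by (auto simp: T_def)
  show ?thesis
  proof (rule that[of M], intro exI[of _ y'] conjI allI)
    fix W' i assume W': "W' \<subseteq> \<P>" "agree M W W'"
    show "y' i \<in> R_of W'"
    proof (cases "i \<le> n")
      case True
      then have "denom_primes (y i) \<subseteq> T" by (auto simp: T_def)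
      also have "T \<subseteq> W'" using TW M W'(2) by (auto simp: agree_def)
      finally show ?thesis using True mem_R_of_iff[OF W'(1)] by (simp add: y'_def)
    qed (simp add: y'_def is_subringD(2)[OF is_subring_R_of])
    have "F y' = F y" by (rule n) (simp add: y'_def)
    then show "F y' = 0" using y(2) by simp
    show "y' 0 = y 0" by (simp add: y'_def)
  qed
qed

lemma A_set_open:
  assumes "V \<in> A_set f"
  obtains M where "\<And>W. W \<subseteq> \<P> \<Longrightarrow> agree M V W \<Longrightarrow> W \<in> A_set f"
proof -
  obtain x where x: "V \<subseteq> \<P>" "\<And>i. x i \<in> R_of V" "eval_poly f x = 0"
    using assms unfolding A_set_def HTP_def by blast
  obtain M where M: "\<And>W'. W' \<subseteq> \<P> \<Longrightarrow> agree M V W' \<Longrightarrow> \<exists>y'. (\<forall>i. y' i \<in> R_of W') \<and> eval_poly f y' = 0 \<and> y' 0 = x 0"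
    by (rule solution_open[OF x(1) polyfun_eval_poly x(2,3)]) blast
  show ?thesis
  proof (rule that[of M])
    fix W assume "W \<subseteq> \<P>" "agree M V W"
    then show "W \<in> A_set f" using M[of W] unfolding A_set_def HTP_def by blast
  qed
qed

lemma not_boundary_iff:
  assumes V: "V \<subseteq> \<P>"
  shows "V \<notin> B_set f \<longleftrightarrow> V \<in> A_set f \<or> (\<exists>M. \<forall>W\<subseteq>\<P>. agree M V W \<longrightarrow> W \<notin> A_set f)"
proof -
  have "V \<in> cantor_top interior_of (Pow \<P> - A_set f) \<longleftrightarrow> (\<exists>M. \<forall>W\<subseteq>\<P>. agree M V W \<longrightarrow> W \<notin> A_set f)"
  proof
    assume "V \<in> cantor_top interior_of (Pow \<P> - A_set f)"
    then obtain M where M: "V \<subseteq> \<P>" "\<And>W. W \<subseteq> \<P> \<Longrightarrow> agree M V W \<Longrightarrow> W \<in> cantor_top interior_of (Pow \<P> - A_set f)"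
      by (rule openin_cantor_topD[OF openin_interior_of]) blast
    have "W \<notin> A_set f" if "W \<subseteq> \<P>" "agree M V W" for W
      using M(2)[OF that] interior_of_subset[of cantor_top "Pow \<P> - A_set f"] by blast
    then show "\<exists>M. \<forall>W\<subseteq>\<P>. agree M V W \<longrightarrow> W \<notin> A_set f" by blast
  next
    assume "\<exists>M. \<forall>W\<subseteq>\<P>. agree M V W \<longrightarrow> W \<notin> A_set f"
    then obtain M where M: "\<And>W. W \<subseteq> \<P> \<Longrightarrow> agree M V W \<Longrightarrow> W \<notin> A_set f" by blast
    have "openin cantor_top {W. W \<subseteq> \<P> \<and> agree M V W}"
      unfolding openin_cantor_top by (auto intro: agree_trans)
    then have "{W. W \<subseteq> \<P> \<and> agree M V W} \<subseteq> cantor_top interior_of (Pow \<P> - A_set f)"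
      using M by (intro interior_of_maximal) auto
    then show "V \<in> cantor_top interior_of (Pow \<P> - A_set f)" using V agree_refl by blast
  qed
  then have *: "(\<exists>M. \<forall>W\<subseteq>\<P>. agree M V W \<longrightarrow> W \<notin> A_set f) \<longleftrightarrow> V \<in> cantor_top interior_of (Pow \<P> - A_set f)" ..
  show ?thesis unfolding * B_set_def Diff_iff Pow_iff using V by blast
qed

text \<open>
  A finitely supported map is determined by its graph on the support, which is a finite set.
\<close>
lemma countable_zpoly: "countable (UNIV :: zpoly set)"
proof -
  have gen: "countable (UNIV :: ('a \<Rightarrow>\<^sub>0 'b :: zero) set)"
    if a: "countable (UNIV :: 'a set)" and b: "countable (UNIV :: 'b set)"
  proof -
    let ?g = "\<lambda>f :: 'a \<Rightarrow>\<^sub>0 'b. (\<lambda>k. (k, Poly_Mapping.lookup f k)) ` Poly_Mapping.keys f"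
    have "countable (UNIV :: ('a \<times> 'b) set)" using countable_SIGMA[OF a b] by simp
    then have "countable {A. finite A \<and> A \<subseteq> (UNIV :: ('a \<times> 'b) set)}" by (rule countable_Collect_finite_subset)
    moreover have "?g ` UNIV \<subseteq> {A. finite A \<and> A \<subseteq> UNIV}" by auto
    ultimately have "countable (?g ` UNIV)" by (rule countable_subset[rotated])
    moreover have "inj ?g"
    proof (rule injI, rule poly_mapping_eqI)
      fix f h :: "'a \<Rightarrow>\<^sub>0 'b" and k assume eq: "?g f = ?g h"
      have "(k, v) \<in> ?g f \<longleftrightarrow> v \<noteq> 0 \<and> Poly_Mapping.lookup f k = v" for v and f :: "'a \<Rightarrow>\<^sub>0 'b"
        by (auto simp: in_keys_iff)
      then show "Poly_Mapping.lookup f k = Poly_Mapping.lookup h k" using eq by metis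
    qed
    ultimately show ?thesis by (rule countable_image_inj_on)
  qed
  show ?thesis by (intro gen) auto
qed

text \<open>
  The complement of each boundary \<open>B_set f\<close> is open and dense, and there are countably many \<open>f\<close>.
\<close>
lemma generic_dense:
  assumes V: "V \<subseteq> \<P>"
  obtains W where "W \<subseteq> \<P>" "agree M V W" "HTP_generic W"
proof -
  define f where "f = from_nat_into (UNIV :: zpoly set)"
  have f: "range f = UNIV" unfolding f_def using countable_zpoly by (intro range_from_nat_into) auto
  obtain W where W: "W \<subseteq> \<P>" "agree M V W" "\<And>n. W \<in> - B_set (f n)"
  proof (rule cantor_baire[OF V, of "\<lambda>n. - B_set (f n)" M])
    fix n V M assume V: "V \<subseteq> \<P>"
    show "\<exists>W\<subseteq>\<P>. agree M V W \<and> (\<exists>M'. \<forall>W'\<subseteq>\<P>. agree M' W W' \<longrightarrow> W' \<in> - B_set (f n))"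
    proof (cases "\<exists>W\<subseteq>\<P>. agree M V W \<and> W \<in> A_set (f n)")
      case True
      then obtain W where W: "W \<subseteq> \<P>" "agree M V W" "W \<in> A_set (f n)" by blast
      obtain M' where M': "\<And>W'. W' \<subseteq> \<P> \<Longrightarrow> agree M' W W' \<Longrightarrow> W' \<in> A_set (f n)"
        using A_set_open[OF W(3)] by blast
      have "W' \<in> - B_set (f n)" if "W' \<subseteq> \<P>" "agree M' W W'" for W'
        using M'[OF that] not_boundary_iff[OF that(1)] by blast
      then show ?thesis using W(1,2) by blast
    next
      case False
      have "W' \<in> - B_set (f n)" if W': "W' \<subseteq> \<P>" "agree M V W'" for W'
      proof -
        have "W'' \<notin> A_set (f n)" if "W'' \<subseteq> \<P>" "agree M W' W''" for W''
          using False that agree_trans[OF W'(2) that(2)] by blast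
        then show ?thesis using not_boundary_iff[OF W'(1), of "f n"] by blast
      qed
      then show ?thesis using V agree_refl by blast
    qed
  qed blast
  have "W \<notin> B_set h" for h using W(3) f by (metis ComplD UNIV_I rangeE)
  then show ?thesis using that W(1,2) unfolding HTP_generic_def by blast
qed

lemma specialise_poly:
  obtains f where "\<And>y. eval_poly f y = eval_poly g (case_nat (of_int k) y)"
proof -
  have "polyfun (\<lambda>y. case_nat (of_int k) y i)" for i
    by (cases i) (simp_all add: polyfun_const_int polyfun_var)
  then have "polyfun (\<lambda>y. eval_poly g (\<lambda>i. case_nat (of_int k) y i))"
    by (rule polyfun_compose[OF polyfun_eval_poly])
  then obtain f where f: "eval_poly f = (\<lambda>y. eval_poly g (\<lambda>i. case_nat (of_int k) y i))"
    by (rule polyfun_is_eval_poly) blast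
  show ?thesis by (rule that[of f]) (simp add: f)
qed

text \<open>
  Genericity is used for integers \<open>q\<close> only: the polynomial \<open>g (q, Y)\<close> has a zero in the rings of a dense
  set near \<open>V\<close>, so no neighbourhood of \<open>V\<close> avoids solvability, and a generic \<open>V\<close> must then have a zero
  itself. Conversely, a zero for a parameter \<open>q\<close> persists in a neighbourhood of \<open>V\<close>, and the dense
  set shows that \<open>q\<close> is an integer.
\<close>
lemma nonmeager_imp_generic_definition:
  assumes "\<not> meager_in cantor_top E_class"
  obtains \<sigma> g where "\<sigma> \<in> fin_strings" "\<And>V. V \<in> basic_open \<sigma> \<Longrightarrow> HTP_generic V \<Longrightarrow> ex_defines_Z g (R_of V)"
proof -
  define E where "E g = {W. W \<subseteq> \<P> \<and> ex_defines_Z g (R_of W)}" for g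
  have "E_class = \<Union>(range E)" by (auto simp: E_class_def E_def Z_ex_definable_def)
  moreover have "countable (range E)" using countable_zpoly by simp
  ultimately obtain g where g: "\<not> nowhere_dense_in cantor_top (E g)"
    using assms unfolding meager_in_def by blast
  have "E g \<subseteq> Pow \<P>" by (auto simp: E_def)
  then obtain V0 M0 where V0: "V0 \<subseteq> \<P>"
    and dense: "\<And>W M'. W \<subseteq> \<P> \<Longrightarrow> agree M0 V0 W \<Longrightarrow> \<exists>W'\<in>E g. agree M' W W'"
    using g unfolding nowhere_dense_cantor_top by meson
  show ?thesis
  proof (rule that[OF prefix_of_fin_string[of V0 M0]])
    fix V assume "V \<in> basic_open (prefix_of V0 M0)" and gen: "HTP_generic V"
    then have V: "V \<subseteq> \<P>" "agree M0 V0 V" by (auto simp: basic_open_prefix_of[OF V0])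
    show "ex_defines_Z g (R_of V)"
      unfolding ex_defines_Z_def
    proof (intro ballI iffI)
      fix q assume q: "q \<in> R_of V" "q \<in> \<int>"
      then obtain k where k: "q = of_int k" by (auto elim: Ints_cases)
      obtain f where f: "\<And>y. eval_poly f y = eval_poly g (case_nat (of_int k) y)"
        by (rule specialise_poly[where g = g and k = k]) blast
      have EA: "W \<in> A_set f" if "W \<in> E g" for W
      proof -
        have "\<exists>y. (\<forall>i. y i \<in> R_of W) \<and> eval_poly g (case_nat (of_int k) y) = 0"
        proof -
          have d: "ex_defines_Z g (R_of W)" using that by (simp add: E_def)
          have "of_int k \<in> R_of W" by (rule is_subringD(7)[OF is_subring_R_of])
          from iffD1[OF bspec[OF d[unfolded ex_defines_Z_def] this] Ints_of_int] show ?thesis .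
        qed
        then show ?thesis using that unfolding A_set_def HTP_def f[symmetric] E_def by simp
      qed
      have "\<not> (\<exists>M. \<forall>W\<subseteq>\<P>. agree M V W \<longrightarrow> W \<notin> A_set f)"
      proof
        assume "\<exists>M. \<forall>W\<subseteq>\<P>. agree M V W \<longrightarrow> W \<notin> A_set f"
        then obtain M where M: "\<And>W. W \<subseteq> \<P> \<Longrightarrow> agree M V W \<Longrightarrow> W \<notin> A_set f" by blast
        obtain W where "W \<in> E g" "agree M V W" using dense[OF V, of M] by blast
        then show False using M EA \<open>E g \<subseteq> Pow \<P>\<close> by blast
      qed
      then have "V \<in> A_set f" using gen not_boundary_iff[OF V(1), of f] unfolding HTP_generic_def by blast
      then obtain y where y: "\<forall>i. y i \<in> R_of V" "eval_poly f y = 0" unfolding A_set_def HTP_def by auto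
      then show "\<exists>y. (\<forall>i. y i \<in> R_of V) \<and> eval_poly g (case_nat q y) = 0"
        by (intro exI[of _ y]) (simp add: f k)
    next
      fix q assume q: "q \<in> R_of V" and "\<exists>y. (\<forall>i. y i \<in> R_of V) \<and> eval_poly g (case_nat q y) = 0"
      then obtain y where y: "\<And>i. y i \<in> R_of V" "eval_poly g (case_nat q y) = 0" by blast
      have qy: "case_nat q y i \<in> R_of V" for i using q y(1) by (cases i) auto
      obtain M where M: "\<And>W'. W' \<subseteq> \<P> \<Longrightarrow> agree M V W' \<Longrightarrow>
          \<exists>y'. (\<forall>i. y' i \<in> R_of W') \<and> eval_poly g y' = 0 \<and> y' 0 = case_nat q y 0"
        by (rule solution_open[OF V(1) polyfun_eval_poly qy y(2)]) blast
      obtain W where W: "W \<in> E g" "agree M V W" using dense[OF V, of M] by blast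
      then have WP: "W \<subseteq> \<P>" and d: "ex_defines_Z g (R_of W)" by (simp_all add: E_def)
      obtain y' where y': "\<forall>i. y' i \<in> R_of W" "eval_poly g y' = 0" "y' 0 = q"
        using M[OF WP W(2)] by auto
      have "case_nat q (\<lambda>i. y' (Suc i)) = y'" using y'(3) by (auto split: nat.split)
      then have "\<exists>y. (\<forall>i. y i \<in> R_of W) \<and> eval_poly g (case_nat q y) = 0"
        using y' by (intro exI[of _ "\<lambda>i. y' (Suc i)"]) simp
      moreover have "q \<in> R_of W" using y' by auto
      ultimately show "q \<in> \<int>" using iffD2[OF bspec[OF d[unfolded ex_defines_Z_def]]] by blast
    qed
  qed
qed

section \<open>Semilocal rings are Diophantine over the rationals\<close>

lemma diophantine_certificate:
  "diophantine (\<lambda>e. integrality_certificate p r (2 * of_nat r * (e 0) ^ 3))"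
proof -
  define P where "P e \<longleftrightarrow> 1 + of_nat p * ((2 * of_nat r * (e 0) ^ 3)\<^sup>2 - of_nat r * (e 1)\<^sup>2)
    - ((e 2)\<^sup>2 - of_nat r * (e 3)\<^sup>2) = 0" for e :: "nat \<Rightarrow> rat"
  have "diophantine P" unfolding P_def by (intro diophantine_eq_0 polyfun_intros)
  from diophantine_ex[OF this, of "{1, 2, 3}"]
  have "diophantine (\<lambda>e. \<exists>y. P (\<lambda>i. if i \<in> {1, 2, 3} then y i else e i))" .
  moreover have "(\<exists>y. P (\<lambda>i. if i \<in> {1, 2, 3} then y i else e i)) \<longleftrightarrow>
      integrality_certificate p r (2 * of_nat r * (e 0) ^ 3)" for e
  proof
    assume "\<exists>y. P (\<lambda>i. if i \<in> {1, 2, 3} then y i else e i)"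
    then show "integrality_certificate p r (2 * of_nat r * (e 0) ^ 3)"
      unfolding P_def integrality_certificate_def by auto
  next
    assume "integrality_certificate p r (2 * of_nat r * (e 0) ^ 3)"
    then obtain W E F where "1 + of_nat p * ((2 * of_nat r * (e 0) ^ 3)\<^sup>2 - of_nat r * W\<^sup>2) = E\<^sup>2 - of_nat r * F\<^sup>2"
      unfolding integrality_certificate_def by blast
    then show "\<exists>y. P (\<lambda>i. if i \<in> {1, 2, 3} then y i else e i)"
      unfolding P_def by (intro exI[of _ "\<lambda>i. if i = 1 then W else if i = 2 then E else F"]) simp
  qed
  ultimately show ?thesis by simp
qed

lemma semilocal_certificate:
  assumes S: "finite S" "S \<subseteq> \<P>"
  obtains D where "diophantine (\<lambda>e. D (e 0))" "\<And>n::int. D (of_int n)"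
    "\<And>x. D x \<Longrightarrow> denom_primes x \<inter> S = {}"
proof -
  have "\<exists>D. diophantine (\<lambda>e. D (e 0)) \<and> (\<forall>n::int. D (of_int n)) \<and> (\<forall>x. D x \<longrightarrow> q \<notin> denom_primes x)"
    if "q \<in> S" for q
  proof -
    have q: "prime q" using that S(2) by blast
    obtain p r :: nat where pr: "\<And>n::int. integrality_certificate p r (2 * of_nat r * (of_int n) ^ 3)"
      "\<And>x. integrality_certificate p r (2 * of_nat r * x ^ 3) \<Longrightarrow> \<exists>a b. x = of_int a / of_int b \<and> b > 0 \<and> \<not> int q dvd b"
      using prime_integrality_certificate[OF q] by blast
    have "q \<notin> denom_primes x" if cert: "integrality_certificate p r (2 * of_nat r * x ^ 3)" for x
    proof -
      obtain a b where ab: "x = of_int a / of_int b" "b > 0" "\<not> int q dvd b" using pr(2)[OF cert] by blast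
      have "denom x dvd b" by (rule denom_dvd[OF ab(1)]) (use ab(2) in simp)
      then show ?thesis using ab(3) by (auto simp: denom_primes_def dest: dvd_trans)
    qed
    then show ?thesis using diophantine_certificate pr(1)
      by (intro exI[of _ "\<lambda>x. integrality_certificate p r (2 * of_nat r * x ^ 3)"]) blast
  qed
  then obtain D where D: "\<And>q. q \<in> S \<Longrightarrow> diophantine (\<lambda>e. D q (e 0))" "\<And>q n. q \<in> S \<Longrightarrow> D q (of_int n)"
    "\<And>q x. q \<in> S \<Longrightarrow> D q x \<Longrightarrow> q \<notin> denom_primes x" by metis
  show ?thesis
  proof (rule that[of "\<lambda>x. \<forall>q\<in>S. D q x"])
    show "diophantine (\<lambda>e. \<forall>q\<in>S. D q (e 0))" by (rule diophantine_ball[OF S(1) D(1)])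
  qed (use D(2,3) in blast)+
qed

text \<open>
  The elements of the ring are the fractions \<open>a / (1 + N * c)\<close> with \<open>a\<close> and \<open>c\<close> in the set \<open>D\<close>: for
  integral \<open>c\<close> at each prime of \<open>S\<close> the denominator is a unit there, and conversely a denominator
  prime to \<open>N\<close> can be extended to one that is \<open>1\<close> modulo \<open>N\<close>.
\<close>
lemma diophantine_semilocal_ring:
  assumes S: "finite S" "S \<subseteq> \<P>"
  shows "diophantine (\<lambda>e. e 0 \<in> R_of (\<P> - S))"
proof -
  obtain D where D: "diophantine (\<lambda>e. D (e 0))" "\<And>n::int. D (of_int n)"
    "\<And>x. D x \<Longrightarrow> denom_primes x \<inter> S = {}"
    using semilocal_certificate[OF S] by blast
  define N where "N = \<Prod>S"
  have N: "N > 0" unfolding N_def using S(2) by (intro prod_pos) (auto simp: prime_gt_0_nat)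
  have qN: "q dvd N" if "q \<in> S" for q using S(1) that unfolding N_def by (simp add: dvd_prod_eqI)
  have iff: "x \<in> R_of (\<P> - S) \<longleftrightarrow> (\<exists>a c. D a \<and> D c \<and> 1 + of_nat N * c \<noteq> 0 \<and> x * (1 + of_nat N * c) - a = 0)" for x
  proof
    assume "x \<in> R_of (\<P> - S)"
    then have bx: "denom_primes x \<inter> S = {}" using mem_R_of_iff[of "\<P> - S" x] by blast
    obtain a where a: "x = of_int a / of_int (denom x)" by (rule denom_numerator)
    have "coprime (denom x) (int N)"
    proof -
      have "coprime (denom x) (int q)" if "q \<in> S" for q
      proof -
        have "prime q" using that S(2) by blast
        then have "\<not> int q dvd denom x" using bx that by (auto simp: denom_primes_def)
        then show ?thesis using \<open>prime q\<close> by (simp add: coprime_commute prime_imp_coprime)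
      qed
      then have "coprime (denom x) (\<Prod>q\<in>S. int q)" by (intro prod_coprime_right)
      then show ?thesis by (simp add: N_def)
    qed
    then obtain v0 where v0: "[denom x * v0 = 1] (mod int N)" using cong_solve_coprime_int by blast
    \<comment> \<open>If \<open>N = 1\<close>, the inverse \<open>0\<close> is possible and would give the denominator \<open>0\<close>.\<close>
    define v where "v = (if v0 = 0 then int N else v0)"
    have "[denom x * v = 1] (mod int N)"
    proof (cases "v0 = 0")
      case True
      then show ?thesis using v0 by (simp add: v_def cong_def)
    qed (use v0 in \<open>simp add: v_def\<close>)
    then have "int N dvd denom x * v - 1" by (simp add: cong_iff_dvd_diff)
    then obtain c where c: "denom x * v = 1 + int N * c" by (metis dvdE add_diff_cancel_left' diff_add_cancel add.commute)
    have v: "v \<noteq> 0" using N by (simp add: v_def)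
    have "1 + of_nat N * of_int c = (of_int (denom x * v) :: rat)" unfolding c by simp
    moreover have "x * of_int (denom x * v) = of_int (a * v)"
      using denom_pos[of x] by (subst a) simp
    ultimately show "\<exists>a c. D a \<and> D c \<and> 1 + of_nat N * c \<noteq> 0 \<and> x * (1 + of_nat N * c) - a = 0"
      using D(2)[of "a * v"] D(2)[of c] v denom_pos[of x]
      by (rule_tac exI[of _ "of_int (a * v)"], rule_tac exI[of _ "of_int c"]) simp
  next
    assume "\<exists>a c. D a \<and> D c \<and> 1 + of_nat N * c \<noteq> 0 \<and> x * (1 + of_nat N * c) - a = 0"
    then obtain a c where ac: "D a" "D c" "1 + of_nat N * c \<noteq> 0" "x * (1 + of_nat N * c) = a" by auto
    obtain a1 where a1: "a = of_int a1 / of_int (denom a)" by (rule denom_numerator)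
    obtain c1 where c1: "c = of_int c1 / of_int (denom c)" by (rule denom_numerator)
    define u where "u = denom c + int N * c1"
    have u: "1 + of_nat N * c = of_int u / of_int (denom c)"
      unfolding u_def using denom_pos[of c] by (subst c1) (simp add: add_divide_distrib)
    have "u \<noteq> 0" using u ac(3) by auto
    have "x = a / (1 + of_nat N * c)" using ac(3,4) by (metis nonzero_mult_div_cancel_right)
    also have "\<dots> = of_int (a1 * denom c) / of_int (denom a * u)"
      unfolding u using denom_pos[of a] by (subst a1) simp
    finally have "denom x dvd denom a * u" by (rule denom_dvd) (use denom_pos[of a] \<open>u \<noteq> 0\<close> in simp)
    have "q \<notin> denom_primes x" if q: "q \<in> S" for q
    proof
      assume "q \<in> denom_primes x"
      then have pq: "prime (int q)" "int q dvd denom a * u"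
        using \<open>denom x dvd denom a * u\<close> by (auto simp: denom_primes_def dest: dvd_trans)
      moreover have "\<not> int q dvd denom a" "\<not> int q dvd denom c"
        using D(3)[OF ac(1)] D(3)[OF ac(2)] q pq(1) by (auto simp: denom_primes_def)
      moreover have "int q dvd u \<longleftrightarrow> int q dvd denom c"
        unfolding u_def using qN[OF q] by (simp add: dvd_add_left_iff)
      ultimately show False using prime_dvd_multD by blast
    qed
    then have "denom_primes x \<subseteq> \<P> - S" by (auto simp: denom_primes_def)
    then show "x \<in> R_of (\<P> - S)" using mem_R_of_iff[of "\<P> - S" x] by blast
  qed
  define P where "P e \<longleftrightarrow> (D (e 1) \<and> D (e 2)) \<and> 1 + of_nat N * e 2 \<noteq> 0 \<and> e 0 * (1 + of_nat N * e 2) - e 1 = 0"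
    for e :: "nat \<Rightarrow> rat"
  have "diophantine P"
    unfolding P_def
    by (intro diophantine_conj diophantine_neq_0 diophantine_eq_0 polyfun_intros
        diophantine_subst[OF D(1), of "\<lambda>i e. e 1"] diophantine_subst[OF D(1), of "\<lambda>i e. e 2"])
  from diophantine_ex[OF this, of "{1, 2}"]
  have "diophantine (\<lambda>e. \<exists>y. P (\<lambda>i. if i \<in> {1, 2} then y i else e i))" .
  moreover have "(\<exists>y. P (\<lambda>i. if i \<in> {1, 2} then y i else e i)) \<longleftrightarrow> e 0 \<in> R_of (\<P> - S)" for e
  proof
    assume "\<exists>y. P (\<lambda>i. if i \<in> {1, 2} then y i else e i)"
    then show "e 0 \<in> R_of (\<P> - S)" unfolding iff P_def by auto
  next
    assume "e 0 \<in> R_of (\<P> - S)"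
    then obtain a c where "D a" "D c" "1 + of_nat N * c \<noteq> 0" "e 0 * (1 + of_nat N * c) - a = 0"
      unfolding iff by blast
    then show "\<exists>y. P (\<lambda>i. if i \<in> {1, 2} then y i else e i)"
      unfolding P_def by (intro exI[of _ "\<lambda>i. if i = 1 then a else c"]) simp
  qed
  ultimately show ?thesis by simp
qed

section \<open>Transfer of definitions between subrings\<close>

lemma ex_defines_ZD:
  assumes "ex_defines_Z g R" "q \<in> R"
  shows "q \<in> \<int> \<longleftrightarrow> (\<exists>y. (\<forall>i. y i \<in> R) \<and> eval_poly g (case_nat q y) = 0)"
  using assms(1)[unfolded ex_defines_Z_def] assms(2) by (rule bspec)

lemma case_nat_Suc: "case_nat (y 0) (\<lambda>i. y (Suc i)) = y"
  by (auto split: nat.split)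

text \<open>
  For an integer \<open>q\<close>, a generic set that contains no prime of \<open>S\<close> supplies the zero. For a parameter with
  a zero in the semilocal ring, the zero already exists in the ring of a generic set close to \<open>\<P> - S\<close>.
\<close>
lemma generic_definition_imp_semilocal_definition:
  assumes \<sigma>: "\<sigma> \<in> fin_strings"
    and g: "\<And>V. V \<in> basic_open \<sigma> \<Longrightarrow> HTP_generic V \<Longrightarrow> ex_defines_Z g (R_of V)"
    and S_def: "S = {p. \<sigma> p = Some False}"
  shows "ex_defines_Z g (R_of (\<P> - S))"
proof -
  have dom: "dom \<sigma> \<subseteq> \<P>" using \<sigma> by (simp add: fin_strings_def)
  obtain M where M: "\<And>p. p \<in> dom \<sigma> \<Longrightarrow> p \<le> M" by (rule fin_string_bound[OF \<sigma>]) blast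
  let ?R = "R_of (\<P> - S)"
  have R: "\<P> - S \<subseteq> \<P>" by blast
  have basic: "V \<in> basic_open \<sigma>" if "V \<subseteq> \<P>" "\<And>p. p \<in> dom \<sigma> \<Longrightarrow> p \<in> V \<longleftrightarrow> \<sigma> p = Some True" for V
  proof -
    have "\<sigma> p = Some (p \<in> V)" if p: "p \<in> dom \<sigma>" for p
    proof -
      obtain b where "\<sigma> p = Some b" using p by blast
      then show ?thesis using \<open>\<And>p. p \<in> dom \<sigma> \<Longrightarrow> _ = (_ = Some True)\<close>[OF p] by (cases b) auto
    qed
    then show ?thesis using that(1) by (simp add: basic_open_def)
  qed
  show ?thesis
    unfolding ex_defines_Z_def
  proof (intro ballI iffI)
    fix q :: rat assume q: "q \<in> \<int>"
    define V0 where "V0 = {p. \<sigma> p = Some True}"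
    have "V0 \<subseteq> \<P>" using dom by (auto simp: V0_def)
    then obtain V where V: "V \<subseteq> \<P>" "agree M V0 V" "HTP_generic V" by (rule generic_dense) blast
    have mem: "p \<in> V \<longleftrightarrow> \<sigma> p = Some True" if "p \<in> dom \<sigma>" for p
      using V(2) M[OF that] by (simp add: agree_def V0_def)
    have "p \<notin> V" if "p \<in> S" for p using mem[of p] that by (auto simp: S_def)
    then have VS: "V \<subseteq> \<P> - S" using V(1) by blast
    have "ex_defines_Z g (R_of V)" by (rule g[OF basic[OF V(1) mem] V(3)])
    moreover have "q \<in> R_of V" using q is_subringD(7)[OF is_subring_R_of] by (auto elim!: Ints_cases)
    ultimately obtain y where "\<forall>i. y i \<in> R_of V" "eval_poly g (case_nat q y) = 0"
      using q ex_defines_ZD by blast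
    then show "\<exists>y. (\<forall>i. y i \<in> ?R) \<and> eval_poly g (case_nat q y) = 0"
      using R_of_sub[OF VS R] by blast
  next
    fix q assume q: "q \<in> ?R" and "\<exists>y. (\<forall>i. y i \<in> ?R) \<and> eval_poly g (case_nat q y) = 0"
    then obtain y where y: "\<And>i. y i \<in> ?R" "eval_poly g (case_nat q y) = 0" by blast
    have qy: "case_nat q y i \<in> ?R" for i using q y(1) by (cases i) auto
    obtain M' where M': "\<And>W'. W' \<subseteq> \<P> \<Longrightarrow> agree M' (\<P> - S) W' \<Longrightarrow>
        \<exists>y'. (\<forall>i. y' i \<in> R_of W') \<and> eval_poly g y' = 0 \<and> y' 0 = case_nat q y 0"
      by (rule solution_open[OF R polyfun_eval_poly qy y(2)]) blast
    obtain V where V: "V \<subseteq> \<P>" "agree (max M M') (\<P> - S) V" "HTP_generic V"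
      by (rule generic_dense[OF R]) blast
    have mem: "p \<in> V \<longleftrightarrow> \<sigma> p = Some True" if p: "p \<in> dom \<sigma>" for p
    proof -
      have "p \<in> V \<longleftrightarrow> p \<notin> S"
      proof -
        have "p \<le> max M M'" using M[OF p] by simp
        then have "p \<in> \<P> - S \<longleftrightarrow> p \<in> V" using V(2) unfolding agree_def by blast
        moreover have "p \<in> \<P>" using dom p by blast
        ultimately show ?thesis by blast
      qed
      moreover obtain b where "\<sigma> p = Some b" using p by blast
      ultimately show ?thesis by (cases b) (auto simp: S_def)
    qed
    have d: "ex_defines_Z g (R_of V)" by (rule g[OF basic[OF V(1) mem] V(3)])
    have "agree M' (\<P> - S) V" using V(2) by (rule agree_mono) simp
    then obtain y' where y': "\<forall>i. y' i \<in> R_of V" "eval_poly g y' = 0" "y' 0 = q"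
      using M'[OF V(1)] by auto
    have "eval_poly g (case_nat q (\<lambda>i. y' (Suc i))) = 0" using y'(2) case_nat_Suc[of y'] unfolding y'(3) by simp
    moreover have "q \<in> R_of V" using y' by auto
    ultimately show "q \<in> \<int>" using ex_defines_ZD[OF d] y'(1) by (metis (no_types, lifting))
  qed
qed

text \<open>
  The unknowns are required to lie in the ring by means of its Diophantine definition; only those that
  occur in \<open>g\<close> need to be restricted.
\<close>
lemma semilocal_definition_imp_rat_definition:
  assumes S: "finite S" "S \<subseteq> \<P>" and g: "ex_defines_Z g (R_of (\<P> - S))"
  obtains g' where "ex_defines_Z g' UNIV"
proof -
  let ?R = "R_of (\<P> - S)"
  obtain n where n: "\<And>e e'. (\<And>i. i < n \<Longrightarrow> e i = e' i) \<Longrightarrow> eval_poly g e = eval_poly g e'"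
    by (rule polyfun_finite_dependence[OF polyfun_eval_poly[of g]]) blast
  define P where "P e \<longleftrightarrow> (\<forall>i\<in>{..n}. e i \<in> ?R) \<and> eval_poly g e = 0" for e
  have mem: "diophantine (\<lambda>e. e i \<in> ?R)" for i
    using diophantine_subst[OF diophantine_semilocal_ring[OF S], of "\<lambda>_ e. e i"] polyfun_var by blast
  have "diophantine P"
    unfolding P_def by (intro diophantine_conj diophantine_ball mem diophantine_eq_0 polyfun_eval_poly) simp
  from diophantine_ex[OF this, of "{0<..}"]
  have "diophantine (\<lambda>e. \<exists>y. P (\<lambda>i. if i \<in> {0<..} then y i else e i))" .
  then obtain g' where g': "\<And>q. (\<exists>y. P (\<lambda>i. if i \<in> {0<..} then y i else q)) \<longleftrightarrow>
      (\<exists>y. eval_poly g' (case_nat q y) = 0)"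
    by (rule diophantine_to_poly) blast
  have "q \<in> \<int> \<longleftrightarrow> (\<exists>y. P (\<lambda>i. if i \<in> {0<..} then y i else q))" for q
  proof
    assume q: "q \<in> \<int>"
    then have qR: "q \<in> ?R" using is_subringD(7)[OF is_subring_R_of] by (auto elim!: Ints_cases)
    then obtain y where y: "\<forall>i. y i \<in> ?R" "eval_poly g (case_nat q y) = 0"
      using ex_defines_ZD[OF g] q by blast
    have eq: "(\<lambda>i. if i \<in> {0<..} then case_nat q y i else q) = case_nat q y" by (auto split: nat.split)
    have "P (case_nat q y)" unfolding P_def using y qR by (auto split: nat.split)
    then have "P (\<lambda>i. if i \<in> {0<..} then case_nat q y i else q)" unfolding eq .
    then show "\<exists>y. P (\<lambda>i. if i \<in> {0<..} then y i else q)" by (rule exI[where x = "case_nat q y"])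
  next
    assume "\<exists>y. P (\<lambda>i. if i \<in> {0<..} then y i else q)"
    then obtain y where y: "P (\<lambda>i. if i \<in> {0<..} then y i else q)" by blast
    define e where "e = (\<lambda>i. if i \<in> {0<..} then y i else q)"
    define y' where "y' i = (if Suc i \<le> n then e (Suc i) else 0)" for i
    have e: "\<And>i. i \<le> n \<Longrightarrow> e i \<in> ?R" "eval_poly g e = 0" "e 0 = q" using y unfolding e_def[symmetric] P_def by (auto simp: e_def)
    have "eval_poly g (case_nat q y') = eval_poly g e"
      by (rule n) (use e(3) in \<open>auto simp: y'_def split: nat.split\<close>)
    moreover have "y' i \<in> ?R" for i
      using e(1) is_subringD(2)[OF is_subring_R_of] by (simp add: y'_def)
    moreover have "q \<in> ?R" using e(1)[of 0] e(3) by simp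
    ultimately show "q \<in> \<int>" using ex_defines_ZD[OF g] e(2) by auto
  qed
  then have "ex_defines_Z g' UNIV" unfolding ex_defines_Z_def using g' by simp
  then show ?thesis using that by blast
qed

lemma clear_denominators:
  fixes y :: "nat \<Rightarrow> rat"
  obtains d :: nat where "d > 0" "\<And>i. i < n \<Longrightarrow> of_nat d * y i \<in> \<int>"
proof -
  obtain d :: nat where "d > 0" "\<And>x. x \<in> y ` {..<n} \<Longrightarrow> of_nat d * x \<in> \<int>"
    by (rule rat_common_denominator[of "y ` {..<n}"]) auto
  then show ?thesis using that by blast
qed

text \<open>
  The odd part of \<open>d\<close> is of the form \<open>2 * v - 1\<close>, and the odd powers of \<open>2\<close> are of the form
  \<open>3 * w - 1\<close>.
\<close>
lemma divides_denominator_form: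
  fixes d :: nat
  assumes "d > 0"
  obtains v w :: int where "int d dvd (2 * v - 1) * (3 * w - 1)"
proof -
  define k where "k = multiplicity 2 d"
  obtain m where m: "d = 2 ^ k * m" "odd m"
    unfolding k_def using multiplicity_decompose'[of d 2] assms by auto
  obtain j where j: "m = 2 * j + 1" using m(2) by (elim oddE)
  have w: "\<exists>w::int. 2 ^ (2 * i + 1) = 3 * w - 1" for i
  proof (induction i)
    case 0
    show ?case by (intro exI[of _ 1]) simp
  next
    case (Suc i)
    then obtain w :: int where "2 ^ (2 * i + 1) = 3 * w - 1" by blast
    then show ?case by (intro exI[of _ "4 * w - 1"]) simp
  qed
  obtain w :: int where w: "2 ^ (2 * k + 1) = 3 * w - 1" using w by blast
  have "int d = (2 ^ k) * (2 * (int j + 1) - 1)" unfolding m(1) j by (simp add: algebra_simps)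
  moreover have "(2::int) ^ k dvd 3 * w - 1" unfolding w[symmetric] by (intro le_imp_power_dvd) simp
  ultimately have "int d dvd (3 * w - 1) * (2 * (int j + 1) - 1)"
    by (simp only: mult_dvd_mono dvd_refl)
  then have "int d dvd (2 * (int j + 1) - 1) * (3 * w - 1)" by (simp only: mult.commute)
  then show ?thesis by (rule that)
qed

lemma prime_inverse_not_mem:
  assumes V: "V \<subseteq> \<P>" and p: "prime p" "p \<notin> V" and x: "x \<in> R_of V"
  shows "of_nat p * x \<noteq> 1"
proof
  assume px: "of_nat p * x = 1"
  obtain a where a: "x = of_int a / of_int (denom x)" by (rule denom_numerator)
  have "of_int (denom x) * x = of_int a" using denom_pos[of x] by (subst (2) a) simp
  then have "of_int (denom x) * (of_nat p * x) = of_nat p * of_int a" by (simp add: mult.left_commute)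
  then have "(of_int (denom x) :: rat) = of_int (int p * a)" unfolding px by simp
  then have "denom x = int p * a" by (simp only: of_int_eq_iff)
  then have "p \<in> denom_primes x" using p(1) by (simp add: denom_primes_def)
  then show False using x p(2) mem_R_of_iff[OF V] by blast
qed

text \<open>
  The common denominator is \<open>(2 * v - 1) * (3 * w - 1)\<close> with \<open>v\<close> and \<open>w\<close> in the ring, which cannot
  vanish as neither \<open>1/2\<close> nor \<open>1/3\<close> is in the ring.
\<close>
lemma rat_definition_imp_open_definition:
  assumes g: "ex_defines_Z g UNIV"
  obtains g' where "\<And>V. V \<subseteq> \<P> \<Longrightarrow> 2 \<notin> V \<Longrightarrow> 3 \<notin> V \<Longrightarrow> ex_defines_Z g' (R_of V)"
proof -
  obtain n where n: "\<And>e e'. (\<And>i. i < n \<Longrightarrow> e i = e' i) \<Longrightarrow> eval_poly g e = eval_poly g e'"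
    by (rule polyfun_finite_dependence[OF polyfun_eval_poly[of g]]) blast
  obtain H :: "(nat \<Rightarrow> rat) \<Rightarrow> rat" where H: "polyfun H"
    "\<And>z. z 1 \<noteq> 0 \<Longrightarrow> H z = 0 \<longleftrightarrow> eval_poly g (case_nat (z 0) (\<lambda>i. z (i + 2) / z 1)) = 0"
    by (rule fraction_zero[OF polyfun_eval_poly[of g]]) blast
  define r where "r z i = (if i = 0 then z 0 else if i = 1 then (2 * z 1 - 1) * (3 * z 2 - 1) else z (i + 1))"
    for z :: "nat \<Rightarrow> rat" and i :: nat
  have "polyfun (\<lambda>z. r z i)" for i
  proof -
    consider "i = 0" | "i = 1" | "i > 1" by linarith
    then show ?thesis
    proof cases
      case 2
      have "polyfun (\<lambda>z. (2 * z 1 - 1) * (3 * z 2 - 1))" by (intro polyfun_intros)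
      then show ?thesis unfolding r_def 2 by simp
    qed (simp_all add: r_def polyfun_var)
  qed
  then have "polyfun (\<lambda>z. H (\<lambda>i. r z i))" by (rule polyfun_compose[OF H(1)])
  then obtain g' where g': "eval_poly g' = (\<lambda>z. H (\<lambda>i. r z i))" by (rule polyfun_is_eval_poly) blast
  show ?thesis
  proof (rule that[of g'])
    fix V assume V: "V \<subseteq> \<P>" "2 \<notin> V" "3 \<notin> V"
    let ?R = "R_of V"
    note sub = is_subringD[OF is_subring_R_of[of V]]
    show "ex_defines_Z g' ?R"
      unfolding ex_defines_Z_def
    proof (intro ballI iffI)
      fix q assume "q \<in> ?R" and q: "q \<in> \<int>"
      obtain y where y: "eval_poly g (case_nat q y) = 0" using ex_defines_ZD[OF g, of q] q by auto
      obtain d :: nat where d: "d > 0" "\<And>i. i < n \<Longrightarrow> of_nat d * y i \<in> \<int>" using clear_denominators by blast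
      obtain v w where vw: "int d dvd (2 * v - 1) * (3 * w - 1)" by (rule divides_denominator_form[OF d(1)])
      then obtain k where k: "(2 * v - 1) * (3 * w - 1) = int d * k" by (elim dvdE)
      define b :: rat where "b = (2 * of_int v - 1) * (3 * of_int w - 1)"
      have bk: "b = of_int k * of_nat d"
      proof -
        have "b = of_int ((2 * v - 1) * (3 * w - 1))" by (simp add: b_def)
        then show ?thesis unfolding k by simp
      qed
      have "2 * v - 1 \<noteq> 0" "3 * w - 1 \<noteq> 0" by presburger+
      then have "(2 * v - 1) * (3 * w - 1) \<noteq> 0" by simp
      then have "k \<noteq> 0" unfolding k by simp
      then have b0: "b \<noteq> 0" unfolding bk using d(1) by simp
      define a where "a i = (if i < n then b * y i else 0)" for i
      have aR: "a i \<in> ?R" for i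
      proof (cases "i < n")
        case True
        then obtain c where "of_nat d * y i = of_int c" using d(2) by (metis Ints_cases)
        then have "b * y i = of_int (k * c)" by (simp add: bk mult.assoc)
        then show ?thesis using sub(7)[of "k * c"] True by (simp add: a_def)
      qed (simp add: a_def sub(2))
      define z where "z = case_nat q (case_nat (of_int v) (case_nat (of_int w) a))"
      have z: "z 0 = q" "z 1 = of_int v" "z 2 = of_int w" "\<And>i. z (i + 3) = a i"
        by (simp_all add: z_def numeral_2_eq_2 numeral_3_eq_3)
      have r: "r z 0 = q" "r z 1 = b" by (simp_all add: r_def b_def z(1) z(2)[simplified] z(3))
      have r2: "r z (i + 2) = a i" for i using z(4)[of i] by (simp add: r_def eval_nat_numeral)
      have "eval_poly g (case_nat (r z 0) (\<lambda>i. r z (i + 2) / r z 1)) = eval_poly g (case_nat q y)"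
        by (rule n) (use b0 in \<open>auto simp: r r(2)[simplified] r2[simplified] a_def split: nat.split\<close>)
      then have "H (\<lambda>i. r z i) = 0" using H(2)[of "r z"] r(2) b0 y by simp
      then have "eval_poly g' z = 0" by (simp add: g')
      then show "\<exists>y. (\<forall>i. y i \<in> ?R) \<and> eval_poly g' (case_nat q y) = 0"
        unfolding z_def using aR sub(7)
        by (intro exI[of _ "case_nat (of_int v) (case_nat (of_int w) a)"]) (auto split: nat.split)
    next
      fix q assume qR: "q \<in> ?R" and "\<exists>y. (\<forall>i. y i \<in> ?R) \<and> eval_poly g' (case_nat q y) = 0"
      then obtain y where y: "\<And>i. y i \<in> ?R" "eval_poly g' (case_nat q y) = 0" by blast
      define z where "z = case_nat q y"
      have zR: "z i \<in> ?R" for i using qR y(1) by (cases i) (auto simp: z_def)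
      have "2 * z 1 \<noteq> 1" using prime_inverse_not_mem[OF V(1) _ V(2) zR[of 1]] by simp
      moreover have "3 * z 2 \<noteq> 1" using prime_inverse_not_mem[OF V(1) _ V(3) zR[of 2]] by simp
      ultimately have "r z 1 \<noteq> 0" by (simp add: r_def)
      moreover have "H (\<lambda>i. r z i) = 0" using y(2) by (simp add: g' z_def)
      ultimately have "eval_poly g (case_nat (r z 0) (\<lambda>i. r z (i + 2) / r z 1)) = 0" using H(2)[of "r z"] by simp
      moreover have "r z 0 = q" by (simp add: r_def z_def)
      ultimately show "q \<in> \<int>" using ex_defines_ZD[OF g, of q] by auto
    qed
  qed
qed

lemma sat_Exists_list:
  "sat R e (foldr Exists is \<phi>) \<longleftrightarrow>
    (\<exists>e'. (\<forall>i\<in>set is. e' i \<in> R) \<and> (\<forall>i. i \<notin> set is \<longrightarrow> e' i = e i) \<and> sat R e' \<phi>)"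
proof (induction "is" arbitrary: e)
  case Nil
  show ?case
  proof
    assume "sat R e (foldr Exists [] \<phi>)"
    then show "\<exists>e'. (\<forall>i\<in>set []. e' i \<in> R) \<and> (\<forall>i. i \<notin> set [] \<longrightarrow> e' i = e i) \<and> sat R e' \<phi>"
      by (intro exI[of _ e]) simp
  next
    assume "\<exists>e'. (\<forall>i\<in>set []. e' i \<in> R) \<and> (\<forall>i. i \<notin> set [] \<longrightarrow> e' i = e i) \<and> sat R e' \<phi>"
    then obtain e' where "\<forall>i. e' i = e i" "sat R e' \<phi>" by auto
    moreover from this have "e' = e" by auto
    ultimately show "sat R e (foldr Exists [] \<phi>)" by simp
  qed
next
  case (Cons i "is")
  show ?case
  proof
    assume "sat R e (foldr Exists (i # is) \<phi>)"
    then obtain a where a: "a \<in> R" "sat R (e(i := a)) (foldr Exists is \<phi>)" by auto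
    then obtain e' where e': "\<forall>j\<in>set is. e' j \<in> R" "\<forall>j. j \<notin> set is \<longrightarrow> e' j = (e(i := a)) j" "sat R e' \<phi>"
      using Cons.IH by blast
    have "e' i \<in> R" using e'(1,2) a(1) by (cases "i \<in> set is") auto
    then show "\<exists>e'. (\<forall>j\<in>set (i # is). e' j \<in> R) \<and> (\<forall>j. j \<notin> set (i # is) \<longrightarrow> e' j = e j) \<and> sat R e' \<phi>"
      using e' by (intro exI[of _ e']) auto
  next
    assume "\<exists>e'. (\<forall>j\<in>set (i # is). e' j \<in> R) \<and> (\<forall>j. j \<notin> set (i # is) \<longrightarrow> e' j = e j) \<and> sat R e' \<phi>"
    then obtain e' where e': "\<forall>j\<in>set (i # is). e' j \<in> R" "\<forall>j. j \<notin> set (i # is) \<longrightarrow> e' j = e j" "sat R e' \<phi>" by blast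
    have "sat R (e(i := e' i)) (foldr Exists is \<phi>)"
      unfolding Cons.IH using e' by (intro exI[of _ e']) auto
    then show "sat R e (foldr Exists (i # is) \<phi>)" using e'(1) by auto
  qed
qed

lemma fvars_Exists_list: "fvars (foldr Exists is \<phi>) = fvars \<phi> - set is"
  by (induction "is") auto

lemma existential_Exists_list: "qfree \<phi> \<Longrightarrow> existential (foldr Exists is \<phi>)"
  by (induction "is") (auto intro: existential.intros)

lemma finite_tvars: "finite (tvars t)"
  by (induction t) auto

text \<open>
  The formula says that there are a nonzero denominator and numerators that give a zero of \<open>g\<close>. The trivial
  equation for the variable of index \<open>0\<close> ensures that it occurs free.
\<close>
lemma rat_definition_imp_formula:
  assumes g: "ex_defines_Z g UNIV"
  obtains \<phi> where "existential \<phi>" "\<And>R. is_subring R \<Longrightarrow> fm_defines_Z \<phi> 0 R"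
proof -
  obtain n where n: "\<And>e e'. (\<And>i. i < n \<Longrightarrow> e i = e' i) \<Longrightarrow> eval_poly g e = eval_poly g e'"
    by (rule polyfun_finite_dependence[OF polyfun_eval_poly[of g]]) blast
  obtain H :: "(nat \<Rightarrow> rat) \<Rightarrow> rat" where H: "polyfun H"
    "\<And>z. z 1 \<noteq> 0 \<Longrightarrow> H z = 0 \<longleftrightarrow> eval_poly g (case_nat (z 0) (\<lambda>i. z (i + 2) / z 1)) = 0"
    by (rule fraction_zero[OF polyfun_eval_poly[of g]]) blast
  obtain t where t: "\<And>e. tval e t = H e" using H(1) unfolding polyfun_def by blast
  obtain K0 where "\<forall>i\<in>tvars t. i \<le> K0"
    using finite_tvars[of t] unfolding finite_nat_set_iff_bounded_le by blast
  \<comment> \<open>All variables of \<open>t\<close> have index below \<open>K\<close>, as do the \<open>n\<close> numerators, which start at index 2.\<close>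
  define K where "K = max (Suc K0) (n + 2)"
  have K: "i \<in> tvars t \<Longrightarrow> i < K" for i
    using \<open>\<forall>i\<in>tvars t. i \<le> K0\<close> by (auto simp: K_def less_max_iff_disj less_Suc_eq_le)
  have K2: "1 < K" "n + 2 \<le> K" by (auto simp: K_def)
  define \<psi> where "\<psi> = Conj (Eq (Var 0) (Var 0)) (Conj (Neg (Eq (Var 1) Zero)) (Eq t Zero))"
  define \<phi> where "\<phi> = foldr Exists [1..<K] \<psi>"
  show ?thesis
  proof (rule that[of \<phi>])
    show "existential \<phi>" unfolding \<phi>_def \<psi>_def by (rule existential_Exists_list) simp
    fix R assume R: "is_subring R"
    note sub = is_subringD[OF R]
    have fv: "fvars \<phi> = {0}"
      unfolding \<phi>_def fvars_Exists_list \<psi>_def using K K2(1) by (auto simp: not_less Suc_le_eq)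
    have "sat R e \<phi> \<longleftrightarrow> e 0 \<in> \<int>" if e: "\<forall>i. e i \<in> R" for e
    proof
      assume "sat R e \<phi>"
      then obtain e' where e': "\<forall>i. i \<notin> set [1..<K] \<longrightarrow> e' i = e i" "sat R e' \<psi>"
        unfolding \<phi>_def sat_Exists_list by blast
      have "e' 1 \<noteq> 0" "H e' = 0" using e'(2) t by (auto simp: \<psi>_def)
      then have "eval_poly g (case_nat (e' 0) (\<lambda>i. e' (i + 2) / e' 1)) = 0" using H(2) by blast
      moreover have "e' 0 = e 0" using e'(1) by simp
      ultimately show "e 0 \<in> \<int>" using ex_defines_ZD[OF g, of "e 0"] by auto
    next
      assume e0: "e 0 \<in> \<int>"
      obtain y where y: "eval_poly g (case_nat (e 0) y) = 0" using ex_defines_ZD[OF g, of "e 0"] e0 by auto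
      obtain d :: nat where d: "d > 0" "\<And>i. i < n \<Longrightarrow> of_nat d * y i \<in> \<int>" using clear_denominators by blast
      define e' where "e' i = (if i = 0 \<or> i \<ge> K then e i else if i = 1 then of_nat d
        else if i - 2 < n then of_nat d * y (i - 2) else 0)" for i
      have e'R: "e' i \<in> R" for i
      proof -
        have "of_nat d * y (i - 2) \<in> R" if "i - 2 < n" using d(2)[OF that] sub(7) by (auto elim!: Ints_cases)
        then show ?thesis using e sub(2,8) by (auto simp: e'_def)
      qed
      have e'1: "e' 1 = of_nat d" "e' 0 = e 0" using K2(1) by (simp_all add: e'_def)
      have e'2: "e' (i + 2) / e' 1 = y i" if "i < n" for i
        using that K2(2) d(1) by (simp add: e'1 e'_def)
      have "eval_poly g (case_nat (e' 0) (\<lambda>i. e' (i + 2) / e' 1)) = eval_poly g (case_nat (e 0) y)"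
      proof (rule n)
        fix i assume "i < n"
        then show "case_nat (e' 0) (\<lambda>i. e' (i + 2) / e' 1) i = case_nat (e 0) y i"
          using e'1(2) e'2 by (cases i) auto
      qed
      then have "H e' = 0" using H(2)[of e'] e'1(1) d(1) y by simp
      then have "sat R e' \<psi>" using e'1(1) d(1) by (simp add: \<psi>_def t)
      moreover have "e' i = e i" if "i \<notin> set [1..<K]" for i using that by (auto simp: e'_def)
      ultimately show "sat R e \<phi>" unfolding \<phi>_def sat_Exists_list using e'R by blast
    qed
    then show "fm_defines_Z \<phi> 0 R" unfolding fm_defines_Z_def using fv by blast
  qed
qed

lemma formula_imp_rat_definition:
  assumes \<phi>: "existential \<phi>" "fm_defines_Z \<phi> v UNIV"
  obtains g where "ex_defines_Z g UNIV"
proof -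
  obtain g where g: "\<And>q. sat UNIV (\<lambda>_. q) \<phi> \<longleftrightarrow> (\<exists>y. eval_poly g (case_nat q y) = 0)"
    by (rule diophantine_to_poly[OF diophantine_existential[OF \<phi>(1)]]) blast
  have "sat UNIV (\<lambda>_. q) \<phi> \<longleftrightarrow> q \<in> \<int>" for q using \<phi>(2) by (simp add: fm_defines_Z_def)
  then have "ex_defines_Z g UNIV" unfolding ex_defines_Z_def using g by simp
  then show ?thesis using that by blast
qed

lemma Primes_mem_E_class_iff: "\<P> \<in> E_class \<longleftrightarrow> (\<exists>g. ex_defines_Z g UNIV)"
  by (simp add: E_class_def Z_ex_definable_def R_of_Primes)

theorem theorem5p6:
  shows
    "(\<not> meager_in cantor_top E_class \<longleftrightarrow>
       (\<exists>\<sigma>\<in>fin_strings. \<exists>g. \<forall>V\<in>basic_open \<sigma>. HTP_generic V \<longrightarrow> ex_defines_Z g (R_of V)))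
     \<and> ((\<exists>\<sigma>\<in>fin_strings. \<exists>g. \<forall>V\<in>basic_open \<sigma>. HTP_generic V \<longrightarrow> ex_defines_Z g (R_of V))
         \<longleftrightarrow> \<P> \<in> E_class)
     \<and> (\<P> \<in> E_class \<longleftrightarrow>
         (\<exists>\<phi> v. existential \<phi> \<and> (\<forall>R. is_subring R \<longrightarrow> fm_defines_Z \<phi> v R)))"
    (is "(?one \<longleftrightarrow> ?two) \<and> (?two \<longleftrightarrow> ?three) \<and> (?three \<longleftrightarrow> ?four)")
proof -
  have "?two" if "?one"
    using nonmeager_imp_generic_definition[OF that] by metis
  moreover have "?three" if two: "?two"
  proof -
    obtain \<sigma> g where \<sigma>: "\<sigma> \<in> fin_strings"
      and g: "\<And>V. V \<in> basic_open \<sigma> \<Longrightarrow> HTP_generic V \<Longrightarrow> ex_defines_Z g (R_of V)"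
      using two by blast
    define S where "S = {p. \<sigma> p = Some False}"
    have "S \<subseteq> dom \<sigma>" by (auto simp: S_def)
    then have "finite S" "S \<subseteq> \<P>" using \<sigma> finite_subset unfolding fin_strings_def by blast+
    then obtain g' where "ex_defines_Z g' UNIV"
      using semilocal_definition_imp_rat_definition
        generic_definition_imp_semilocal_definition[OF \<sigma> g S_def] by blast
    then show ?thesis unfolding Primes_mem_E_class_iff by blast
  qed
  moreover have "?one" if three: "?three"
  proof
    assume meager: "meager_in cantor_top E_class"
    obtain g where "ex_defines_Z g UNIV" using three unfolding Primes_mem_E_class_iff by blast
    then obtain g' where g': "\<And>V. V \<subseteq> \<P> \<Longrightarrow> 2 \<notin> V \<Longrightarrow> 3 \<notin> V \<Longrightarrow> ex_defines_Z g' (R_of V)"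
      by (rule rat_definition_imp_open_definition) blast
    obtain W where W: "W \<subseteq> \<P>" "agree 3 {} W" "W \<notin> E_class"
      by (rule meager_no_open[OF meager, of "{}" 3]) auto
    have "2 \<notin> W" "3 \<notin> W" using W(2) by (auto simp: agree_def)
    then have "ex_defines_Z g' (R_of W)" by (rule g'[OF W(1)])
    then show False using W(1,3) by (auto simp: E_class_def Z_ex_definable_def)
  qed
  moreover have "?four" if three: "?three"
  proof -
    obtain g where "ex_defines_Z g UNIV" using three unfolding Primes_mem_E_class_iff by blast
    then obtain \<phi> where "existential \<phi>" "\<And>R. is_subring R \<Longrightarrow> fm_defines_Z \<phi> 0 R"
      by (rule rat_definition_imp_formula) blast
    then show ?thesis by blast
  qed
  moreover have "?three" if four: "?four"
  proof -
    obtain \<phi> v where \<phi>: "existential \<phi>" "\<And>R. is_subring R \<Longrightarrow> fm_defines_Z \<phi> v R" using four by blast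
    have "is_subring UNIV" by (simp add: is_subring_def)
    then show ?thesis
      unfolding Primes_mem_E_class_iff using formula_imp_rat_definition[OF \<phi>(1) \<phi>(2)] by blast
  qed
  ultimately show ?thesis by blast
qed

end
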